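(* Let $\mathbf{\Phi}$ be the matrix-valued kernel built from the Wendland functions $\psi_{\tau+1},\psi_{\tau-1}$ and let $\mathbf{\Phi}_\delta$ be the scaled kernel with a positive scaling factor $\delta$ (definitions in the context). Let $X=\{\mathbf{x}_1,\dots,\mathbf{x}_M\}$ be a set of pairwise distinct interior centres $\mathbf{x}_1,\dots,\mathbf{x}_N\in\Omega$ and boundary centres $\mathbf{x}_{N+1},\dots,\mathbf{x}_M\in\partial\Omega$, with separation distance $q_X$. Then the smallest eigenvalue of the symmetric collocation matrix $\mathbf{A}_\delta$ for the Stokes problem can be bounded by $$\lambda_{\min}(\mathbf{A}_\delta)\ge C\left(\frac{q_X}{\delta}\right)^{2\tau+2}q_X^{-d-2},$$ where the constant $C>0$ is independent of the point set $X$.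
   Context: $\Omega\subset\mathbb{R}^d$ ($d\ge2$) is a bounded domain, $\nu>0$ is the viscosity. $q_X=\frac12\min_{j\ne k}\|\mathbf{x}_j-\mathbf{x}_k\|_2$. **Wendland functions.** For $k\in\mathbb{N}$ and $\ell=\lfloor d/2\rfloor+k+1$, $\psi_{\ell,k}(r)=\frac{1}{\Gamma(k)2^{k-1}}\int_r^1s(1-s)^\ell(s^2-r^2)^{k-1}\mathrm{d}s$ for $0\le r\le1$ and $\psi_{\ell,k}(r)=0$ for $r>1$. The function $\mathbf{x}\mapsto\psi_{\ell,k}(\|\mathbf{x}\|_2)$ on $\mathbb{R}^d$ is positive definite and its Fourier transform lies between two positive multiples of $(1+\|\boldsymbol\omega\|_2^2)^{-\frac{d+1}{2}-k}$. **Kernels.** $\psi_{\tau-1}$ and $\psi_{\tau+1}$ denote the Wendland functions with smoothness parameters $k$ and $k+2$ respectively (each with its corresponding $\ell$), where $k\ge2$ and $\tau=\frac{d+3}{2}+k$, so that $\widehat{\psi_{\tau\pm1}}$ is comparable with $(1+\|\boldsymbol\omega\|_2^2)^{-\tau\mp1}$. They are regarded as radial functions on $\mathbb{R}^d$. For $\delta>0$, $\psi_{\tau\pm1,\delta}(\mathbf{x})=\delta^{-d}\psi_{\tau\pm1}(\|\mathbf{x}\|_2/\delta)$, $\mathbf{\Psi}_{\tau+1,\delta}=(-\Delta\mathbf{I}+\nabla\nabla^T)\psi_{\tau+1,\delta}$, $\mathbf{\Phi}_\delta=\begin{pmatrix}\mathbf{\Psi}_{\tau+1,\delta}&0\\0&\psi_{\tau-1,\delta}\end{pmatrix}:\mathbb{R}^d\to\mathbb{R}^{(d+1)\times(d+1)}$,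 and $\mathbf{\Phi}=\mathbf{\Phi}_1$. **Collocation matrix.** For $\mathbf{v}=(v_1,\dots,v_{d+1})$ put $(L\mathbf{v})_i=-\nu\sum_{j=1}^d\partial_{jj}v_i+\partial_iv_{d+1}$, $1\le i\le d$. Define functionals, for $1\le i\le d$: $\xi_{i,j}(\mathbf{v})=(L\mathbf{v})_i(\mathbf{x}_j)$ for $1\le j\le N$ and $\xi_{i,j}(\mathbf{v})=v_i(\mathbf{x}_j)$ for $N+1\le j\le M$. Then $\mathbf{A}_\delta$ is the symmetric positive definite $dM\times dM$ matrix with entries $\xi_{i,j}\,\xi_{i',k}^{\mathbf{y}}\mathbf{\Phi}_\delta(\mathbf{x}-\mathbf{y})$, where $\xi_{i',k}^{\mathbf{y}}$ acts on each row of $\mathbf{\Phi}_\delta(\mathbf{x}-\mathbf{y})$ as a function of $\mathbf{y}$, producing an $\mathbb{R}^{d+1}$-valued function of $\mathbf{x}$, to which $\xi_{i,j}$ is then applied. *)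

theory Defs
  imports "HOL-Analysis.Analysis" "Jordan_Normal_Form.Spectral_Radius"
begin

no_notation Matrix.vec_index (infixl \<open>$\<close> 100)

definition wendland :: "nat \<Rightarrow> nat \<Rightarrow> real \<Rightarrow> real" where
  "wendland l k r =
     (if r \<le> 1
      then 1 / (Gamma (real k) * 2 ^ (k - 1)) *
           integral {r..1} (\<lambda>s. s * (1 - s) ^ l * (s\<^sup>2 - r\<^sup>2) ^ (k - 1))
      else 0)"

text \<open>The scaled radial function \<open>\<delta>\<^sup>-\<^sup>d \<psi>(\<parallel>x\<parallel> / \<delta>)\<close> on \<open>\<real>\<^sup>d\<close>, \<open>d = CARD('n)\<close>, for the Wendland
  function with smoothness parameter \<open>k\<close>. With \<open>\<tau> = (d + 3) / 2 + k\<close>, the function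
  \<open>\<psi>\<close> with index \<open>\<tau> - 1\<close> has parameter \<open>k\<close>, the one with index \<open>\<tau> + 1\<close> has parameter \<open>k + 2\<close>.\<close>
definition scaled_wendland :: "nat \<Rightarrow> real \<Rightarrow> real ^ 'n \<Rightarrow> real" where
  "scaled_wendland k \<delta> x =
     wendland (CARD('n) div 2 + k + 1) k (norm x / \<delta>) / \<delta> ^ CARD('n)"

definition pderiv_at :: "'n \<Rightarrow> (real ^ 'n \<Rightarrow> real) \<Rightarrow> real ^ 'n \<Rightarrow> real" where
  "pderiv_at i f x = deriv (\<lambda>t. f (x + t *\<^sub>R axis i 1)) 0"

definition laplacian :: "(real ^ 'n::finite \<Rightarrow> real) \<Rightarrow> real ^ 'n \<Rightarrow> real" where
  "laplacian f x = (\<Sum>j\<in>UNIV. pderiv_at j (pderiv_at j f) x)"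

definition div_free_kernel :: "(real ^ 'n::finite \<Rightarrow> real) \<Rightarrow> real ^ 'n \<Rightarrow> real ^ 'n ^ 'n" where
  "div_free_kernel \<psi> x =
     (\<chi> i j. - (if i = j then laplacian \<psi> x else 0) + pderiv_at i (pderiv_at j \<psi>) x)"

text \<open>Velocity-pressure vectors live in \<open>real ^ ('n option)\<close>: component \<open>Some i\<close> is the velocity
  component \<open>v\<^sub>i\<close> and component \<open>None\<close> is the pressure \<open>v\<close> with index \<open>d + 1\<close>.\<close>
definition stokes_kernel ::
    "nat \<Rightarrow> real \<Rightarrow> real ^ 'n::finite \<Rightarrow> real ^ ('n option) ^ ('n option)" where
  "stokes_kernel k \<delta> x =
     (\<chi> a b. case (a, b) of
        (Some i, Some j) \<Rightarrow> div_free_kernel (scaled_wendland (k + 2) \<delta>) x $ i $ j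
      | (None, None) \<Rightarrow> scaled_wendland k \<delta> x
      | _ \<Rightarrow> 0)"

definition stokes_op ::
    "real \<Rightarrow> (real ^ 'n::finite \<Rightarrow> real ^ ('n option)) \<Rightarrow> 'n \<Rightarrow> real ^ 'n \<Rightarrow> real" where
  "stokes_op \<nu> v i x =
     - \<nu> * laplacian (\<lambda>z. v z $ Some i) x + pderiv_at i (\<lambda>z. v z $ None) x"

definition colloc_functional ::
    "real \<Rightarrow> nat \<Rightarrow> (nat \<Rightarrow> real ^ 'n::finite) \<Rightarrow> 'n \<Rightarrow> nat \<Rightarrow>
     (real ^ 'n \<Rightarrow> real ^ ('n option)) \<Rightarrow> real" where
  "colloc_functional \<nu> N x i j v =
     (if j \<le> N then stokes_op \<nu> v i (x j) else v (x j) $ Some i)"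

definition colloc_entry ::
    "nat \<Rightarrow> real \<Rightarrow> real \<Rightarrow> nat \<Rightarrow> (nat \<Rightarrow> real ^ 'n::finite) \<Rightarrow> 'n \<Rightarrow> nat \<Rightarrow> 'n \<Rightarrow> nat \<Rightarrow> real" where
  "colloc_entry k \<delta> \<nu> N x i j i' j' =
     colloc_functional \<nu> N x i j
       (\<lambda>y. \<chi> a. colloc_functional \<nu> N x i' j' (\<lambda>z. stokes_kernel k \<delta> (y - z) $ a))"

text \<open>The pairs \<open>(i, j)\<close> of a coordinate and a centre index \<open>1 \<le> j \<le> M\<close> are enumerated by
  \<open>{0..<d * M}\<close>; on the finite index type \<open>from_nat_into UNIV\<close> restricts to a bijection
  from \<open>{0..<d}\<close>. The choice of enumeration does not affect the eigenvalues.\<close>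
definition colloc_matrix ::
    "nat \<Rightarrow> real \<Rightarrow> real \<Rightarrow> nat \<Rightarrow> nat \<Rightarrow> (nat \<Rightarrow> real ^ 'n::finite) \<Rightarrow> real Matrix.mat" where
  "colloc_matrix k \<delta> \<nu> N M x =
     Matrix.mat (CARD('n) * M) (CARD('n) * M)
       (\<lambda>(r, c). colloc_entry k \<delta> \<nu> N x
          (from_nat_into UNIV (r mod CARD('n))) (r div CARD('n) + 1)
          (from_nat_into UNIV (c mod CARD('n))) (c div CARD('n) + 1))"

text \<open>Meaningful when the spectrum is nonempty, in particular for real symmetric matrices of
  positive dimension.\<close>
definition lambda_min :: "real Matrix.mat \<Rightarrow> real" where
  "lambda_min A = Min (spectrum A)"

text \<open>Meaningful for at least two centres.\<close>
definition separation_distance :: "nat \<Rightarrow> (nat \<Rightarrow> real ^ 'n::finite) \<Rightarrow> real" where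
  "separation_distance M x =
     1 / 2 * Min {norm (x j - x k) | j k. j \<in> {1..M} \<and> k \<in> {1..M} \<and> j \<noteq> k}"

end

theory Submission
  imports Defs "HOL-Probability.Probability" "HOL-Real_Asymp.Real_Asymp"
begin

text \<open>The quadratic form of the collocation matrix is a Fourier integral of the
  densities of the two Wendland functions against nonnegative weights, so it is monotone in these
  densities. The Wendland function with support radius \<open>T\<close> has the explicit positive density
  \<open>B(T, \<bar>\<omega>\<bar>)\<close>, where \<open>B(\<cdot>, w)\<close> is the \<open>\<ell>\<close>-fold convolution power of \<open>t \<mapsto> (1 - cos (w t)) / w\<^sup>2\<close>
  (compare Laplace transforms in \<open>T\<close>: both sides are multiples of \<open>(p (p\<^sup>2 + w\<^sup>2))\<close> to the power \<open>-\<ell>\<close>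
  integrated against \<open>cos (\<omega> \<cdot> x)\<close>). Since \<open>B(T, w)\<close> is comparable with \<open>(1 + w\<^sup>2)\<close> to the power
  \<open>-\<ell>\<close>, it dominates a multiple of \<open>s\<close> to the power \<open>1 - \<ell>\<close> times \<open>B(s, w)\<close> for all \<open>s \<le> T\<close>: the
  form at scale \<open>\<delta>\<close> dominates the form at a scale \<open>s < 2 q\<^sub>X\<close> comparable with \<open>q\<^sub>X\<close>. There the supports of
  distinct centres are disjoint, the matrix is block diagonal, and its blocks are explicit.
  For even \<open>d\<close> the function is regarded as the restriction of its analogue on \<open>\<real>\<^sup>d \<times> \<real>\<close>, which has the
  same \<open>\<ell>\<close>; this makes \<open>\<ell>\<close> and all exponents integers.\<close>

text \<open>The Laplace comparison closes because of the exact value of the Wendland index. With n =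
  2 (d div 2) + 1 and smoothness k it satisfies 2 l = n + 2 k + 1. The polynomial (t - s)^l then
  transforms to a multiple of p^(-l-1), subordination gives back one p, and the remaining profile
  has (p^2 + w^2)^(-l) as its spectral density. All exponents equal l, so an l-th convolution power
  appears. The obstacle to a lower bound is that \<open>osc\<close> has zeros: a single factor
  admits no pointwise bound below. From two factors on, averaging removes the zeros. Interior
  unknowns are controlled by the pressure kernel alone and boundary unknowns by the velocity kernel;
  the interior velocity blocks merely contribute something nonnegative. Comparing scales costs
  s^(-m), while second derivatives at 0 scale like s^(m + 1 + 2 k'), with k' = k + 1 for velocity
  and k' = k - 1 for pressure. The net rates are s^(2k+3) and s^(2k-1). The first is the weaker one
  for small s, and 2 k + 3 = (2 \<tau> + 2) - (d + 2).\<close>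

no_notation scalar_prod (infix \<open>\<bullet>\<close> 70)

section \<open>Convolution powers of an oscillating kernel\<close>

text \<open>The form with \<open>sinc\<close> builds in the value t^2 / 2 at w = 0 and makes joint
  continuity in w and t immediate; the quotient form \<open>osc_altdef\<close> holds for nonzero
  w.\<close>

definition osc :: "real \<Rightarrow> real \<Rightarrow> real" where
  "osc w t = t\<^sup>2 / 2 * (sinc (w * t / 2))\<^sup>2"

text \<open>\<open>osc_conv l w\<close> is the \<open>(l + 1)\<close>-fold convolution power of \<open>osc w\<close> on \<open>[0, \<infinity>)\<close>; the convolution
  integral is rescaled to \<open>[0, 1]\<close> so that joint continuity in \<open>w\<close> and \<open>t\<close> is immediate.\<close>

fun osc_conv :: "nat \<Rightarrow> real \<Rightarrow> real \<Rightarrow> real" where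
  "osc_conv 0 w t = osc w t"
| "osc_conv (Suc l) w t = t * integral {0..1} (\<lambda>u. osc w (t * (1 - u)) * osc_conv l w (t * u))"

lemma osc_nonneg: "osc w t \<ge> 0"
  by (simp add: osc_def)

lemma osc_altdef: "w \<noteq> 0 \<Longrightarrow> osc w t = (1 - cos (w * t)) / w\<^sup>2"
  using cos_double_sin[of "w * t / 2"]
  by (auto simp: osc_def power2_eq_square field_simps)

lemma abs_sinc_le_1: "\<bar>sinc x\<bar> \<le> 1"
  using abs_sin_x_le_abs_x[of x] by (auto simp: divide_le_eq_1)

text \<open>Two bounds are added: \<open>\<bar>sinc\<bar> \<le> 1\<close> gives t^2 / 2, and 1 - cos
  \<le> 2 gives 2 after multiplication by w^2.\<close>

lemma osc_le: "(1 + w\<^sup>2) * osc w t \<le> 2 * (1 + t\<^sup>2)"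
proof -
  have "(sinc (w * t / 2))\<^sup>2 \<le> 1"
    using abs_sinc_le_1 abs_square_le_1 by blast
  then have a: "osc w t \<le> t\<^sup>2 / 2"
    unfolding osc_def by (intro mult_left_le) auto
  have b: "w\<^sup>2 * osc w t \<le> 2"
  proof (cases "w = 0")
    case False
    have "w\<^sup>2 * osc w t = 1 - cos (w * t)" using False by (simp add: osc_altdef)
    then show ?thesis using cos_ge_minus_one[of "w * t"] by linarith
  qed auto
  have "t\<^sup>2 \<ge> 0" by simp
  with a b show ?thesis by (simp only: ring_distribs)
qed

lemma osc_scale: "osc w (t * u) = t\<^sup>2 * osc (w * t) u"
  by (simp add: osc_def power_mult_distrib mult_ac)

lemma continuous_on_osc [continuous_intros]:
  assumes "continuous_on A f" "continuous_on A g"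
  shows "continuous_on A (\<lambda>x. osc (f x) (g x))"
  unfolding osc_def by (intro continuous_intros assms) auto

text \<open>Joint continuity is the form that the induction can carry through a parameter integral;
  it also yields the joint measurability used in the Fubini arguments.\<close>

lemma continuous_on_osc_conv_pair:
  "continuous_on UNIV (\<lambda>p::real \<times> real. osc_conv l (fst p) (snd p))"
proof (induction l)
  case 0
  show ?case by (auto intro!: continuous_on_osc continuous_intros)
next
  case (Suc l)
  have "continuous_on (UNIV::(real\<times>real) set) (\<lambda>p. integral (cbox 0 1) (\<lambda>u. osc (fst p) (snd p * (1 - u)) * osc_conv l (fst p) (snd p * u)))"
  proof (rule integral_continuous_on_param)
    have "continuous_on UNIV (\<lambda>x::(real\<times>real)\<times>real. osc_conv l (fst (fst x)) (snd (fst x) * snd x))"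
    proof -
      have "continuous_on UNIV (\<lambda>x::(real\<times>real)\<times>real. (fst (fst x), snd (fst x) * snd x))"
        by (intro continuous_intros)
      from continuous_on_compose2[OF Suc this] show ?thesis by simp
    qed
    then have "continuous_on (UNIV \<times> cbox 0 1) (\<lambda>x::(real\<times>real)\<times>real. osc_conv l (fst (fst x)) (snd (fst x) * snd x))"
      by (rule continuous_on_subset) auto
    then show "continuous_on (UNIV \<times> cbox 0 1) (\<lambda>(p, u). osc (fst p) (snd p * (1 - u)) * osc_conv l (fst p) (snd p * u))"
      unfolding case_prod_unfold
      by (intro continuous_intros)
  qed
  then show ?case unfolding osc_conv.simps by (intro continuous_intros) auto
qed

lemma continuous_on_osc_conv [continuous_intros]:
  assumes "continuous_on A f" "continuous_on A g"
  shows "continuous_on A (\<lambda>x. osc_conv l (f x) (g x))"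
proof -
  have "continuous_on A (\<lambda>x. (f x, g x))"
    by (intro continuous_intros assms)
  from continuous_on_compose2[OF continuous_on_osc_conv_pair this] show ?thesis by simp
qed

lemma osc_conv_borel [measurable]:
  assumes [measurable]: "f \<in> borel_measurable M" "g \<in> borel_measurable M"
  shows "(\<lambda>x. osc_conv l (f x) (g x)) \<in> borel_measurable M"
proof -
  have "(\<lambda>p::real\<times>real. osc_conv l (fst p) (snd p)) \<in> borel_measurable borel"
    by (intro borel_measurable_continuous_onI continuous_intros)
  from measurable_compose[OF _ this, of "\<lambda>x. (f x, g x)"] show ?thesis
    by (simp add: borel_prod[symmetric])
qed

section \<open>Upper bound and scaling law of the convolution powers\<close>

lemma osc_conv_integrable:
  "(\<lambda>u. osc w (t * (1 - u)) * osc_conv l w (t * u)) integrable_on {a..b}"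
  by (intro integrable_continuous_interval continuous_intros)

lemma osc_conv_nonneg: "t \<ge> 0 \<Longrightarrow> osc_conv l w t \<ge> 0"
proof (induction l arbitrary: t)
  case (Suc l)
  have "0 \<le> integral {0..1} (\<lambda>u. osc w (t * (1 - u)) * osc_conv l w (t * u))"
  proof (rule integral_nonneg[OF osc_conv_integrable])
    fix u :: real assume "u \<in> {0..1}"
    then show "0 \<le> osc w (t * (1 - u)) * osc_conv l w (t * u)"
      using Suc by (simp add: osc_nonneg)
  qed
  then show ?case using Suc.prems by simp
qed (simp add: osc_nonneg)

text \<open>Each convolution contributes a prefactor t, and each of the l + 1 copies of
  \<open>osc\<close> a factor from \<open>osc_le\<close>. The power of t is kept apart from T
  because it becomes the factor \<open>s ^ Suc l\<close> when scales are compared.\<close>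

lemma osc_conv_le:
  assumes "0 \<le> t" "t \<le> T"
  shows "osc_conv l w t \<le> t ^ l * (2 * (1 + T\<^sup>2) / (1 + w\<^sup>2)) ^ Suc l"
  using assms
proof (induction l arbitrary: t)
  case (0 t)
  have "osc w t \<le> 2 * (1 + t\<^sup>2) / (1 + w\<^sup>2)"
    using osc_le[of w t] by (simp add: field_simps add_pos_nonneg)
  also have "\<dots> \<le> 2 * (1 + T\<^sup>2) / (1 + w\<^sup>2)"
    using 0 by (intro divide_right_mono) auto
  finally show ?case by simp
next
  case (Suc l t)
  let ?K = "2 * (1 + T\<^sup>2) / (1 + w\<^sup>2)"
  have K: "?K \<ge> 0" by simp
  have "integral {0..1} (\<lambda>u. osc w (t * (1 - u)) * osc_conv l w (t * u)) \<le> integral {0..1} (\<lambda>u::real. ?K * (t ^ l * ?K ^ Suc l))"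
  proof (intro integral_le osc_conv_integrable integrable_const_ivl)
    fix u :: real assume u: "u \<in> {0..1}"
    have tu: "0 \<le> t * u" "t * u \<le> t" "0 \<le> t * (1 - u)" "t * (1 - u) \<le> t"
      using u Suc.prems by (auto intro: mult_left_le mult_nonneg_nonneg)
    have "osc w (t * (1 - u)) \<le> 2 * (1 + (t * (1 - u))\<^sup>2) / (1 + w\<^sup>2)"
      using osc_le[of w "t * (1 - u)"] by (simp add: field_simps add_pos_nonneg)
    also have "\<dots> \<le> ?K"
      using tu Suc.prems by (intro divide_right_mono) auto
    finally have a: "osc w (t * (1 - u)) \<le> ?K" .
    have "osc_conv l w (t * u) \<le> (t * u) ^ l * ?K ^ Suc l"
      using tu Suc.prems by (intro Suc.IH) auto
    also have "\<dots> \<le> t ^ l * ?K ^ Suc l"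
      using tu K by (intro mult_right_mono power_mono) auto
    finally have b: "osc_conv l w (t * u) \<le> t ^ l * ?K ^ Suc l" .
    show "osc w (t * (1 - u)) * osc_conv l w (t * u) \<le> ?K * (t ^ l * ?K ^ Suc l)"
      using a b tu K by (intro mult_mono osc_conv_nonneg) auto
  qed
  then have "osc_conv (Suc l) w t \<le> t * (?K * (t ^ l * ?K ^ Suc l))"
    using Suc.prems by (simp add: mult_left_mono del: power_Suc times_divide_eq_left times_divide_eq_right)
  then show ?case by (simp only: power_Suc mult_ac)
qed

text \<open>The exponent counts t^2 for each of the l + 1 copies of \<open>osc\<close> and t for
  each of the l convolutions.\<close>

lemma osc_conv_scale: "osc_conv l w (t * s) = t ^ (3 * l + 2) * osc_conv l (w * t) s"
proof (induction l arbitrary: s)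
  case 0 then show ?case using osc_scale[of w t s] by (simp add: power2_eq_square)
next
  case (Suc l)
  have *: "osc w (t * s * (1 - u)) * osc_conv l w (t * s * u)
     = t ^ (3 * l + 4) * (osc (w * t) (s * (1 - u)) * osc_conv l (w * t) (s * u))" for u
    using osc_scale[of w t "s * (1 - u)"] Suc[of "s * u"]
    by (simp add: mult_ac power_add eval_nat_numeral)
  show ?case unfolding osc_conv.simps *
    by (simp add: mult_ac power_add eval_nat_numeral)
qed

section \<open>Lower bounds for the convolution powers\<close>

lemma osc_lower:
  shows "\<exists>c>0. \<forall>w u. \<bar>w\<bar> \<le> 6 \<longrightarrow> 0 \<le> u \<longrightarrow> u \<le> 1 \<longrightarrow> osc w u \<ge> c * u\<^sup>2"
proof -
  \<comment> \<open>The argument w * u / 2 stays in [-3, 3], which lies inside (-pi, pi), where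
    \<open>sinc\<close> is positive; compactness then gives a positive minimum.\<close>
  obtain y0 where y0: "y0 \<in> {-3..3::real}" "\<And>y. y \<in> {-3..3} \<Longrightarrow> sinc y0 \<le> sinc y"
    using continuous_attains_inf[of "{-3..3::real}" sinc] continuous_on_sinc[of "{-3..3}" "\<lambda>x. x"]
    by (auto intro: continuous_intros)
  have pos: "sinc y > 0" if "y \<in> {-3..3}" for y
  proof (cases "y > 0")
    case True
    then have "sin y > 0" using that pi_gt3 by (intro sin_gt_zero) auto
    then show ?thesis using True by simp
  next
    case False
    show ?thesis
    proof (cases "y = 0")
      case False
      with \<open>\<not> y > 0\<close> have "sin (-y) > 0" using that pi_gt3 by (intro sin_gt_zero) auto
      then show ?thesis using False \<open>\<not> y > 0\<close> by (simp add: divide_neg_neg)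
    qed auto
  qed
  let ?c = "(sinc y0)\<^sup>2 / 2"
  have "?c > 0" using pos[OF y0(1)] by (simp add: zero_less_power)
  moreover have "osc w u \<ge> ?c * u\<^sup>2" if "\<bar>w\<bar> \<le> 6" "0 \<le> u" "u \<le> 1" for w u
  proof -
    have "\<bar>w * u\<bar> \<le> 6 * 1" unfolding abs_mult using that by (intro mult_mono) auto
    then have "sinc y0 \<le> sinc (w * u / 2)" by (intro y0(2)) auto
    then have "(sinc y0)\<^sup>2 \<le> (sinc (w * u / 2))\<^sup>2"
      using pos[OF y0(1)] by (intro power_mono) auto
    then show ?thesis unfolding osc_def
      by (simp add: mult.commute mult_left_mono)
  qed
  ultimately show ?thesis by blast
qed

text \<open>For large w the function \<open>osc w\<close> has zeros in the interval, but its mean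
  does not degenerate. The threshold 6 makes the oscillating term sin (w / 2) / w at most 1/6,
  leaving 1/2 - 1/6.\<close>

lemma osc_avg_lower:
  assumes "\<bar>w\<bar> \<ge> 6"
  shows "integral {1/2..1} (\<lambda>u. osc w (1 - u)) \<ge> 1 / 3 / w\<^sup>2"
proof -
  have w: "w \<noteq> 0" using assms by auto
  have "((\<lambda>u. (1 - cos (w * (1 - u))) / w\<^sup>2) has_integral
         ((1 + sin (w * (1 - 1)) / w) / w\<^sup>2 - (1/2 + sin (w * (1 - 1/2)) / w) / w\<^sup>2)) {1/2..1}"
    by (rule fundamental_theorem_of_calculus)
       (auto intro!: derivative_eq_intros simp: has_real_derivative_iff_has_vector_derivative[symmetric] w field_simps)
  then have "integral {1/2..1} (\<lambda>u. osc w (1 - u)) = (1 + sin (w * (1 - 1)) / w) / w\<^sup>2 - (1/2 + sin (w * (1 - 1/2)) / w) / w\<^sup>2"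
    unfolding osc_altdef[OF w] by (rule integral_unique)
  also have "\<dots> = (1/2 - sin (w / 2) / w) / w\<^sup>2"
    using w by (simp add: field_simps)
  finally have "integral {1/2..1} (\<lambda>u. osc w (1 - u)) = (1/2 - sin (w / 2) / w) / w\<^sup>2" .
  moreover have "\<bar>sin (w / 2) / w\<bar> \<le> 1 / 6"
    unfolding abs_divide using assms by (intro frac_le) auto
  then have "1 / 3 \<le> 1/2 - sin (w / 2) / w" by linarith
  ultimately show ?thesis by (metis divide_right_mono zero_le_power2)
qed

text \<open>The value is exactly (1 + cos w / 2 - (3 / 2) * (sin w / w)) / w^4, and beyond the
  threshold 6 the bracket is at least 1 - 1/2 - 1/4.\<close>

lemma osc_conv_1_lower:
  assumes "\<bar>w\<bar> \<ge> 6"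
  shows "osc_conv 1 w 1 \<ge> 1 / 4 / w ^ 4"
proof -
  have w: "w \<noteq> 0" using assms by auto
  \<comment> \<open>An antiderivative of the product of the two factors, once the product of cosines
    is expanded into a sum as in \<open>pr\<close>.\<close>
  define A where "A = (\<lambda>u. u - sin (w * u) / w + sin (w * (1 - u)) / w + (u * cos w + sin (w * (2 * u - 1)) / (2 * w)) / 2)"
  have pr: "(1 - cos (w * (1 - u))) * (1 - cos (w * u)) =
    1 - cos (w * u) - cos (w * (1 - u)) + (cos w + cos (w * (2 * u - 1))) / 2" for u
    using cos_times_cos[of "w * u" "w * (1 - u)"]
    by (simp add: algebra_simps)
  have "((\<lambda>u. (1 - cos (w * (1 - u))) * (1 - cos (w * u))) has_integral (A 1 - A 0)) {0..1}"
    unfolding pr A_def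
    by (rule fundamental_theorem_of_calculus)
       (auto intro!: derivative_eq_intros simp: has_real_derivative_iff_has_vector_derivative[symmetric] w field_simps)
  from has_integral_divide[OF this, of "w ^ 4"]
  have int: "integral {0..1} (\<lambda>u. (1 - cos (w * (1 - u))) * (1 - cos (w * u)) / w ^ 4) = (A 1 - A 0) / w ^ 4"
    by (rule integral_unique)
  have e: "osc w (1 * (1 - u)) * osc_conv 0 w (1 * u) = (1 - cos (w * (1 - u))) * (1 - cos (w * u)) / w ^ 4" for u
    unfolding osc_conv.simps(1) osc_altdef[OF w] times_divide_times_eq power_add[symmetric] by simp
  have "osc_conv 1 w 1 = (A 1 - A 0) / w ^ 4"
    unfolding One_nat_def osc_conv.simps(2) e int by simp
  moreover have "A 1 - A 0 = 1 + cos w / 2 - (3 / 2) * (sin w / w)"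
    using w by (simp add: A_def field_simps)
  moreover have "\<bar>sin w / w\<bar> \<le> 1 / 6"
    unfolding abs_divide using assms by (intro frac_le) auto
  then have "1 / 4 \<le> 1 + cos w / 2 - (3 / 2) * (sin w / w)"
    using cos_ge_minus_one[of w] by linarith
  ultimately show ?thesis using divide_right_mono[of "1 / 4" "A 1 - A 0" "w ^ 4"] by simp
qed

text \<open>The index starts at \<open>Suc l\<close> because a single factor vanishes at t = 1
  whenever w is a nonzero multiple of 2 pi. The induction keeps only the part [1/2, 1] of the
  convolution integral: there the previous power is bounded below by scaling, so \<open>osc\<close>
  enters through its mean alone.\<close>

lemma osc_conv_lower:
  "\<exists>c>0. \<forall>w. osc_conv (Suc l) w 1 \<ge> c / (1 + w\<^sup>2) ^ (l + 2)"
proof -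
  obtain c0 where c0: "c0 > 0" "\<And>w u. \<bar>w\<bar> \<le> 6 \<Longrightarrow> 0 \<le> u \<Longrightarrow> u \<le> 1 \<Longrightarrow> osc w u \<ge> c0 * u\<^sup>2"
    using osc_lower by blast
  show ?thesis
  proof (induction l)
    case 0
    \<comment> \<open>The Beta integral B(3, 3), which arises from bounding both factors below by c0
      u^2.\<close>
    have i2: "((\<lambda>u. (1 - u)\<^sup>2 * u\<^sup>2) has_integral 1 / 30) {0..1::real}"
    proof -
      have "((\<lambda>u. (1 - u)\<^sup>2 * u\<^sup>2) has_integral ((1^3/3 - 1^4/2 + 1^5/5) - (0^3/3 - 0^4/2 + 0^5/5))) {0..1::real}"
        by (rule fundamental_theorem_of_calculus)
           (auto intro!: derivative_eq_intros simp: has_real_derivative_iff_has_vector_derivative[symmetric] field_simps power2_eq_square power3_eq_cube power4_eq_xxxx)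
      then show ?thesis by simp
    qed
    define c where "c = min (c0\<^sup>2 / 30) (1 / 4)"
    have c: "c > 0" using c0 by (simp add: c_def)
    have "osc_conv 1 w 1 \<ge> c / (1 + w\<^sup>2) ^ 2" for w
    proof (cases "\<bar>w\<bar> \<le> 6")
      case True
      have "integral {0..1} (\<lambda>u. c0\<^sup>2 * ((1 - u)\<^sup>2 * u\<^sup>2)) \<le> integral {0..1} (\<lambda>u. osc w (1 * (1 - u)) * osc_conv 0 w (1 * u))"
      proof (intro integral_le osc_conv_integrable)
        show "(\<lambda>u. c0\<^sup>2 * ((1 - u)\<^sup>2 * u\<^sup>2)) integrable_on {0..1}"
          by (intro integrable_continuous_interval continuous_intros)
        fix u :: real assume "u \<in> {0..1}"
        then have "(c0 * (1 - u)\<^sup>2) * (c0 * u\<^sup>2) \<le> osc w (1 - u) * osc w u"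
          using c0 True by (intro mult_mono) (auto simp: osc_nonneg)
        then show "c0\<^sup>2 * ((1 - u)\<^sup>2 * u\<^sup>2) \<le> osc w (1 * (1 - u)) * osc_conv 0 w (1 * u)"
          by (simp add: power2_eq_square mult_ac)
      qed
      then have "c0\<^sup>2 * (1 / 30) \<le> osc_conv 1 w 1"
        unfolding integral_mult_right integral_unique[OF i2] by simp
      then have "c0\<^sup>2 / 30 \<le> osc_conv 1 w 1" by simp
      moreover have "c / (1 + w\<^sup>2) ^ 2 \<le> c"
      proof -
        have "1 \<le> (1 + w\<^sup>2) ^ 2" by simp
        then show ?thesis using c by (simp add: divide_le_eq)
      qed
      moreover have "c \<le> c0\<^sup>2 / 30" by (simp add: c_def)
      ultimately show ?thesis by linarith
    next
      case False
      have "c / (1 + w\<^sup>2) ^ 2 \<le> 1 / 4 / w ^ 4"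
      proof (rule frac_le)
        have "w ^ 4 = (w\<^sup>2) ^ 2" by simp
        also have "\<dots> \<le> (1 + w\<^sup>2) ^ 2" by (intro power_mono) auto
        finally show "w ^ 4 \<le> (1 + w\<^sup>2) ^ 2" .
      qed (use False in \<open>auto simp: c_def\<close>)
      then show ?thesis using osc_conv_1_lower[of w] False by linarith
    qed
    then show ?case using c unfolding One_nat_def add_0 by blast
  next
    case (Suc l)
    then obtain c where c: "c > 0" "\<And>w. osc_conv (Suc l) w 1 \<ge> c / (1 + w\<^sup>2) ^ (l + 2)" by blast
    \<comment> \<open>The scaling exponent of the previous power; for u in [1/2, 1] rescaling costs
      at most a factor (1/2)^m.\<close>
    define m where "m = 3 * Suc l + 2"
    \<comment> \<open>The entry c0 / 24 is the integral of c0 (1 - u)^2 over [1/2, 1], for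
      \<open>\<bar>w\<bar> \<le> 6\<close>; the entry 1/3 comes from \<open>osc_avg_lower\<close>,
      for the other w.\<close>
    define c1 where "c1 = min (c0 / 24) (1 / 3)"
    have c1: "c1 > 0" using c0 by (simp add: c1_def)
    have avg: "integral {1/2..1} (\<lambda>u. osc w (1 - u)) \<ge> c1 / (1 + w\<^sup>2)" for w
    proof (cases "\<bar>w\<bar> \<le> 6")
      case True
      have i1: "((\<lambda>u. c0 * (1 - u)\<^sup>2) has_integral c0 / 24) {1/2..1::real}"
      proof -
        have "((\<lambda>u. c0 * (1 - u)\<^sup>2) has_integral (- c0 * (1 - 1)^3/3 - (- c0 * (1 - 1/2)^3/3))) {1/2..1::real}"
          by (rule fundamental_theorem_of_calculus)
             (auto intro!: derivative_eq_intros simp: has_real_derivative_iff_has_vector_derivative[symmetric] field_simps power2_eq_square)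
        then show ?thesis by (simp add: power3_eq_cube)
      qed
      have "integral {1/2..1} (\<lambda>u. c0 * (1 - u)\<^sup>2) \<le> integral {1/2..1} (\<lambda>u. osc w (1 - u))"
      proof (intro integral_le)
        show "(\<lambda>u. c0 * (1 - u)\<^sup>2) integrable_on {1/2..1}"
          by (intro integrable_continuous_interval continuous_intros)
        show "(\<lambda>u. osc w (1 - u)) integrable_on {1/2..1}"
          by (intro integrable_continuous_interval continuous_intros)
        fix u :: real assume "u \<in> {1/2..1}"
        then show "c0 * (1 - u)\<^sup>2 \<le> osc w (1 - u)"
          using c0 True by auto
      qed
      then have "c0 / 24 \<le> integral {1/2..1} (\<lambda>u. osc w (1 - u))"
        unfolding integral_unique[OF i1] .
      moreover have "c1 / (1 + w\<^sup>2) \<le> c1"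
        using c1 by (simp add: divide_le_eq add_pos_nonneg)
      moreover have "c1 \<le> c0 / 24" by (simp add: c1_def)
      ultimately show ?thesis by linarith
    next
      case False
      have "c1 / (1 + w\<^sup>2) \<le> 1 / 3 / w\<^sup>2"
        using False by (intro frac_le) (auto simp: c1_def)
      then show ?thesis using osc_avg_lower[of w] False by linarith
    qed
    let ?c = "c1 * (c * (1 / 2) ^ m)"
    have "osc_conv (Suc (Suc l)) w 1 \<ge> ?c / (1 + w\<^sup>2) ^ (Suc l + 2)" for w
    proof -
      let ?D = "c * (1 / 2) ^ m / (1 + w\<^sup>2) ^ (l + 2)"
      have D: "?D \<ge> 0" using c by simp
      have low: "osc_conv (Suc l) w u \<ge> ?D" if u: "u \<in> {1/2..1}" for u
      proof -
        have "u ^ m * osc_conv (Suc l) (w * u) 1 \<ge> (1 / 2) ^ m * (c / (1 + (w * u)\<^sup>2) ^ (l + 2))"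
          using u c by (intro mult_mono power_mono) (auto simp del: osc_conv.simps)
        moreover have "c / (1 + (w * u)\<^sup>2) ^ (l + 2) \<ge> c / (1 + w\<^sup>2) ^ (l + 2)"
        proof (rule divide_left_mono)
          have "u\<^sup>2 \<le> 1\<^sup>2" using u by (intro power_mono) auto
          then have "(w * u)\<^sup>2 \<le> w\<^sup>2"
            by (simp add: power_mult_distrib mult_left_le)
          then show "(1 + (w * u)\<^sup>2) ^ (l + 2) \<le> (1 + w\<^sup>2) ^ (l + 2)" by (intro power_mono) auto
          show "0 < (1 + w\<^sup>2) ^ (l + 2) * (1 + (w * u)\<^sup>2) ^ (l + 2)"
            by (intro mult_pos_pos zero_less_power add_pos_nonneg) auto
        qed (use c in auto)
        then have "(1 / 2) ^ m * (c / (1 + (w * u)\<^sup>2) ^ (l + 2)) \<ge> ?D"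
          using mult_left_mono[of "c / (1 + w\<^sup>2) ^ (l + 2)" "c / (1 + (w * u)\<^sup>2) ^ (l + 2)" "(1/2)^m"] by (simp add: mult_ac)
        ultimately show ?thesis using osc_conv_scale[of "Suc l" w u 1]
          by (simp add: m_def del: osc_conv.simps)
      qed
      have "c1 / (1 + w\<^sup>2) * ?D \<le> integral {1/2..1} (\<lambda>u. osc w (1 - u)) * ?D"
        using avg D by (rule mult_right_mono)
      also have "\<dots> = integral {1/2..1} (\<lambda>u. osc w (1 - u) * ?D)" by simp
      also have "\<dots> \<le> integral {1/2..1} (\<lambda>u. osc w (1 * (1 - u)) * osc_conv (Suc l) w (1 * u))"
      proof (intro integral_le osc_conv_integrable)
        show "(\<lambda>u. osc w (1 - u) * ?D) integrable_on {1/2..1}"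
          by (intro integrable_continuous_interval continuous_intros)
        fix u :: real assume "u \<in> {1/2..1}"
        from mult_left_mono[OF low[OF this] osc_nonneg]
        show "osc w (1 - u) * ?D \<le> osc w (1 * (1 - u)) * osc_conv (Suc l) w (1 * u)"
          unfolding mult_1 .
      qed
      also have "\<dots> \<le> integral {0..1} (\<lambda>u. osc w (1 * (1 - u)) * osc_conv (Suc l) w (1 * u))"
        by (intro integral_subset_le osc_conv_integrable ballI mult_nonneg_nonneg osc_nonneg osc_conv_nonneg) auto
      also have "\<dots> = osc_conv (Suc (Suc l)) w 1" by (simp only: osc_conv.simps(2)[of "Suc l"] mult_1)
      finally show ?thesis by (simp add: mult_ac)
    qed
    moreover have "?c > 0" using c c1 by simp
    ultimately show ?case by blast
  qed
qed

section \<open>Laplace transforms\<close>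

lemma nn_integral_convolution:
  fixes f g :: "real \<Rightarrow> ennreal"
  assumes [measurable]: "f \<in> borel_measurable borel" "g \<in> borel_measurable borel"
  shows "(\<integral>\<^sup>+t. \<integral>\<^sup>+s. f (t - s) * g s \<partial>lborel \<partial>lborel) = (\<integral>\<^sup>+t. f t \<partial>lborel) * (\<integral>\<^sup>+t. g t \<partial>lborel)"
proof -
  have "(\<integral>\<^sup>+t. \<integral>\<^sup>+s. f (t - s) * g s \<partial>lborel \<partial>lborel) = (\<integral>\<^sup>+s. \<integral>\<^sup>+t. f (t - s) * g s \<partial>lborel \<partial>lborel)"
    by (rule lborel_pair.Fubini') measurable
  also have "\<dots> = (\<integral>\<^sup>+s. (\<integral>\<^sup>+t. f t \<partial>lborel) * g s \<partial>lborel)"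
  proof (rule nn_integral_cong)
    fix s :: real
    have "(\<integral>\<^sup>+t. f (t - s) * g s \<partial>lborel) = (\<integral>\<^sup>+t. f (t - s) \<partial>lborel) * g s"
      by (rule nn_integral_multc) measurable
    also have "(\<integral>\<^sup>+t. f (t - s) \<partial>lborel) = (\<integral>\<^sup>+t. f t \<partial>lborel)"
      using nn_integral_real_affine[of f 1 "-s"] by simp
    finally show "(\<integral>\<^sup>+t. f (t - s) * g s \<partial>lborel) = (\<integral>\<^sup>+t. f t \<partial>lborel) * g s" .
  qed
  also have "\<dots> = (\<integral>\<^sup>+t. f t \<partial>lborel) * (\<integral>\<^sup>+t. g t \<partial>lborel)"
    by (rule nn_integral_cmult) measurable
  finally show ?thesis .
qed

text \<open>Values in \<open>ennreal\<close> allow Tonelli's theorem without integrability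
  conditions; the functions transformed below are all nonnegative on the half-line.\<close>

definition laplace :: "(real \<Rightarrow> real) \<Rightarrow> real \<Rightarrow> ennreal" where
  "laplace f p = (\<integral>\<^sup>+t. ennreal (f t * exp (- p * t)) * indicator {0..} t \<partial>lborel)"

lemma laplace_convolution:
  fixes f g h :: "real \<Rightarrow> real"
  assumes [measurable]: "f \<in> borel_measurable borel" "g \<in> borel_measurable borel"
    and nonneg: "\<And>t. t \<ge> 0 \<Longrightarrow> f t \<ge> 0" "\<And>t. t \<ge> 0 \<Longrightarrow> g t \<ge> 0"
    and h: "\<And>t. t \<ge> 0 \<Longrightarrow> ennreal (h t) = (\<integral>\<^sup>+s. ennreal (f (t - s) * g s) * indicator {0..t} s \<partial>lborel)"
  shows "laplace h p = laplace f p * laplace g p"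
proof -
  let ?F = "\<lambda>t. ennreal (f t * exp (- p * t)) * indicator {0..} t"
  let ?G = "\<lambda>t. ennreal (g t * exp (- p * t)) * indicator {0..} t"
  have "laplace h p = (\<integral>\<^sup>+t. \<integral>\<^sup>+s. ?F (t - s) * ?G s \<partial>lborel \<partial>lborel)"
    unfolding laplace_def
  proof (rule nn_integral_cong)
    fix t :: real
    show "ennreal (h t * exp (- p * t)) * indicator {0..} t = (\<integral>\<^sup>+s. ?F (t - s) * ?G s \<partial>lborel)"
    proof (cases "t \<ge> 0")
      case True
      have "ennreal (h t * exp (- p * t)) = (\<integral>\<^sup>+s. ennreal (f (t - s) * g s) * indicator {0..t} s \<partial>lborel) * ennreal (exp (- p * t))"
        using h[OF True] by (simp add: ennreal_mult'')
      also have "\<dots> = (\<integral>\<^sup>+s. ennreal (f (t - s) * g s) * indicator {0..t} s * ennreal (exp (- p * t)) \<partial>lborel)"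
        by (rule nn_integral_multc[symmetric]) measurable
      also have "\<dots> = (\<integral>\<^sup>+s. ?F (t - s) * ?G s \<partial>lborel)"
      proof (rule nn_integral_cong)
        fix s :: real
        show "ennreal (f (t - s) * g s) * indicator {0..t} s * ennreal (exp (- p * t)) = ?F (t - s) * ?G s"
        proof (cases "s \<in> {0..t}")
          case True
          have e: "exp (- p * t) = exp (- p * (t - s)) * exp (- p * s)"
            unfolding exp_add[symmetric] by (simp add: algebra_simps)
          show ?thesis unfolding e using True nonneg
            by (auto simp: ennreal_mult'[symmetric] mult_ac)
        qed (auto simp: indicator_def)
      qed
      finally show ?thesis using True by simp
    next
      case False
      then have z: "(\<lambda>s. ?F (t - s) * ?G s) = (\<lambda>_. 0)"
        by (intro ext) (auto simp: indicator_def)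
      show ?thesis unfolding z using False by simp
    qed
  qed
  also have "\<dots> = laplace f p * laplace g p"
    unfolding laplace_def by (rule nn_integral_convolution) measurable
  finally show ?thesis .
qed

lemma nn_integral_Icc_continuous:
  fixes f :: "real \<Rightarrow> real"
  assumes "continuous_on {a..b} f" "\<And>x. x \<in> {a..b} \<Longrightarrow> f x \<ge> 0"
  shows "(\<integral>\<^sup>+x. ennreal (f x) * indicator {a..b} x \<partial>lborel) = ennreal (integral {a..b} f)"
  using assms by (intro nn_integral_has_integral_lebesgue' integrable_integral integrable_continuous_interval)

lemma osc_conv_Suc_eq_convolution:
  assumes t: "t \<ge> 0"
  shows "osc_conv (Suc l) w t = integral {0..t} (\<lambda>s. osc w (t - s) * osc_conv l w s)"
proof (cases "t = 0")
  case False
  with t have t: "t > 0" by simp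
  let ?g = "\<lambda>s. osc w (t - s) * osc_conv l w s"
  have "(?g has_integral integral {0..t} ?g) {0..t}"
    by (intro integrable_integral integrable_continuous_interval continuous_intros)
  from has_integral_affinity[OF this[folded cbox_interval] , of t 0] t
  have "((\<lambda>u. ?g (t * u)) has_integral integral {0..t} ?g / t) {0..1}"
    by (simp add: image_affinity_atLeastAtMost_div_diff)
  then have "integral {0..1} (\<lambda>u. ?g (t * u)) = integral {0..t} ?g / t" by (rule integral_unique)
  then show ?thesis using t by (simp add: algebra_simps)
qed auto

lemma laplace_osc:
  assumes w: "w \<noteq> 0" and p: "p > 0"
  shows "laplace (osc w) p = ennreal (1 / (p * (p\<^sup>2 + w\<^sup>2)))"
proof -
  define D where "D = p\<^sup>2 + w\<^sup>2"
  have D: "D > 0" using p by (simp add: D_def add_pos_nonneg)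
  \<comment> \<open>Chosen so that \<open>F\<close>, the product of \<open>b\<close> with e^(-pt),
    is an antiderivative of the integrand that tends to 0; the transform is then minus the value of
    \<open>F\<close> at 0.\<close>
  define b where "b = (\<lambda>t. (- 1 / p - (w * sin (w * t) - p * cos (w * t)) / D) / w\<^sup>2)"
  define F where "F = (\<lambda>t. exp (- p * t) * b t)"
  have "laplace (osc w) p = ennreal (0 - F 0)" unfolding laplace_def
  proof (rule nn_integral_FTC_atLeast)
    have "continuous_on UNIV (\<lambda>t. osc w t * exp (- p * t))"
      by (intro continuous_intros)
    then show "(\<lambda>t. osc w t * exp (- p * t)) \<in> borel_measurable borel"
      by (rule borel_measurable_continuous_onI)
    show "0 \<le> osc w t * exp (- p * t)" for t by (simp add: osc_nonneg)
    have b_bound: "norm (F t) \<le> exp (- p * t) * ((1 / p + (\<bar>w\<bar> + p) / D) / w\<^sup>2)" for t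
    proof -
      have "\<bar>w * sin (w * t)\<bar> \<le> \<bar>w\<bar>" "\<bar>p * cos (w * t)\<bar> \<le> p"
        using p by (auto simp: abs_mult intro!: mult_left_le)
      then have "\<bar>w * sin (w * t) - p * cos (w * t)\<bar> \<le> \<bar>w\<bar> + p" by linarith
      then have "\<bar>(w * sin (w * t) - p * cos (w * t)) / D\<bar> \<le> (\<bar>w\<bar> + p) / D"
        using D by (simp add: abs_divide divide_right_mono)
      moreover have "\<bar>- 1 / p\<bar> = 1 / p" using p by simp
      ultimately have "\<bar>- 1 / p - (w * sin (w * t) - p * cos (w * t)) / D\<bar> \<le> 1 / p + (\<bar>w\<bar> + p) / D"
        by linarith
      then have "\<bar>b t\<bar> \<le> (1 / p + (\<bar>w\<bar> + p) / D) / w\<^sup>2"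
        unfolding b_def abs_divide by (simp add: divide_right_mono)
      then show ?thesis unfolding F_def real_norm_def abs_mult by (simp only: abs_exp_cancel) (rule mult_left_mono, auto)
    qed
    have "((\<lambda>t. exp (- p * t)) \<longlongrightarrow> 0) at_top" using p by real_asymp
    then have "((\<lambda>t. exp (- p * t) * ((1 / p + (\<bar>w\<bar> + p) / D) / w\<^sup>2)) \<longlongrightarrow> 0) at_top"
      by (rule tendsto_mult_left_zero)
    then show "(F \<longlongrightarrow> 0) at_top"
      by (rule Lim_null_comparison[OF always_eventually[OF allI[OF b_bound]]])
    fix t :: real
    let ?b' = "(0 - (w * (w * cos (w * t)) + p * (w * sin (w * t))) / D) / w\<^sup>2"
    have "((\<lambda>t. w * sin (w * t) - p * cos (w * t)) has_real_derivative
        w * (w * cos (w * t)) + p * (w * sin (w * t))) (at t)"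
      by (auto intro!: derivative_eq_intros)
    then have b': "(b has_real_derivative ?b') (at t)"
      unfolding b_def by (intro DERIV_cdivide DERIV_diff DERIV_const)
    have "((\<lambda>t. exp (- p * t)) has_real_derivative exp (- p * t) * (- p)) (at t)"
      by (auto intro!: derivative_eq_intros)
    from DERIV_mult[OF this b']
    have "(F has_real_derivative (exp (- p * t) * (- p) * b t + ?b' * exp (- p * t))) (at t)"
      unfolding F_def .
    also have "exp (- p * t) * (- p) * b t + ?b' * exp (- p * t) = exp (- p * t) * (- p * b t + ?b')"
      by (simp add: ring_distribs mult_ac)
    also have "- p * b t + ?b' = (1 - cos (w * t)) / w\<^sup>2"
    proof -
      have "p * (w * sin (w * t) - p * cos (w * t)) - (w * (w * cos (w * t)) + p * (w * sin (w * t))) = - D * cos (w * t)"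
        unfolding D_def power2_eq_square by (simp add: algebra_simps)
      then have "p * (w * sin (w * t) - p * cos (w * t)) / D - (w * (w * cos (w * t)) + p * (w * sin (w * t))) / D = - cos (w * t)"
        using D unfolding diff_divide_distrib[symmetric] by simp
      moreover have "- p * b t + ?b' = (1 + (p * (w * sin (w * t) - p * cos (w * t)) / D - (w * (w * cos (w * t)) + p * (w * sin (w * t))) / D)) / w\<^sup>2"
        unfolding b_def using p w by (simp add: diff_divide_distrib add_divide_distrib right_diff_distrib)
      ultimately show ?thesis by simp
    qed
    also have "exp (- p * t) * ((1 - cos (w * t)) / w\<^sup>2) = osc w t * exp (- p * t)"
      by (simp add: osc_altdef[OF w])
    finally show "(F has_real_derivative (osc w t * exp (- p * t))) (at t)" .
  qed
  also have "0 - F 0 = 1 / (p * D)"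
  proof -
    have "1 / p - p / D = w\<^sup>2 / (p * D)"
      using p D by (simp add: diff_frac_eq) (simp add: D_def power2_eq_square)
    then have "(1 / p - p / D) / w\<^sup>2 = 1 / (p * D)" using w by simp
    then show ?thesis unfolding F_def b_def
      by (simp add: diff_divide_distrib)
  qed
  finally show ?thesis by (simp add: D_def)
qed

lemma laplace_osc_conv:
  assumes w: "w \<noteq> 0" and p: "p > 0"
  shows "laplace (osc_conv l w) p = ennreal ((1 / (p * (p\<^sup>2 + w\<^sup>2))) ^ Suc l)"
proof (induction l)
  case 0
  have "osc_conv 0 w = osc w" by (rule ext) simp
  then show ?case using laplace_osc[OF w p] by simp
next
  case (Suc l)
  have "laplace (osc_conv (Suc l) w) p = laplace (osc w) p * laplace (osc_conv l w) p"
  proof (rule laplace_convolution)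
    show "osc w \<in> borel_measurable borel"
      by (intro borel_measurable_continuous_onI continuous_on_osc continuous_on_const continuous_on_id)
    show "osc_conv l w \<in> borel_measurable borel"
      by (intro borel_measurable_continuous_onI continuous_on_osc_conv continuous_on_const continuous_on_id)
    fix t :: real assume t: "t \<ge> 0"
    have "ennreal (osc_conv (Suc l) w t) = ennreal (integral {0..t} (\<lambda>s. osc w (t - s) * osc_conv l w s))"
      using osc_conv_Suc_eq_convolution[OF t] by simp
    also have "\<dots> = (\<integral>\<^sup>+s. ennreal (osc w (t - s) * osc_conv l w s) * indicator {0..t} s \<partial>lborel)"
      by (intro nn_integral_Icc_continuous[symmetric] continuous_intros mult_nonneg_nonneg osc_nonneg osc_conv_nonneg) auto
    finally show "ennreal (osc_conv (Suc l) w t) = \<dots>" .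
  qed (auto simp: osc_nonneg osc_conv_nonneg)
  also have "\<dots> = ennreal ((1 / (p * (p\<^sup>2 + w\<^sup>2))) ^ Suc (Suc l))"
    unfolding Suc laplace_osc[OF w p] using p by (subst ennreal_mult'[symmetric]) auto
  finally show ?case .
qed

section \<open>Gaussian and Matern integrals\<close>

text \<open>A rescaling, with s^2 = 1 / (2 v), of the characteristic function of the standard normal
  law. The complex form is kept because, unlike the cosine, it factors over coordinates.\<close>

lemma gaussian_fourier_1d:
  fixes v y :: real
  assumes v: "v > 0"
  shows "integrable lborel (\<lambda>z. of_real (exp (- v * z\<^sup>2)) * cis (z * y))"
    and "(LINT z|lborel. of_real (exp (- v * z\<^sup>2)) * cis (z * y)) = of_real (sqrt (pi / v) * exp (- y\<^sup>2 / (4 * v)))"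
proof -
  define s where "s = sqrt (1 / (2 * v))"
  have s: "s > 0" "s\<^sup>2 = 1 / (2 * v)" using v by (auto simp: s_def)
  let ?f = "\<lambda>z. of_real (exp (- v * z\<^sup>2)) * cis (z * y) :: complex"
  have int0: "integrable std_normal_distribution (\<lambda>x. cis (s * y * x))"
  proof -
    interpret prob_space std_normal_distribution by (rule prob_space_normal_density) simp
    show ?thesis by (rule integrable_const_bound[of _ 1]) (auto simp: cis_conv_exp)
  qed
  have fs: "?f (0 + s * x) = sqrt (2 * pi) *\<^sub>R (std_normal_density x *\<^sub>R cis (s * y * x))" for x
  proof -
    have "v * (s * x)\<^sup>2 = x\<^sup>2 / 2" using v unfolding power_mult_distrib s(2) by simp
    then show ?thesis
      by (simp add: std_normal_density_def scaleR_conv_of_real mult_ac)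
  qed
  have int1: "integrable lborel (\<lambda>x. std_normal_density x *\<^sub>R cis (s * y * x))"
    using int0 by (subst (asm) integrable_density) (auto simp: normal_density_nonneg cis_conv_exp)
  then have int2: "integrable lborel (\<lambda>x. ?f (0 + s * x))"
    unfolding fs by (rule integrable_scaleR_right)
  then show "integrable lborel ?f"
    using lborel_integrable_real_affine_iff[of s ?f 0] s by simp
  have c: "(LINT x|lborel. std_normal_density x *\<^sub>R cis (s * y * x)) = of_real (exp (- (s * y)\<^sup>2 / 2))"
  proof -
    have "(LINT x|lborel. std_normal_density x *\<^sub>R cis (s * y * x)) = char std_normal_distribution (s * y)"
      unfolding char_def
      by (subst integral_density) (auto simp: normal_density_nonneg cis_conv_exp)
    then show ?thesis by (simp add: char_std_normal_distribution)
  qed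
  have "(LINT z|lborel. ?f z) = \<bar>s\<bar> *\<^sub>R (LINT x|lborel. ?f (0 + s * x))"
    using s by (intro lborel_integral_real_affine) auto
  also have "\<dots> = of_real (s * (sqrt (2 * pi) * exp (- (s * y)\<^sup>2 / 2)))"
    unfolding fs integral_scaleR_right c using s by (simp add: scaleR_conv_of_real)
  also have "s * (sqrt (2 * pi) * exp (- (s * y)\<^sup>2 / 2)) = sqrt (pi / v) * exp (- y\<^sup>2 / (4 * v))"
  proof -
    have "s * sqrt (2 * pi) = sqrt (pi / v)"
      unfolding s_def real_sqrt_mult[symmetric] using v by (simp add: field_simps)
    moreover have "(s * y)\<^sup>2 / 2 = y\<^sup>2 / (4 * v)"
      unfolding power_mult_distrib s(2) using v by simp
    ultimately show ?thesis by (simp add: mult.assoc[symmetric])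
  qed
  finally show "(LINT z|lborel. ?f z) = of_real (sqrt (pi / v) * exp (- y\<^sup>2 / (4 * v)))" .
qed

text \<open>Lebesgue measure is the image of the product measure over \<open>Basis\<close>, along
  which the Gaussian and \<open>cis\<close> both factor; the cosine is the real part.\<close>

lemma gaussian_fourier:
  fixes x :: "'a::euclidean_space"
  assumes v: "v > 0"
  shows "integrable lborel (\<lambda>z::'a. exp (- v * (norm z)\<^sup>2) * cos (z \<bullet> x))"
    and "(LINT z|lborel. exp (- v * (norm z)\<^sup>2) * cos (z \<bullet> x)) =
           (pi / v) powr (DIM('a) / 2) * exp (- (norm x)\<^sup>2 / (4 * v))"
proof -
  interpret product_sigma_finite "\<lambda>_::'a. lborel :: real measure" by standard
  let ?g = "\<lambda>b z. of_real (exp (- v * z\<^sup>2)) * cis (z * (x \<bullet> b)) :: complex"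
  let ?h = "\<lambda>z::'a. of_real (exp (- v * (norm z)\<^sup>2)) * cis (z \<bullet> x) :: complex"
  have pr: "?h (\<Sum>b\<in>Basis. f b *\<^sub>R b) = (\<Prod>b\<in>Basis. ?g b (f b))" for f
  proof -
    let ?z = "\<Sum>b\<in>Basis. f b *\<^sub>R b :: 'a"
    have zb: "?z \<bullet> b = f b" if "b \<in> Basis" for b
      using that by (simp add: inner_sum_left inner_Basis if_distrib cong: if_cong)
    have "(norm ?z)\<^sup>2 = (\<Sum>b\<in>Basis. (f b)\<^sup>2)"
      unfolding power2_norm_eq_inner euclidean_inner[of ?z ?z] by (simp add: zb power2_eq_square)
    moreover have "?z \<bullet> x = (\<Sum>b\<in>Basis. f b * (x \<bullet> b))"
      unfolding euclidean_inner[of ?z x] by (simp add: zb)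
    moreover have "exp (- v * (\<Sum>b\<in>Basis. (f b)\<^sup>2)) = (\<Prod>b\<in>Basis. exp (- v * (f b)\<^sup>2))"
      by (simp add: exp_sum sum_distrib_left sum_negf[symmetric] del: sum_negf)
    moreover have "cis (\<Sum>b\<in>Basis. f b * (x \<bullet> b)) = (\<Prod>b\<in>Basis. cis (f b * (x \<bullet> b)))"
      by (simp add: cis_conv_exp exp_sum sum_distrib_left)
    ultimately show ?thesis by (simp add: prod.distrib)
  qed
  have meas: "?h \<in> borel_measurable borel"
    by (intro borel_measurable_continuous_onI continuous_intros)
  have m2: "(\<lambda>f. \<Sum>b\<in>Basis. f b *\<^sub>R b :: 'a) \<in> (\<Pi>\<^sub>M b\<in>Basis. lborel) \<rightarrow>\<^sub>M borel"
    by measurable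
  have "integrable (\<Pi>\<^sub>M b\<in>(Basis::'a set). lborel) (\<lambda>f. \<Prod>b\<in>Basis. ?g b (f b))"
    by (intro product_integrable_prod gaussian_fourier_1d v) simp
  then have int: "integrable lborel ?h"
    by (subst lborel_eq, subst integrable_distr_eq[OF m2 meas]) (simp only: pr)
  have "(LINT z|lborel. ?h z) = (LINT f|(\<Pi>\<^sub>M b\<in>(Basis::'a set). lborel). (\<Prod>b\<in>Basis. ?g b (f b)))"
    by (subst lborel_eq, subst integral_distr[OF m2 meas]) (simp only: pr)
  also have "\<dots> = (\<Prod>b\<in>Basis. LINT z|lborel. ?g b z)"
    by (intro product_integral_prod gaussian_fourier_1d v) simp
  also have "\<dots> = (\<Prod>b\<in>(Basis::'a set). of_real (sqrt (pi / v) * exp (- (x \<bullet> b)\<^sup>2 / (4 * v))))"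
    by (intro prod.cong refl gaussian_fourier_1d v)
  also have "\<dots> = of_real (sqrt (pi / v) ^ DIM('a) * exp (- (norm x)\<^sup>2 / (4 * v)))"
  proof -
    have "exp (- (norm x)\<^sup>2 / (4 * v)) = (\<Prod>b\<in>Basis. exp (- (x \<bullet> b)\<^sup>2 / (4 * v)))"
      unfolding power2_norm_eq_inner euclidean_inner[of x x]
      by (simp add: exp_sum[symmetric] sum_divide_distrib power2_eq_square sum_negf)
    then show ?thesis by (simp add: prod.distrib)
  qed
  also have "sqrt (pi / v) ^ DIM('a) = (pi / v) powr (DIM('a) / 2)"
    using v by (simp add: powr_half_sqrt[symmetric] powr_powr powr_realpow[symmetric])
  finally have val: "(LINT z|lborel. ?h z) = of_real ((pi / v) powr (DIM('a) / 2) * exp (- (norm x)\<^sup>2 / (4 * v)))" .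
  have Re: "(\<lambda>z. Re (?h z)) = (\<lambda>z. exp (- v * (norm z)\<^sup>2) * cos (z \<bullet> x))" by simp
  show "integrable lborel (\<lambda>z::'a. exp (- v * (norm z)\<^sup>2) * cos (z \<bullet> x))"
    using integrable_Re[OF int] unfolding Re .
  show "(LINT z|lborel. exp (- v * (norm z)\<^sup>2) * cos (z \<bullet> x)) =
           (pi / v) powr (DIM('a) / 2) * exp (- (norm x)\<^sup>2 / (4 * v))"
    using integral_Re[OF int] unfolding Re val by simp
qed

lemma nn_integral_gaussian:
  assumes "v > 0"
  shows "(\<integral>\<^sup>+z. ennreal (exp (- v * (norm (z::'a::euclidean_space))\<^sup>2)) \<partial>lborel) = ennreal ((pi / v) powr (DIM('a) / 2))"
  using nn_integral_eq_integral[OF gaussian_fourier(1)[OF assms, of "0::'a"]] gaussian_fourier(2)[OF assms, of "0::'a"]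
  by simp

text \<open>This is the device that writes negative powers of p^2 + (norm z)^2 as mixtures of
  Gaussians in z.\<close>

lemma nn_integral_Gamma:
  assumes "a > 0" "A > (0::real)"
  shows "(\<integral>\<^sup>+v. ennreal (v powr (a - 1) * exp (- A * v)) * indicator {0<..} v \<partial>lborel) = ennreal (Gamma a * A powr (- a))"
proof -
  let ?f = "\<lambda>t. ennreal (indicator {0..} t * t powr (a - 1) / exp t)"
  have "ennreal (Gamma a) = (\<integral>\<^sup>+t. ?f t \<partial>lborel)"
    using Gamma_conv_nn_integral_real[OF assms(1)] .
  also have "\<dots> = ennreal A * (\<integral>\<^sup>+v. ?f (0 + A * v) \<partial>lborel)"
    using assms by (subst nn_integral_real_affine[of _ A 0]) (auto simp: divide_inverse)
  also have "(\<integral>\<^sup>+v. ?f (0 + A * v) \<partial>lborel) = (\<integral>\<^sup>+v. ennreal (A powr (a - 1)) * (ennreal (v powr (a - 1) * exp (- A * v)) * indicator {0<..} v) \<partial>lborel)"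
  proof (rule nn_integral_cong)
    fix v :: real
    show "?f (0 + A * v) = ennreal (A powr (a - 1)) * (ennreal (v powr (a - 1) * exp (- A * v)) * indicator {0<..} v)"
      using assms by (cases v "0::real" rule: linorder_cases)
        (auto simp: indicator_def ennreal_mult'[symmetric] powr_mult exp_minus field_simps zero_le_mult_iff)
  qed
  also have "\<dots> = ennreal (A powr (a - 1)) * (\<integral>\<^sup>+v. ennreal (v powr (a - 1) * exp (- A * v)) * indicator {0<..} v \<partial>lborel)"
    by (rule nn_integral_cmult) measurable
  also have "ennreal A * \<dots> = ennreal (A powr a) * (\<integral>\<^sup>+v. ennreal (v powr (a - 1) * exp (- A * v)) * indicator {0<..} v \<partial>lborel)"
    using assms by (simp add: mult.assoc[symmetric] ennreal_mult'[symmetric] powr_diff)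
  finally have e: "ennreal (Gamma a) = ennreal (A powr a) * (\<integral>\<^sup>+v. ennreal (v powr (a - 1) * exp (- A * v)) * indicator {0<..} v \<partial>lborel)" .
  have "ennreal (Gamma a * A powr (- a)) = ennreal (A powr (- a)) * ennreal (Gamma a)"
    by (simp add: ennreal_mult'' mult.commute)
  also have "\<dots> = (\<integral>\<^sup>+v. ennreal (v powr (a - 1) * exp (- A * v)) * indicator {0<..} v \<partial>lborel)"
    unfolding e using assms
    by (simp add: mult.assoc[symmetric] ennreal_mult'[symmetric] powr_minus)
  finally show ?thesis ..
qed

text \<open>Up to the factor 2 / sqrt pi this is the error function: the half-line Gaussian integral
  gives the limit at infinity, and oddness the other one.\<close>

lemma gauss_antiderivative:
  obtains E :: "real \<Rightarrow> real" where
    "\<And>x. (E has_real_derivative exp (- x\<^sup>2)) (at x)"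
    "(E \<longlongrightarrow> sqrt pi / 2) at_top" "(E \<longlongrightarrow> - (sqrt pi / 2)) at_bot"
proof -
  define E where "E = (\<lambda>x::real. LBINT t=ereal 0..ereal x. exp (- t\<^sup>2))"
  have deriv: "(E has_real_derivative exp (- x\<^sup>2)) (at x)" for x
  proof -
    have "(at x within {min 0 (x - 1)..max 0 (x + 1)}) = at x"
      by (intro at_within_interior) auto
    moreover have "min 0 (x - 1) \<le> x" "x \<le> max 0 (x + 1)"
      by auto
    moreover have "continuous_on {min 0 (x - 1)..max 0 (x + 1)} (\<lambda>t. exp (- t\<^sup>2))"
      by (intro continuous_intros)
    ultimately show ?thesis
      using interval_integral_FTC2[of "min 0 (x - 1)" 0 "max 0 (x + 1)" "\<lambda>t. exp (- t\<^sup>2)" x]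
      by (auto simp: E_def has_real_derivative_iff_has_vector_derivative split del: if_split)
  qed
  have top: "(E \<longlongrightarrow> sqrt pi / 2) at_top"
  proof -
    let ?f = "\<lambda>x. indicator {0..} x *\<^sub>R exp (- x\<^sup>2)"
    have "((\<lambda>y. LINT x|lborel. indicator {..y} x *\<^sub>R ?f x) \<longlongrightarrow> sqrt pi / 2) at_top"
      using tendsto_integral_at_top[OF sets_lborel integrable.intros[OF gaussian_moment_0]]
      unfolding has_bochner_integral_integral_eq[OF gaussian_moment_0] .
    moreover have "eventually (\<lambda>y. (LINT x|lborel. indicator {..y} x *\<^sub>R ?f x) = E y) at_top"
      using eventually_ge_at_top[of 0]
    proof eventually_elim
      case (elim y)
      have "E y = (LBINT t:{0..y}. exp (- t\<^sup>2))"
        unfolding E_def using elim by (rule interval_integral_Icc)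
      also have "\<dots> = (LINT x|lborel. indicator {..y} x *\<^sub>R ?f x)"
        unfolding set_lebesgue_integral_def
        by (rule Bochner_Integration.integral_cong) (auto simp: indicator_def)
      finally show ?case by simp
    qed
    ultimately show ?thesis by (rule Lim_transform_eventually)
  qed
  have E0: "E 0 = 0" by (simp add: E_def)
  have odd: "E (- x) = - E x" for x
  proof -
    have "((\<lambda>x. E (- x) + E x) has_real_derivative 0) (at y)" for y
    proof -
      have "((\<lambda>x. E (- x)) has_real_derivative exp (- (- y)\<^sup>2) * - 1) (at y)"
        by (rule DERIV_chain2[OF deriv]) (auto intro!: derivative_eq_intros)
      from DERIV_add[OF this deriv[of y]] show ?thesis by simp
    qed
    then have "E (- x) + E x = E (- 0) + E 0"
      by (intro DERIV_isconst_all[of "\<lambda>x. E (- x) + E x"] allI)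
    then show ?thesis using E0 by simp
  qed
  have "((\<lambda>x. - E (- x)) \<longlongrightarrow> - (sqrt pi / 2)) at_bot"
    by (intro tendsto_minus filterlim_compose[OF top] filterlim_uminus_at_top_at_bot)
  then have "(E \<longlongrightarrow> - (sqrt pi / 2)) at_bot" unfolding odd by simp
  with deriv top that show thesis by blast
qed

text \<open>The subordination formula: it presents e^(-ps) as a mixture of Gaussians in s, so that
  Laplace integrals reduce to Gaussian ones.\<close>

lemma nn_integral_subordination:
  assumes p: "p > 0" and s: "s > 0"
  shows "(\<integral>\<^sup>+v. ennreal (exp (- v * p\<^sup>2 - s\<^sup>2 / (4 * v)) / sqrt v) * indicator {0<..} v \<partial>lborel) = ennreal (sqrt pi / p * exp (- p * s))"
proof -
  obtain E where E: "\<And>x. (E has_real_derivative exp (- x\<^sup>2)) (at x)"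
    "(E \<longlongrightarrow> sqrt pi / 2) at_top" "(E \<longlongrightarrow> - (sqrt pi / 2)) at_bot"
    using gauss_antiderivative by blast
  let ?f = "\<lambda>v. exp (- v * p\<^sup>2 - s\<^sup>2 / (4 * v)) / sqrt v"
  \<comment> \<open>The integrand has the elementary antiderivative \<open>F\<close> in terms of the error function.\<close>
  define m where "m = (\<lambda>v. p * sqrt v - s / (2 * sqrt v))"
  define q where "q = (\<lambda>v. p * sqrt v + s / (2 * sqrt v))"
  define F where "F = (\<lambda>v. (exp (- p * s) * E (m v) + exp (p * s) * E (q v)) / p)"
  let ?A = "(exp (- p * s) * - (sqrt pi / 2) + exp (p * s) * (sqrt pi / 2)) / p"
  let ?B = "(exp (- p * s) * (sqrt pi / 2) + exp (p * s) * (sqrt pi / 2)) / p"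
  have dF: "(F has_real_derivative ?f v) (at v)" if v: "v > 0" for v
  proof -
    define u where "u = sqrt v"
    have u: "u > 0" "v = u\<^sup>2" using v by (auto simp: u_def)
    have ds: "(sqrt has_real_derivative 1 / (2 * u)) (at v)"
      by (rule DERIV_cong[OF DERIV_real_sqrt[OF v]]) (simp add: u_def inverse_eq_divide)
    have dm: "(m has_real_derivative p / (2 * u) + s / (4 * u ^ 3)) (at v)"
    proof -
      have "(m has_real_derivative p * (1 / (2 * u)) - (0 * (2 * sqrt v) - s * (2 * (1 / (2 * u)))) / ((2 * sqrt v) * (2 * sqrt v))) (at v)"
        unfolding m_def using v by (intro DERIV_diff DERIV_cmult DERIV_divide DERIV_const ds) auto
      also have "p * (1 / (2 * u)) - (0 * (2 * sqrt v) - s * (2 * (1 / (2 * u)))) / ((2 * sqrt v) * (2 * sqrt v)) = p / (2 * u) + s / (4 * u ^ 3)"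
        unfolding u_def[symmetric] using u(1) by (simp add: power3_eq_cube)
      finally show ?thesis .
    qed
    have dq: "(q has_real_derivative p / (2 * u) - s / (4 * u ^ 3)) (at v)"
    proof -
      have "(q has_real_derivative p * (1 / (2 * u)) + (0 * (2 * sqrt v) - s * (2 * (1 / (2 * u)))) / ((2 * sqrt v) * (2 * sqrt v))) (at v)"
        unfolding q_def using v by (intro DERIV_add DERIV_cmult DERIV_divide DERIV_const ds) auto
      also have "p * (1 / (2 * u)) + (0 * (2 * sqrt v) - s * (2 * (1 / (2 * u)))) / ((2 * sqrt v) * (2 * sqrt v)) = p / (2 * u) - s / (4 * u ^ 3)"
        unfolding u_def[symmetric] using u(1) by (simp add: power3_eq_cube)
      finally show ?thesis .
    qed
    \<comment> \<open>Since (m v)^2 and (q v)^2 equal v p^2 + s^2 / (4 v) minus and plus p s, the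
      prefactors e^(-ps) and e^(ps) make both exponentials coincide; the terms with s / (4 u^3) then
      cancel.\<close>
    have "(F has_real_derivative (exp (- p * s) * (exp (- (m v)\<^sup>2) * (p / (2 * u) + s / (4 * u ^ 3)))
        + exp (p * s) * (exp (- (q v)\<^sup>2) * (p / (2 * u) - s / (4 * u ^ 3)))) / p) (at v)"
      unfolding F_def
      by (intro DERIV_cdivide DERIV_add DERIV_cmult DERIV_chain2[OF E(1)] dm dq)
    moreover have "exp (- p * s) * exp (- (m v)\<^sup>2) = exp (- v * p\<^sup>2 - s\<^sup>2 / (4 * v))"
      unfolding exp_add[symmetric] m_def u_def[symmetric] u(2) using u(1)
      by (simp add: power2_diff power_mult_distrib power_divide)
    moreover have "exp (p * s) * exp (- (q v)\<^sup>2) = exp (- v * p\<^sup>2 - s\<^sup>2 / (4 * v))"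
      unfolding exp_add[symmetric] q_def u_def[symmetric] u(2) using u(1)
      by (simp add: power2_sum power_mult_distrib power_divide)
    ultimately have "(F has_real_derivative (exp (- v * p\<^sup>2 - s\<^sup>2 / (4 * v)) * (p / (2 * u) + s / (4 * u ^ 3))
        + exp (- v * p\<^sup>2 - s\<^sup>2 / (4 * v)) * (p / (2 * u) - s / (4 * u ^ 3))) / p) (at v)"
      by (simp only: mult.assoc[symmetric])
    moreover have "(X * (p / (2 * u) + s / (4 * u ^ 3)) + X * (p / (2 * u) - s / (4 * u ^ 3))) / p = X / sqrt v" for X
      using u(1) p by (simp add: u_def[symmetric] field_simps)
    ultimately show ?thesis by simp
  qed
  \<comment> \<open>Only m has different limits at the two ends, so just the term with e^(-ps)
    survives in \<open>?B - ?A\<close>.\<close>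
  have m_top: "filterlim m at_top at_top" and q_top: "filterlim q at_top at_top"
    and m_0: "filterlim m at_bot (at_right 0)" and q_0: "filterlim q at_top (at_right 0)"
    unfolding m_def q_def using p s by real_asymp+
  have FB: "(F \<longlongrightarrow> ?B) at_top"
    unfolding F_def using p
    by (intro tendsto_intros filterlim_compose[OF E(2) m_top] filterlim_compose[OF E(2) q_top]) auto
  have FA: "(F \<longlongrightarrow> ?A) (at_right 0)"
    unfolding F_def using p
    by (intro tendsto_intros filterlim_compose[OF E(3) m_0] filterlim_compose[OF E(2) q_0]) auto
  have A: "((F \<circ> real_of_ereal) \<longlongrightarrow> ?A) (at_right 0)"
    using FA by (simp add: zero_ereal_def ereal_tendsto_simps)
  have B: "((F \<circ> real_of_ereal) \<longlongrightarrow> ?B) (at_left \<infinity>)"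
    using FB by (simp add: ereal_tendsto_simps)
  have cont: "isCont ?f x" if "0 < ereal x" "ereal x < \<infinity>" for x
    using that by (intro continuous_intros) auto
  have dF': "(F has_real_derivative ?f x) (at x)" if "0 < ereal x" "ereal x < \<infinity>" for x
    using dF[of x] that by simp
  have nonneg: "AE x in lborel. 0 < ereal x \<longrightarrow> ereal x < \<infinity> \<longrightarrow> 0 \<le> ?f x"
    by (intro AE_I2) auto
  have pos: "(0::ereal) < \<infinity>" by simp
  note * = interval_integral_FTC_nonneg[of 0 \<infinity>, OF pos dF' cont nonneg A B]
  have ei: "einterval 0 \<infinity> = {0<..}" by (auto simp: einterval_def)
  have "(\<integral>\<^sup>+v. ennreal (?f v) * indicator {0<..} v \<partial>lborel) = (\<integral>\<^sup>+v. ennreal (indicator {0<..} v *\<^sub>R ?f v) \<partial>lborel)"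
    by (rule nn_integral_cong) (auto simp: indicator_def)
  also have "\<dots> = ennreal (LINT v|lborel. indicator {0<..} v *\<^sub>R ?f v)"
    using *(1) unfolding ei set_integrable_def
    by (rule nn_integral_eq_integral) (auto simp: indicator_def)
  also have "(LINT v|lborel. indicator {0<..} v *\<^sub>R ?f v) = ?B - ?A"
    using *(2) unfolding interval_lebesgue_integral_def ei set_lebesgue_integral_def by simp
  also have "?B - ?A = sqrt pi / p * exp (- p * s)"
    using p by (simp add: field_simps)
  finally show ?thesis .
qed

text \<open>The derivatives telescope, leaving the top-order term. The sum is the upper incomplete
  Gamma function of order k + 1 divided by k!.\<close>

lemma DERIV_exp_partial_sum:
  "((\<lambda>y. \<Sum>i\<le>k. y ^ i / fact i * exp (- y)) has_real_derivative - (y ^ k / fact k * exp (- y))) (at y)"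
proof (induction k)
  case 0
  show ?case by (auto intro!: derivative_eq_intros)
next
  case (Suc k)
  have "((\<lambda>y. exp (- y)) has_real_derivative - exp (- y)) (at y)"
    by (auto intro!: derivative_eq_intros)
  from DERIV_mult[OF DERIV_cdivide[OF DERIV_pow[of "Suc k"]] this]
  have "((\<lambda>y. y ^ Suc k / fact (Suc k) * exp (- y)) has_real_derivative
      (real (Suc k) * y ^ k / fact (Suc k)) * exp (- y) + - exp (- y) * (y ^ Suc k / fact (Suc k))) (at y)"
    unfolding diff_Suc_Suc diff_zero .
  also have "real (Suc k) * y ^ k / fact (Suc k) = y ^ k / fact k"
    by (simp add: field_simps del: of_nat_Suc)
  finally have "((\<lambda>y. y ^ Suc k / fact (Suc k) * exp (- y)) has_real_derivative
      (y ^ k / fact k) * exp (- y) + - exp (- y) * (y ^ Suc k / fact (Suc k))) (at y)" .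
  from DERIV_add[OF Suc this] show ?case
    unfolding sum.atMost_Suc by (rule DERIV_cong) (simp only: minus_add_cancel mult_minus_left mult.commute[of "exp (- y)"])
qed

text \<open>The substitution y = (s^2 - r^2) / (4 v) reduces this to Euler's integral for k!, with
  e^(-r^2/(4v)) split off.\<close>

lemma nn_integral_power_exp_square:
  assumes v: "v > 0" and r: "r \<ge> 0"
  shows "(\<integral>\<^sup>+s. ennreal (s * (s\<^sup>2 - r\<^sup>2) ^ k * exp (- s\<^sup>2 / (4 * v))) * indicator {r..} s \<partial>lborel) =
    ennreal (fact k * (4 * v) ^ Suc k / 2 * exp (- r\<^sup>2 / (4 * v)))"
proof -
  define c where "c = fact k * (4 * v) ^ Suc k / 2 * exp (- r\<^sup>2 / (4 * v))"
  define P where "P = (\<lambda>y::real. \<Sum>i\<le>k. y ^ i / fact i * exp (- y))"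
  define y where "y = (\<lambda>s. (s\<^sup>2 - r\<^sup>2) / (4 * v))"
  have "(\<integral>\<^sup>+s. ennreal (s * (s\<^sup>2 - r\<^sup>2) ^ k * exp (- s\<^sup>2 / (4 * v))) * indicator {r..} s \<partial>lborel) = ennreal (0 - (- c * P (y r)))"
  proof (rule nn_integral_FTC_atLeast[where F = "\<lambda>s. - c * P (y s)"])
    show "(\<lambda>s. s * (s\<^sup>2 - r\<^sup>2) ^ k * exp (- s\<^sup>2 / (4 * v))) \<in> borel_measurable borel" by measurable
    fix s assume s: "r \<le> s"
    then have rs: "r\<^sup>2 \<le> s\<^sup>2" using r by (intro power_mono) auto
    then show "0 \<le> s * (s\<^sup>2 - r\<^sup>2) ^ k * exp (- s\<^sup>2 / (4 * v))" using s r by simp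
    have dy: "(y has_real_derivative (2 * s / (4 * v))) (at s)"
      unfolding y_def using v by (auto intro!: derivative_eq_intros)
    have dP: "(P has_real_derivative - (y s ^ k / fact k * exp (- y s))) (at (y s))"
      unfolding P_def by (rule DERIV_exp_partial_sum)
    have "((\<lambda>s. - c * P (y s)) has_real_derivative - c * (- (y s ^ k / fact k * exp (- y s)) * (2 * s / (4 * v)))) (at s)"
      by (intro DERIV_cmult DERIV_chain2[OF dP dy])
    also have "- c * (- (y s ^ k / fact k * exp (- y s)) * (2 * s / (4 * v))) = s * (s\<^sup>2 - r\<^sup>2) ^ k * exp (- s\<^sup>2 / (4 * v))"
    proof -
      have "exp (- s\<^sup>2 / (4 * v)) = exp (- r\<^sup>2 / (4 * v)) * exp (- y s)"
        unfolding exp_add[symmetric] y_def by (simp add: diff_divide_distrib)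
      moreover have "(4 * v) ^ Suc k * y s ^ k = (4 * v) * (s\<^sup>2 - r\<^sup>2) ^ k"
        unfolding y_def using v by (simp add: power_divide)
      then have "fact k * (4 * v) ^ Suc k / 2 * (y s ^ k / fact k) * (2 * s / (4 * v)) = s * (s\<^sup>2 - r\<^sup>2) ^ k"
        using v by (simp add: field_simps)
      then have "(fact k * (4 * v) ^ Suc k / 2 * (y s ^ k / fact k) * (2 * s / (4 * v))) * (exp (- r\<^sup>2 / (4 * v)) * exp (- y s))
         = s * (s\<^sup>2 - r\<^sup>2) ^ k * (exp (- r\<^sup>2 / (4 * v)) * exp (- y s))" by (simp only:)
      ultimately show ?thesis unfolding c_def by (simp only: minus_mult_minus mult_minus_left mult_minus_right minus_minus mult_ac)
    qed
    finally show "((\<lambda>s. - c * P (y s)) has_real_derivative s * (s\<^sup>2 - r\<^sup>2) ^ k * exp (- s\<^sup>2 / (4 * v))) (at s)" .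
  next
    have "((\<lambda>y::real. y ^ i / fact i * exp (- y)) \<longlongrightarrow> 0) at_top" for i :: nat
    proof -
      have "((\<lambda>y::real. 1 / fact i * (y ^ i / exp y)) \<longlongrightarrow> 1 / fact i * 0) at_top"
        by (intro tendsto_intros tendsto_power_div_exp_0)
      moreover have "(\<lambda>y::real. y ^ i / fact i * exp (- y)) = (\<lambda>y. 1 / fact i * (y ^ i / exp y))"
        by (rule ext) (simp add: exp_minus field_simps)
      ultimately show ?thesis unfolding mult_zero_right by (simp only:)
    qed
    then have "(P \<longlongrightarrow> 0) at_top"
      unfolding P_def by (intro tendsto_null_sum)
    moreover have "filterlim y at_top at_top" unfolding y_def using v by real_asymp
    ultimately have "((\<lambda>s. P (y s)) \<longlongrightarrow> 0) at_top" by (rule filterlim_compose)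
    then show "((\<lambda>s. - c * P (y s)) \<longlongrightarrow> 0) at_top" by (rule tendsto_mult_right_zero)
  qed
  moreover have "P (y r) = 1"
  proof -
    have "P 0 = (\<Sum>i\<le>k. if i = 0 then 1 else 0)" unfolding P_def by (intro sum.cong) auto
    then show ?thesis by (simp add: y_def)
  qed
  ultimately show ?thesis by (simp add: c_def)
qed

text \<open>The Wendland integrand without its factor (1 - s)^l, extended to all s \<ge> r. Here and
  in the lemmas on profiles and densities, \<open>k\<close> is the Wendland smoothness parameter
  minus one.\<close>

definition wprof :: "nat \<Rightarrow> real \<Rightarrow> real \<Rightarrow> real" where
  "wprof k r s = (if s \<ge> r then s * (s\<^sup>2 - r\<^sup>2) ^ k else 0)"

lemma wprof_borel [measurable]: "wprof k r \<in> borel_measurable borel"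
  unfolding wprof_def by measurable

lemma wprof_nonneg: "r \<ge> 0 \<Longrightarrow> wprof k r s \<ge> 0"
  unfolding wprof_def by (auto intro!: mult_nonneg_nonneg zero_le_power power_mono)

text \<open>For r > 0 this is a Matern function: 2 (r / (2 p))^(k + 3/2) times the modified Bessel
  function K of order k + 3/2 at p r.\<close>

definition matern_integral :: "nat \<Rightarrow> real \<Rightarrow> real \<Rightarrow> ennreal" where
  "matern_integral k p r = (\<integral>\<^sup>+v. ennreal (v powr (real k + 1/2) * exp (- v * p\<^sup>2 - r\<^sup>2 / (4 * v))) * indicator {0<..} v \<partial>lborel)"

text \<open>Inserting the subordination formula for e^(-ps) and exchanging the integrals leaves
  \<open>nn_integral_power_exp_square\<close> inside; its v^(k+1) divided by sqrt v gives the
  exponent k + 1/2.\<close>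

lemma matern_profile:
  assumes p: "p > 0" and r: "r \<ge> 0"
  shows "ennreal (sqrt pi / p) * laplace (wprof k r) p =
    ennreal (fact k * 4 ^ Suc k / 2) * matern_integral k p r"
proof -
  let ?W = "\<lambda>s. ennreal (s * (s\<^sup>2 - r\<^sup>2) ^ k) * indicator {r..} s"
  let ?S = "\<lambda>s v. ennreal (exp (- v * p\<^sup>2 - s\<^sup>2 / (4 * v)) / sqrt v) * indicator {0<..} v"
  have W: "s * (s\<^sup>2 - r\<^sup>2) ^ k \<ge> 0" if "s \<ge> r" for s
    using wprof_nonneg[OF r, of k s] that by (simp add: wprof_def)
  have "ennreal (sqrt pi / p) * laplace (wprof k r) p = (\<integral>\<^sup>+s. ?W s * ennreal (sqrt pi / p * exp (- p * s)) \<partial>lborel)"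
    unfolding laplace_def using p r W
    by (subst nn_integral_cmult[symmetric])
       (auto intro!: nn_integral_cong simp: wprof_def indicator_def ennreal_mult'[symmetric] ennreal_mult''[symmetric] mult_ac)
  also have "\<dots> = (\<integral>\<^sup>+s. ?W s * (\<integral>\<^sup>+v. ?S s v \<partial>lborel) \<partial>lborel)"
  \<comment> \<open>Subordination requires s > 0, but for r = 0 the range of integration contains s
    = 0; this null set is excluded.\<close>
  proof (rule nn_integral_cong_AE, use AE_lborel_singleton[of 0] in eventually_elim)
    case (elim s)
    show ?case
    proof (cases "s \<ge> r")
      case True
      with elim r have "s > 0" by auto
      then show ?thesis using nn_integral_subordination[OF p, of s] by simp
    qed auto
  qed
  also have "\<dots> = (\<integral>\<^sup>+s. (\<integral>\<^sup>+v. ?W s * ?S s v \<partial>lborel) \<partial>lborel)"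
    by (intro nn_integral_cong nn_integral_cmult[symmetric]) measurable
  also have "\<dots> = (\<integral>\<^sup>+v. (\<integral>\<^sup>+s. ?W s * ?S s v \<partial>lborel) \<partial>lborel)"
    by (rule lborel_pair.Fubini') measurable
  also have "\<dots> = (\<integral>\<^sup>+v. ennreal (fact k * 4 ^ Suc k / 2) * (ennreal (v powr (real k + 1/2) * exp (- v * p\<^sup>2 - r\<^sup>2 / (4 * v))) * indicator {0<..} v) \<partial>lborel)"
  proof (rule nn_integral_cong)
    fix v :: real
    show "(\<integral>\<^sup>+s. ?W s * ?S s v \<partial>lborel) = ennreal (fact k * 4 ^ Suc k / 2) * (ennreal (v powr (real k + 1/2) * exp (- v * p\<^sup>2 - r\<^sup>2 / (4 * v))) * indicator {0<..} v)"
    proof (cases "v > 0")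
      case v: True
      have "(\<integral>\<^sup>+s. ?W s * ?S s v \<partial>lborel) = (\<integral>\<^sup>+s. ennreal (exp (- v * p\<^sup>2) / sqrt v) * (ennreal (s * (s\<^sup>2 - r\<^sup>2) ^ k * exp (- s\<^sup>2 / (4 * v))) * indicator {r..} s) \<partial>lborel)"
      proof (rule nn_integral_cong)
        fix s :: real
        have e: "exp (- v * p\<^sup>2 - s\<^sup>2 / (4 * v)) = exp (- v * p\<^sup>2) * exp (- s\<^sup>2 / (4 * v))"
          unfolding exp_add[symmetric] by simp
        show "?W s * ?S s v = ennreal (exp (- v * p\<^sup>2) / sqrt v) * (ennreal (s * (s\<^sup>2 - r\<^sup>2) ^ k * exp (- s\<^sup>2 / (4 * v))) * indicator {r..} s)"
        proof (cases "s \<ge> r")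
          case True
          then have "?W s * ?S s v = ennreal (s * (s\<^sup>2 - r\<^sup>2) ^ k * (exp (- v * p\<^sup>2) * exp (- s\<^sup>2 / (4 * v)) / sqrt v))"
            using v W[OF True] unfolding e by (simp add: ennreal_mult'[symmetric])
          also have "s * (s\<^sup>2 - r\<^sup>2) ^ k * (exp (- v * p\<^sup>2) * exp (- s\<^sup>2 / (4 * v)) / sqrt v) =
            exp (- v * p\<^sup>2) / sqrt v * (s * (s\<^sup>2 - r\<^sup>2) ^ k * exp (- s\<^sup>2 / (4 * v)))"
            by simp
          also have "ennreal \<dots> = ennreal (exp (- v * p\<^sup>2) / sqrt v) * ennreal (s * (s\<^sup>2 - r\<^sup>2) ^ k * exp (- s\<^sup>2 / (4 * v)))"
            using v by (intro ennreal_mult') auto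
          finally show ?thesis using True by simp
        qed simp
      qed
      also have "\<dots> = ennreal (exp (- v * p\<^sup>2) / sqrt v) * ennreal (fact k * (4 * v) ^ Suc k / 2 * exp (- r\<^sup>2 / (4 * v)))"
        using nn_integral_power_exp_square[OF v r, of k] by (subst nn_integral_cmult) auto
      also have "\<dots> = ennreal (fact k * 4 ^ Suc k / 2 * ((v ^ Suc k / sqrt v) * (exp (- v * p\<^sup>2) * exp (- r\<^sup>2 / (4 * v)))))"
        using v by (simp add: ennreal_mult'[symmetric] power_mult_distrib mult_ac)
      also have "v ^ Suc k / sqrt v = v powr (real k + 1/2)"
      proof -
        have "real k + 1/2 = real (Suc k) - 1/2" by simp
        then have "v powr (real k + 1/2) = v powr (real (Suc k) - 1/2)" by (simp only:)
        also have "\<dots> = v ^ Suc k / sqrt v"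
          unfolding powr_diff powr_realpow[OF v] using v by (simp add: powr_half_sqrt)
        finally show ?thesis ..
      qed
      also have "exp (- v * p\<^sup>2) * exp (- r\<^sup>2 / (4 * v)) = exp (- v * p\<^sup>2 - r\<^sup>2 / (4 * v))"
        unfolding exp_add[symmetric] by simp
      finally show ?thesis using v by (simp add: ennreal_mult'[symmetric])
    qed auto
  qed
  also have "\<dots> = ennreal (fact k * 4 ^ Suc k / 2) * matern_integral k p r"
    unfolding matern_integral_def by (rule nn_integral_cmult) measurable
  finally show ?thesis .
qed

text \<open>Writing the inverse power as a Gaussian mixture and integrating over z leaves a Gamma
  integral of order m - n / 2, which is positive by the assumption on m.\<close>

lemma integrable_inverse_power:
  fixes p :: real
  assumes p: "p > 0" and m: "2 * m > DIM('a::euclidean_space)"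
  shows "integrable lborel (\<lambda>z::'a. 1 / (p\<^sup>2 + (norm z)\<^sup>2) ^ m)"
proof -
  define n where "n = DIM('a)"
  let ?A = "\<lambda>z::'a. p\<^sup>2 + (norm z)\<^sup>2"
  have A: "?A z > 0" for z using p by (simp add: add_pos_nonneg)
  have m0: "m > 0" using m by simp
  have G: "Gamma (real m) > 0" using m0 by (intro Gamma_real_pos) auto
  have "(\<integral>\<^sup>+z. ennreal (Gamma (real m) * ?A z powr - real m) \<partial>lborel) =
    (\<integral>\<^sup>+z. (\<integral>\<^sup>+v. ennreal (v powr (real m - 1) * exp (- ?A z * v)) * indicator {0<..} v \<partial>lborel) \<partial>lborel)"
    using m0 by (intro nn_integral_cong nn_integral_Gamma[symmetric] A) auto
  also have "\<dots> = (\<integral>\<^sup>+v. (\<integral>\<^sup>+z. ennreal (v powr (real m - 1) * exp (- ?A z * v)) * indicator {0<..} v \<partial>lborel) \<partial>lborel)"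
    by (rule lborel_pair.Fubini') measurable
  also have "\<dots> = (\<integral>\<^sup>+v. ennreal (pi powr (n / 2)) * (ennreal (v powr (real m - n / 2 - 1) * exp (- p\<^sup>2 * v)) * indicator {0<..} v) \<partial>lborel)"
  proof (rule nn_integral_cong)
    fix v :: real
    show "(\<integral>\<^sup>+z. ennreal (v powr (real m - 1) * exp (- ?A z * v)) * indicator {0<..} v \<partial>lborel) =
      ennreal (pi powr (n / 2)) * (ennreal (v powr (real m - n / 2 - 1) * exp (- p\<^sup>2 * v)) * indicator {0<..} v)"
    proof (cases "v > 0")
      case True
      have e: "exp (- ?A z * v) = exp (- p\<^sup>2 * v) * exp (- v * (norm z)\<^sup>2)" for z
        unfolding exp_add[symmetric] by (simp add: algebra_simps)
      have "(\<integral>\<^sup>+z. ennreal (v powr (real m - 1) * exp (- ?A z * v)) * indicator {0<..} v \<partial>lborel) =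
        (\<integral>\<^sup>+z. ennreal (v powr (real m - 1) * exp (- p\<^sup>2 * v)) * ennreal (exp (- v * (norm (z::'a))\<^sup>2)) \<partial>lborel)"
        unfolding e using True by (intro nn_integral_cong) (simp add: ennreal_mult'[symmetric] mult_ac)
      also have "\<dots> = ennreal (v powr (real m - 1) * exp (- p\<^sup>2 * v)) * ennreal ((pi / v) powr (n / 2))"
        using nn_integral_gaussian[OF True, where 'a='a] by (subst nn_integral_cmult) (auto simp: n_def)
      also have "\<dots> = ennreal (v powr (real m - 1) * exp (- p\<^sup>2 * v) * (pi / v) powr (n / 2))"
        by (simp add: ennreal_mult'[symmetric])
      also have "v powr (real m - 1) * exp (- p\<^sup>2 * v) * (pi / v) powr (n / 2) = pi powr (n / 2) * (v powr (real m - n / 2 - 1) * exp (- p\<^sup>2 * v))"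
      proof -
        have "real m - n / 2 - 1 = (real m - 1) - n / 2" by simp
        then have "v powr (real m - n / 2 - 1) = v powr (real m - 1) / v powr (n / 2)"
          by (simp only: powr_diff)
        then show ?thesis using True by (simp add: powr_divide)
      qed
      finally show ?thesis using True by (simp add: ennreal_mult'[symmetric])
    qed auto
  qed
  also have "\<dots> = ennreal (pi powr (n / 2)) * ennreal (Gamma (real m - n / 2) * (p\<^sup>2) powr (- (real m - n / 2)))"
    using m p by (subst nn_integral_cmult, measurable, subst nn_integral_Gamma) (auto simp: n_def)
  also have "\<dots> < \<infinity>" by (simp add: ennreal_mult_less_top)
  finally have fin: "(\<integral>\<^sup>+z. ennreal (Gamma (real m) * ?A z powr - real m) \<partial>lborel) < \<infinity>" .
  have "integrable lborel (\<lambda>z. Gamma (real m) * ?A z powr - real m)"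
    unfolding integrable_iff_bounded using fin G by (simp add: abs_mult)
  from integrable_mult_right[OF this, of "1 / Gamma (real m)"] G
  have "integrable lborel (\<lambda>z. ?A z powr - real m)" by simp
  also have "(\<lambda>z. ?A z powr - real m) = (\<lambda>z. 1 / ?A z ^ m)"
    using A by (intro ext) (simp add: powr_minus powr_realpow inverse_eq_divide)
  finally show ?thesis .
qed

text \<open>The Gaussian mixture again, now with a cosine: Fubini's theorem moves the Fourier
  transform onto the Gaussians, and the exponents of v combine to l - 1 - n / 2 = k + 1/2.
  Nonnegativity is recorded separately since the \<open>ennreal\<close> identity cannot see the
  sign.\<close>

lemma matern_fourier:
  fixes x :: "'a::euclidean_space"
  assumes p: "p > 0" and l: "2 * l = DIM('a) + 3 + 2 * k"
  shows "0 \<le> (LINT z|lborel. cos (z \<bullet> x) / (p\<^sup>2 + (norm z)\<^sup>2) ^ l)"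
    and "ennreal (Gamma (real l)) * ennreal (LINT z|lborel. cos (z \<bullet> x) / (p\<^sup>2 + (norm z)\<^sup>2) ^ l) =
    ennreal (pi powr (DIM('a) / 2)) * matern_integral k p (norm x)"
proof -
  define n where "n = DIM('a)"
  let ?A = "\<lambda>z::'a. p\<^sup>2 + (norm z)\<^sup>2"
  have A: "?A z > 0" for z using p by (simp add: add_pos_nonneg)
  have l0: "real l > 0" using l by simp
  have G: "Gamma (real l) > 0" using l0 by (intro Gamma_real_pos) auto
  have Apow: "?A z powr - real l = 1 / ?A z ^ l" for z
    using A[of z] by (simp add: powr_minus powr_realpow inverse_eq_divide)
  define g where "g = (\<lambda>z v. indicator {0<..} v *\<^sub>R (v powr (real l - 1) * exp (- ?A z * v)))"
  have g0: "g z v \<ge> 0" for z v unfolding g_def by (simp add: indicator_def)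
  have gm [measurable]: "(\<lambda>(z, v). g z v) \<in> borel_measurable (lborel \<Otimes>\<^sub>M lborel)"
    unfolding g_def by measurable
  have gm1 [measurable]: "(\<lambda>v. g z v) \<in> borel_measurable lborel" for z
    unfolding g_def by measurable
  have gv: "(\<integral>\<^sup>+v. ennreal (g z v) \<partial>lborel) = ennreal (Gamma (real l) * (1 / ?A z ^ l))" for z
  proof -
    have "(\<integral>\<^sup>+v. ennreal (g z v) \<partial>lborel) = (\<integral>\<^sup>+v. ennreal (v powr (real l - 1) * exp (- ?A z * v)) * indicator {0<..} v \<partial>lborel)"
      unfolding g_def by (rule nn_integral_cong) (auto simp: indicator_def)
    also have "\<dots> = ennreal (Gamma (real l) * ?A z powr (- real l))"
      by (rule nn_integral_Gamma[OF l0 A])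
    finally show ?thesis unfolding Apow .
  qed
  have int: "integrable lborel (\<lambda>z. Gamma (real l) * (1 / ?A z ^ l))"
    using l by (intro integrable_mult_right integrable_inverse_power p) auto
  have "(\<integral>\<^sup>+q. ennreal (case q of (z, v) \<Rightarrow> g z v) \<partial>(lborel \<Otimes>\<^sub>M lborel)) = (\<integral>\<^sup>+z. \<integral>\<^sup>+v. ennreal (g z v) \<partial>lborel \<partial>lborel)"
    by (subst lborel.nn_integral_fst[symmetric]) auto
  also have "\<dots> = (\<integral>\<^sup>+z. ennreal (Gamma (real l) * (1 / ?A z ^ l)) \<partial>lborel)"
    unfolding gv ..
  also have "\<dots> = ennreal (LINT z|lborel. Gamma (real l) * (1 / ?A z ^ l))"
    using G A by (intro nn_integral_eq_integral int) (auto intro!: AE_I2 mult_nonneg_nonneg simp: less_imp_le)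
  finally have fin: "(\<integral>\<^sup>+q. ennreal (case q of (z, v) \<Rightarrow> g z v) \<partial>(lborel \<Otimes>\<^sub>M lborel)) < \<infinity>" by simp
  have intg: "integrable (lborel \<Otimes>\<^sub>M lborel) (\<lambda>(z, v). g z v)"
    unfolding integrable_iff_bounded using fin g0 by (auto simp: case_prod_unfold)
  have intf: "integrable (lborel \<Otimes>\<^sub>M lborel) (\<lambda>(z, v). g z v * cos (z \<bullet> x))"
    by (rule Bochner_Integration.integrable_bound[OF intg])
       (auto simp: abs_mult mult_left_le case_prod_unfold)
  have "(LINT v|lborel. LINT z|lborel. g z v * cos (z \<bullet> x)) = (LINT z|lborel. LINT v|lborel. g z v * cos (z \<bullet> x))"
    by (rule lborel_pair.Fubini_integral[OF intf])
  also have "\<dots> = (LINT z|lborel. Gamma (real l) * (cos (z \<bullet> x) / ?A z ^ l))"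
  proof (rule Bochner_Integration.integral_cong[OF refl])
    fix z :: 'a
    have "(LINT v|lborel. g z v) = Gamma (real l) * (1 / ?A z ^ l)"
      using gv[of z] G A[of z] by (subst integral_eq_nn_integral) (auto simp: g0)
    then show "(LINT v|lborel. g z v * cos (z \<bullet> x)) = Gamma (real l) * (cos (z \<bullet> x) / ?A z ^ l)" by simp
  qed
  also have "\<dots> = Gamma (real l) * (LINT z|lborel. cos (z \<bullet> x) / ?A z ^ l)"
    by (rule integral_mult_right_zero)
  finally have 1: "Gamma (real l) * (LINT z|lborel. cos (z \<bullet> x) / ?A z ^ l) = (LINT v|lborel. LINT z|lborel. g z v * cos (z \<bullet> x))" ..
  define h where "h = (\<lambda>v. indicator {0<..} v *\<^sub>R (pi powr (n / 2) * (v powr (real k + 1/2) * exp (- v * p\<^sup>2 - (norm x)\<^sup>2 / (4 * v)))))"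
  have gz: "(LINT z|lborel. g z v * cos (z \<bullet> x)) = h v" for v
  proof (cases "v > 0")
    case True
    have e: "g z v * cos (z \<bullet> x) = (v powr (real l - 1) * exp (- p\<^sup>2 * v)) * (exp (- v * (norm z)\<^sup>2) * cos (z \<bullet> x))" for z
    proof -
      have "exp (- ?A z * v) = exp (- p\<^sup>2 * v) * exp (- v * (norm z)\<^sup>2)"
        unfolding exp_add[symmetric] by (simp add: algebra_simps)
      then show ?thesis using True by (simp add: g_def)
    qed
    have "(LINT z|lborel. g z v * cos (z \<bullet> x)) = (v powr (real l - 1) * exp (- p\<^sup>2 * v)) * ((pi / v) powr (n / 2) * exp (- (norm x)\<^sup>2 / (4 * v)))"
      unfolding e using gaussian_fourier(2)[OF True, of x] by (simp add: n_def)
    also have "\<dots> = pi powr (n / 2) * (v powr (real l - 1) / v powr (n / 2)) * (exp (- p\<^sup>2 * v) * exp (- (norm x)\<^sup>2 / (4 * v)))"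
      using True by (simp add: powr_divide)
    also have "v powr (real l - 1) / v powr (n / 2) = v powr (real k + 1/2)"
    proof -
      have "2 * real l = real n + 3 + 2 * real k" using l unfolding n_def by linarith
      then have "real l - 1 - n / 2 = real k + 1/2" by (simp add: field_simps)
      then show ?thesis by (simp add: powr_diff[symmetric])
    qed
    also have "exp (- p\<^sup>2 * v) * exp (- (norm x)\<^sup>2 / (4 * v)) = exp (- v * p\<^sup>2 - (norm x)\<^sup>2 / (4 * v))"
      unfolding exp_add[symmetric] by simp
    finally show ?thesis using True by (simp add: h_def)
  qed (simp add: g_def h_def)
  have inth: "integrable lborel h"
    using lborel_pair.integrable_snd[OF intf] unfolding gz .
  have h0: "h v \<ge> 0" for v unfolding h_def by (simp add: indicator_def)
  have "0 \<le> Gamma (real l) * (LINT z|lborel. cos (z \<bullet> x) / ?A z ^ l)"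
    unfolding 1 gz using h0 by simp
  then show "0 \<le> (LINT z|lborel. cos (z \<bullet> x) / ?A z ^ l)"
    using G by (simp add: zero_le_mult_iff)
  have "ennreal (Gamma (real l)) * ennreal (LINT z|lborel. cos (z \<bullet> x) / ?A z ^ l) = ennreal (LINT v|lborel. h v)"
    using 1 G unfolding gz by (simp add: ennreal_mult'[symmetric])
  also have "\<dots> = (\<integral>\<^sup>+v. ennreal (h v) \<partial>lborel)"
    by (rule nn_integral_eq_integral[symmetric, OF inth]) (auto simp: h0)
  also have "\<dots> = (\<integral>\<^sup>+v. ennreal (pi powr (n / 2)) * (ennreal (v powr (real k + 1/2) * exp (- v * p\<^sup>2 - (norm x)\<^sup>2 / (4 * v))) * indicator {0<..} v) \<partial>lborel)"
    unfolding h_def by (rule nn_integral_cong) (auto simp: indicator_def ennreal_mult'[symmetric])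
  also have "\<dots> = ennreal (pi powr (n / 2)) * matern_integral k p (norm x)"
    unfolding matern_integral_def by (rule nn_integral_cmult) measurable
  finally show "ennreal (Gamma (real l)) * ennreal (LINT z|lborel. cos (z \<bullet> x) / ?A z ^ l) =
    ennreal (pi powr (DIM('a) / 2)) * matern_integral k p (norm x)"
    by (simp add: n_def)
qed

section \<open>Uniqueness for the Laplace transform\<close>

text \<open>A uniqueness theorem of Lerch type. Integer arguments suffice because they produce the
  monomials in e^(-t); by Weierstrass approximation f can then be tested against itself.\<close>

lemma laplace_eq_0_imp_eq_0:
  fixes f :: "real \<Rightarrow> real"
  assumes cont: "continuous_on {0..} f"
    and bound: "\<And>t. t \<ge> 0 \<Longrightarrow> \<bar>f t\<bar> \<le> K * (1 + t) ^ N"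
    and zero: "\<And>i::nat. (LINT t|lborel. indicator {0..} t * (f t * exp (- (real i + 2) * t))) = 0"
    and T: "T \<ge> 0"
  shows "f T = 0"
proof -
  let ?F = "\<lambda>i::nat. \<lambda>t. indicator {0..} t * (f t * exp (- (real i + 1) * t))"
  \<comment> \<open>From 1 + t \<le> 2 (N + 1) e^(t / (2 (N + 1))) the polynomial growth is absorbed
    into e^(t/2); taking N + 1 instead of N keeps the divisor positive for N = 0.\<close>
  define M where "M = K * (2 * real (Suc N)) ^ Suc N"
  have K: "K \<ge> 0" using bound[of 0] by simp
  have M: "\<bar>f t\<bar> \<le> M * exp (t / 2)" if t: "t \<ge> 0" for t
  proof -
    have "1 + t \<le> 2 * real (Suc N) * (1 + t / (2 * real (Suc N)))" using t by (simp add: field_simps)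
    also have "\<dots> \<le> 2 * real (Suc N) * exp (t / (2 * real (Suc N)))"
      by (intro mult_left_mono exp_ge_add_one_self) auto
    finally have "(1 + t) ^ Suc N \<le> (2 * real (Suc N) * exp (t / (2 * real (Suc N)))) ^ Suc N"
      using t by (intro power_mono) auto
    also have "\<dots> = (2 * real (Suc N)) ^ Suc N * exp (real (Suc N) * (t / (2 * real (Suc N))))"
      unfolding power_mult_distrib exp_of_nat_mult by simp
    also have "real (Suc N) * (t / (2 * real (Suc N))) = t / 2" by (simp add: field_simps)
    finally have "(1 + t) ^ Suc N \<le> (2 * real (Suc N)) ^ Suc N * exp (t / 2)" .
    moreover have "(1 + t) ^ N \<le> (1 + t) ^ Suc N" using t by (intro power_increasing) auto
    ultimately have "K * (1 + t) ^ N \<le> K * ((2 * real (Suc N)) ^ Suc N * exp (t / 2))"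
      using K by (intro mult_left_mono) auto
    then show ?thesis using bound[OF t] unfolding M_def by (simp only: mult.assoc)
  qed
  let ?B = "\<lambda>t. indicator {0..} t * (M * exp (- t / 2))"
  have M0: "M \<ge> 0" using K by (simp add: M_def)
  \<comment> \<open>With \<open>y = exp (- t)\<close> the hypothesis says that \<open>G\<close> is orthogonal to all polynomials.\<close>
  define G where "G = (\<lambda>y. if y \<le> 0 then 0 else f (- ln y) * y)"
  have G_exp: "G (exp (- t)) = f t * exp (- t)" for t by (simp add: G_def)
  \<comment> \<open>The extra factor y in \<open>G\<close> beats the growth y^(-1/2) of f (- ln y),
    so \<open>G\<close> is continuous at 0 with value 0.\<close>
  have contG: "continuous_on {0..1} G"
    unfolding continuous_on_eq_continuous_within
  proof
    fix y :: real assume y: "y \<in> {0..1}"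
    show "continuous (at y within {0..1}) G"
    proof (cases "y = 0")
      case True
      have "(G \<longlongrightarrow> 0) (at 0 within {0..1})"
      proof (rule Lim_null_comparison)
        show "\<forall>\<^sub>F y in at 0 within {0..1}. norm (G y) \<le> M * sqrt y"
          unfolding eventually_at_filter
        proof (intro always_eventually allI impI)
          fix y :: real assume y: "y \<noteq> 0" "y \<in> {0..1}"
          then have y0: "y > 0" by auto
          have "exp (- ln y / 2) = 1 / sqrt y"
            using y0 by (simp add: exp_minus ln_sqrt[symmetric] inverse_eq_divide)
          then have "\<bar>f (- ln y)\<bar> \<le> M * (1 / sqrt y)"
            using M[of "- ln y"] y y0 by simp
          then have "\<bar>f (- ln y)\<bar> * y \<le> M * (1 / sqrt y) * y"
            using y0 by (intro mult_right_mono) auto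
          also have "\<dots> = M * (y / sqrt y)" by simp
          also have "y / sqrt y = sqrt y" using y0 by (intro real_div_sqrt) auto
          finally show "norm (G y) \<le> M * sqrt y"
            using y0 by (simp add: G_def abs_mult)
        qed
        have "((\<lambda>y. M * sqrt y) \<longlongrightarrow> M * sqrt 0) (at 0 within {0..1})"
          by (intro tendsto_intros)
        then show "((\<lambda>y. M * sqrt y) \<longlongrightarrow> 0) (at 0 within {0..1})" by simp
      qed
      then show ?thesis unfolding continuous_within True by (simp add: G_def)
    next
      case False
      have "continuous_on {0<..1} (\<lambda>y. f (- ln y) * y)"
        by (intro continuous_intros continuous_on_compose2[OF cont]) auto
      then have "continuous_on {0<..1} G"
        by (rule continuous_on_eq) (auto simp: G_def)
      moreover have "at y within {0..1} = at y within {0<..1}"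
        by (rule at_within_nhd[of _ "{0<..}"]) (use y False in auto)
      ultimately show ?thesis
        using y False unfolding continuous_on_eq_continuous_within by simp
    qed
  qed
  have fm: "(\<lambda>t. indicator {0..} t * f t) \<in> borel_measurable borel"
    using borel_measurable_continuous_on_indicator[OF _ cont] by simp
  have base: "integrable lborel (\<lambda>t. ?B t)"
  proof -
    have "(\<integral>\<^sup>+t. ennreal (M * exp (- t / 2)) * indicator {0..} t \<partial>lborel) = ennreal (0 - (- 2 * M * exp (- 0 / 2)))"
    proof (rule nn_integral_FTC_atLeast)
      show "((\<lambda>t. - 2 * M * exp (- t / 2)) has_real_derivative M * exp (- t / 2)) (at t)" for t
        by (auto intro!: derivative_eq_intros)
      show "((\<lambda>t. - 2 * M * exp (- t / 2)) \<longlongrightarrow> 0) at_top" by real_asymp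
    qed (auto simp: M0)
    also have "\<dots> < \<infinity>" by simp
    finally have "(\<integral>\<^sup>+t. ennreal (M * exp (- t / 2)) * indicator {0..} t \<partial>lborel) < \<infinity>" .
    moreover have "(\<integral>\<^sup>+t. ennreal (norm (?B t)) \<partial>lborel)
       = (\<integral>\<^sup>+t. ennreal (M * exp (- t / 2)) * indicator {0..} t \<partial>lborel)"
      using M0 by (intro nn_integral_cong) (auto simp: indicator_def)
    ultimately show ?thesis unfolding integrable_iff_bounded by simp
  qed
  have int: "integrable lborel (\<lambda>t. ?F i t)" for i
  proof (rule Bochner_Integration.integrable_bound[OF base])
    show "(\<lambda>t. ?F i t) \<in> borel_measurable lborel"
      unfolding mult.assoc[symmetric] using fm by measurable
    show "AE t in lborel. norm (?F i t) \<le> norm (?B t)"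
    proof (rule AE_I2)
      fix t :: real
      show "norm (?F i t) \<le> norm (?B t)"
      proof (cases "t \<ge> 0")
        case True
        have "\<bar>f t\<bar> * exp (- (real i + 1) * t) \<le> (M * exp (t / 2)) * exp (- t)"
          using True M M0 by (intro mult_mono) (auto simp: algebra_simps)
        also have "\<dots> = M * exp (- t / 2)" unfolding mult.assoc exp_add[symmetric] by simp
        finally show ?thesis using True M0 by (simp add: abs_mult)
      qed simp
    qed
  qed
  let ?d = "\<lambda>g t. ?F 1 t * G (exp (- t)) - ?F 1 t * g (exp (- t))"
  define B where "B = (LINT t|lborel. \<bar>?F 1 t\<bar>)"
  let ?I = "LINT t|lborel. ?F 1 t * G (exp (- t))"
  have Gm: "(\<lambda>t. indicator {0..} t * G (exp (- t))) \<in> borel_measurable borel"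
    unfolding G_exp mult.assoc[symmetric] using fm by measurable
  \<comment> \<open>Replacing \<open>G\<close> by a polynomial within e changes the integral by at
    most e * B, and the polynomial integrates to 0 by hypothesis.\<close>
  have I_le: "\<bar>?I\<bar> \<le> e * B" if e: "e > 0" for e
  proof -
    obtain g where g: "real_polynomial_function g" "\<And>y. y \<in> {0..1} \<Longrightarrow> \<bar>G y - g y\<bar> < e"
      using Stone_Weierstrass_real_polynomial_function[OF _ contG e] by auto
    obtain a n where a: "g = (\<lambda>y. \<Sum>i\<le>n. a i * y ^ i)"
      using g(1) unfolding real_polynomial_function_iff_sum by auto
    have pow: "?F 1 t * (a i * exp (- t) ^ i) = a i * (indicator {0..} t * (f t * exp (- (real i + 2) * t)))" for t i
    proof -
      have "exp (- (real 1 + 1) * t) * exp (- t) ^ i = exp (- (real i + 2) * t)"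
        unfolding exp_of_nat_mult[symmetric] exp_add[symmetric] by (simp add: algebra_simps)
      then show ?thesis by (simp add: mult_ac)
    qed
    have ig: "integrable lborel (\<lambda>t. ?F 1 t * g (exp (- t)))"
      "(LINT t|lborel. ?F 1 t * g (exp (- t))) = 0"
    proof -
      have i2: "integrable lborel (\<lambda>t. a i * (indicator {0..} t * (f t * exp (- (real i + 2) * t))))" for i
        using int[of "i + 1"] by (intro integrable_mult_right) (simp add: add_ac)
      show "integrable lborel (\<lambda>t. ?F 1 t * g (exp (- t)))"
        unfolding a sum_distrib_left pow by (intro Bochner_Integration.integrable_sum i2)
      have "(LINT t|lborel. ?F 1 t * g (exp (- t))) =
         (\<Sum>i\<le>n. LINT t|lborel. a i * (indicator {0..} t * (f t * exp (- (real i + 2) * t))))"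
        unfolding a sum_distrib_left pow by (intro Bochner_Integration.integral_sum i2)
      then show "(LINT t|lborel. ?F 1 t * g (exp (- t))) = 0"
        by (simp only: integral_mult_right_zero zero mult_zero_right sum.neutral_const)
    qed
    have ib: "integrable lborel (\<lambda>t. e * \<bar>?F 1 t\<bar>)"
      by (intro integrable_mult_right integrable_abs int)
    have pt: "\<bar>?d g t\<bar>
       \<le> e * \<bar>?F 1 t\<bar>" for t
    proof (cases "t \<ge> 0")
      case True
      then have "\<bar>G (exp (- t)) - g (exp (- t))\<bar> \<le> e" by (intro less_imp_le g(2)) auto
      then show ?thesis unfolding right_diff_distrib[symmetric] abs_mult[of _ "G (exp (- t)) - g (exp (- t))"]
        by (subst mult.commute) (intro mult_right_mono, auto)
    qed simp
    have Gm2: "(\<lambda>t. ?F 1 t * G (exp (- t))) \<in> borel_measurable lborel"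
    proof -
      have "(\<lambda>t. (indicator {0..} t * f t) * exp (- (real 1 + 1) * t) * (indicator {0..} t * G (exp (- t)))) \<in> borel_measurable lborel"
        using fm Gm by measurable
      also have "(\<lambda>t. (indicator {0..} t * f t) * exp (- (real 1 + 1) * t) * (indicator {0..} t * G (exp (- t)))) = (\<lambda>t. ?F 1 t * G (exp (- t)))"
        by (intro ext) (auto simp: indicator_def)
      finally show ?thesis .
    qed
    have idf: "integrable lborel (\<lambda>t. ?d g t)"
      by (rule Bochner_Integration.integrable_bound[OF ib])
         (use pt Gm2 ig(1) in \<open>auto intro!: borel_measurable_diff simp del: of_nat_1 intro: order_trans[OF _ abs_ge_self]\<close>)
    have iG: "integrable lborel (\<lambda>t. ?F 1 t * G (exp (- t)))"
      using Bochner_Integration.integrable_add[OF idf ig(1)] by simp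
    have "\<bar>?I\<bar> = \<bar>LINT t|lborel. ?d g t\<bar>"
      using ig(2) by (subst Bochner_Integration.integral_diff[OF iG ig(1)]) simp
    also have "\<dots> \<le> (LINT t|lborel. e * \<bar>?F 1 t\<bar>)"
      by (rule order_trans[OF integral_abs_bound integral_mono[OF integrable_abs[OF idf] ib pt]])
    also have "\<dots> = e * B" by (simp only: B_def integral_mult_right_zero)
    finally show ?thesis .
  qed
  have B0: "B \<ge> 0" unfolding B_def by simp
  have I0: "?I = 0"
  proof (rule ccontr)
    assume "?I \<noteq> 0"
    then have "\<bar>?I\<bar> \<le> (\<bar>?I\<bar> / (2 * (B + 1))) * B" using B0 by (intro I_le divide_pos_pos) auto
    also have "\<dots> = \<bar>?I\<bar> / 2 * (B / (B + 1))" using B0 by simp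
    also have "\<dots> \<le> \<bar>?I\<bar> / 2 * 1" using B0 by (intro mult_left_mono) auto
    finally show False using \<open>?I \<noteq> 0\<close> by simp
  qed
  \<comment> \<open>Testing with \<open>G\<close> itself produces the weighted square of f, whose
    integral is therefore 0.\<close>
  let ?h = "\<lambda>t. (f t)\<^sup>2 * exp (- 3 * t)"
  have hI: "?F 1 t * G (exp (- t)) = indicator {0..} t * ?h t" for t
  proof -
    have "exp (- (real 1 + 1) * t) * exp (- t) = exp (- 3 * t)" unfolding exp_add[symmetric] by simp
    then show ?thesis unfolding G_exp by (simp add: power2_eq_square mult_ac)
  qed
  have ih: "integrable lborel (\<lambda>t. indicator {0..} t * ?h t)"
  proof (rule Bochner_Integration.integrable_bound[OF integrable_mult_right[OF base, of M]])
    have "(\<lambda>t. (indicator {0..} t * f t) * (indicator {0..} t * f t) * exp (- 3 * t)) \<in> borel_measurable lborel"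
      using fm by measurable
    also have "(\<lambda>t. (indicator {0..} t * f t) * (indicator {0..} t * f t) * exp (- 3 * t)) = (\<lambda>t. indicator {0..} t * ?h t)"
      by (intro ext) (auto simp: indicator_def power2_eq_square)
    finally show "(\<lambda>t. indicator {0..} t * ?h t) \<in> borel_measurable lborel" .
    show "AE t in lborel. norm (indicator {0..} t * ?h t) \<le> norm (M * (?B t))"
    proof (rule AE_I2)
      fix t :: real
      show "norm (indicator {0..} t * ?h t) \<le> norm (M * (?B t))"
      proof (cases "t \<ge> 0")
        case True
        have "\<bar>f t\<bar> ^ 2 \<le> (M * exp (t / 2)) ^ 2" using M[OF True] by (intro power_mono) auto
        then have "(f t)\<^sup>2 * exp (- 3 * t) \<le> (M * exp (t / 2)) ^ 2 * exp (- 3 * t)" by simp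
        also have "\<dots> = M * (M * (exp (t / 2) ^ 2 * exp (- 3 * t)))" by (simp add: power2_eq_square)
        also have "exp (t / 2) ^ 2 * exp (- 3 * t) = exp (- 2 * t)"
          unfolding exp_of_nat_mult[symmetric] exp_add[symmetric] by simp
        also have "M * (M * exp (- 2 * t)) \<le> M * (M * exp (- t / 2))"
          using True M0 by (intro mult_left_mono) auto
        finally show ?thesis using True M0 by simp
      qed simp
    qed
  qed
  \<comment> \<open>The endpoint T + 1 keeps the interval nondegenerate even for T = 0, so that a
    continuous nonnegative function with integral 0 must vanish at T.\<close>
  have "(LINT t|lborel. indicator {0..T + 1} t * ?h t) \<le> (LINT t|lborel. indicator {0..} t * ?h t)"
    by (rule integral_mono_AE') (use ih in \<open>auto simp: indicator_def\<close>)
  also have "\<dots> = 0" using I0 unfolding hI .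
  finally have le0: "(LINT t:{0..T+1}|lborel. ?h t) \<le> 0" unfolding set_lebesgue_integral_def by simp
  have conth: "continuous_on {0..T+1} ?h"
    by (intro continuous_intros continuous_on_subset[OF cont]) auto
  have "set_integrable lborel {0..T+1} ?h"
    by (rule borel_integrable_atLeastAtMost') (rule conth)
  from set_borel_integral_eq_integral[OF this] le0 have h0: "integral {0..T+1} ?h \<le> 0" by simp
  have "integral {0..T+1} ?h \<ge> 0"
    by (intro integral_nonneg integrable_continuous_interval conth) auto
  with h0 have "integral {0..T+1} ?h = 0" by simp
  then have "(?h has_integral 0) (cbox 0 (T + 1))"
    using integrable_integral[OF integrable_continuous_interval[OF conth]] by simp
  then have "?h T = 0"
    using T conth by (intro has_integral_0_cbox_imp_0[of 0 "T + 1" ?h T]) (auto simp: box_real)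
  then show ?thesis by simp
qed

section \<open>Fourier representation of the Wendland functions\<close>

text \<open>Up to a constant, \<open>wscaled l k r t\<close> is \<open>t\<close> to the power \<open>l + 2 k + 2\<close> times \<open>wendland l (k + 1) (r / t)\<close>.
  In this scaling it is a convolution in the variable \<open>t\<close>.\<close>

definition wscaled :: "nat \<Rightarrow> nat \<Rightarrow> real \<Rightarrow> real \<Rightarrow> real" where
  "wscaled l k r t = (if t \<le> r then 0 else integral {r..t} (\<lambda>s. (t - s) ^ l * (s * (s\<^sup>2 - r\<^sup>2) ^ k)))"

text \<open>On the fixed interval [0, 1], with \<open>max 0 (t - r)\<close> as length, continuity in
  t becomes continuity of a parameter integral and both branches of the definition are covered by
  one formula.\<close>

lemma wscaled_altdef:
  "wscaled l k r t = max 0 (t - r) * integral {0..1} (\<lambda>u. (max 0 (t - r) * (1 - u)) ^ l *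
     ((r + u * max 0 (t - r)) * ((r + u * max 0 (t - r))\<^sup>2 - r\<^sup>2) ^ k))"
proof (cases "t \<le> r")
  case False
  define T where "T = t - r"
  have T: "T > 0" using False by (simp add: T_def)
  let ?g = "\<lambda>s. (t - s) ^ l * (s * (s\<^sup>2 - r\<^sup>2) ^ k)"
  have "(?g has_integral integral {r..t} ?g) {r..t}"
    by (intro integrable_integral integrable_continuous_interval continuous_intros)
  from has_integral_affinity[OF this[folded cbox_interval], of T r] T
  have "((\<lambda>u. ?g (T * u + r)) has_integral integral {r..t} ?g / T) ((\<lambda>x. (x - r) / T) ` {r..t})"
    by (simp add: divide_inverse mult.commute right_diff_distrib)
  also have "(\<lambda>x. (x - r) / T) ` {r..t} = {0..1}"
  proof (intro equalityI subsetI)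
    fix u :: real assume u: "u \<in> {0..1}"
    then have "u * T \<le> t - r" "0 \<le> u * T" using T by (auto simp: T_def intro: mult_left_le_one_le)
    then show "u \<in> (\<lambda>x. (x - r) / T) ` {r..t}"
      using T by (intro image_eqI[of _ _ "r + u * T"]) (simp, simp)
  qed (use T in \<open>auto simp: T_def\<close>)
  finally have "integral {0..1} (\<lambda>u. ?g (T * u + r)) = integral {r..t} ?g / T" by (rule integral_unique)
  moreover have "?g (T * u + r) = (T * (1 - u)) ^ l * ((r + u * T) * ((r + u * T)\<^sup>2 - r\<^sup>2) ^ k)" for u
    by (simp add: T_def algebra_simps)
  ultimately show ?thesis using T False by (simp add: wscaled_def max_def T_def[symmetric])
qed (simp add: wscaled_def)

lemma continuous_on_wscaled: "continuous_on A (wscaled l k r)"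
proof -
  have "continuous_on (UNIV::real set) (\<lambda>T. integral (cbox 0 1) (\<lambda>u. (T * (1 - u)) ^ l * ((r + u * T) * ((r + u * T)\<^sup>2 - r\<^sup>2) ^ k)))"
    by (rule integral_continuous_on_param) (unfold case_prod_unfold, intro continuous_intros)
  then have *: "continuous_on (UNIV::real set) (\<lambda>T. integral {0..1} (\<lambda>u. (T * (1 - u)) ^ l * ((r + u * T) * ((r + u * T)\<^sup>2 - r\<^sup>2) ^ k)))"
    by simp
  have **: "continuous_on A (\<lambda>t. max 0 (t - r))" by (intro continuous_intros)
  show ?thesis unfolding wscaled_altdef[abs_def]
    by (intro continuous_intros continuous_on_compose2[OF * **]) auto
qed

lemma wscaled_convolution:
  assumes r: "r \<ge> 0"
  shows "ennreal (wscaled l k r t) = (\<integral>\<^sup>+s. ennreal ((t - s) ^ l * wprof k r s) * indicator {0..t} s \<partial>lborel)"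
proof (cases "t \<le> r")
  case True
  have "AE s in lborel. ennreal ((t - s) ^ l * wprof k r s) * indicator {0..t} s = 0"
    using AE_lborel_singleton[of r] by eventually_elim (use True in \<open>auto simp: indicator_def wprof_def\<close>)
  then show ?thesis using True by (simp add: wscaled_def nn_integral_0_iff_AE)
next
  case False
  have n: "s * (s\<^sup>2 - r\<^sup>2) ^ k \<ge> 0" if "s \<ge> r" for s
    using wprof_nonneg[OF r, of k s] that by (simp add: wprof_def)
  have "(\<integral>\<^sup>+s. ennreal ((t - s) ^ l * wprof k r s) * indicator {0..t} s \<partial>lborel) =
    (\<integral>\<^sup>+s. ennreal ((t - s) ^ l * (s * (s\<^sup>2 - r\<^sup>2) ^ k)) * indicator {r..t} s \<partial>lborel)"
    using r by (intro nn_integral_cong) (auto simp: indicator_def wprof_def)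
  also have "\<dots> = ennreal (integral {r..t} (\<lambda>s. (t - s) ^ l * (s * (s\<^sup>2 - r\<^sup>2) ^ k)))"
    by (intro nn_integral_Icc_continuous continuous_intros mult_nonneg_nonneg[OF _ n]) auto
  finally show ?thesis using False by (simp add: wscaled_def)
qed

lemma wscaled_bound:
  assumes "r \<ge> 0" "t \<ge> 0"
  shows "0 \<le> wscaled l k r t" "wscaled l k r t \<le> (1 + t) ^ (l + 2 * k + 2)"
proof -
  let ?g = "\<lambda>s. (t - s) ^ l * (s * (s\<^sup>2 - r\<^sup>2) ^ k)"
  have g0: "0 \<le> ?g s" if "s \<in> {r..t}" for s
    using that assms by (auto intro!: mult_nonneg_nonneg zero_le_power power_mono)
  have int: "?g integrable_on {r..t}" by (intro integrable_continuous_interval continuous_intros)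
  show "0 \<le> wscaled l k r t" unfolding wscaled_def using g0 int by (auto intro: integral_nonneg)
  show "wscaled l k r t \<le> (1 + t) ^ (l + 2 * k + 2)"
  proof (cases "t \<le> r")
    case False
    have "integral {r..t} ?g \<le> integral {r..t} (\<lambda>s::real. (1 + t) ^ l * ((1 + t) * ((1 + t) ^ 2) ^ k))"
    proof (intro integral_le int integrable_const_ivl)
      fix s assume s: "s \<in> {r..t}"
      have "s\<^sup>2 \<le> (1 + t)\<^sup>2" "r\<^sup>2 \<le> s\<^sup>2" using s assms by (auto intro!: power_mono)
      then have "0 \<le> s\<^sup>2 - r\<^sup>2" "s\<^sup>2 - r\<^sup>2 \<le> (1 + t) ^ 2"
        using zero_le_power2[of r] by linarith+
      then show "?g s \<le> (1 + t) ^ l * ((1 + t) * ((1 + t) ^ 2) ^ k)"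
        using s assms by (intro mult_mono power_mono) auto
    qed
    also have "\<dots> = (t - r) * ((1 + t) ^ l * ((1 + t) * ((1 + t) ^ 2) ^ k))" using False by simp
    also have "\<dots> \<le> (1 + t) * ((1 + t) ^ l * ((1 + t) * ((1 + t) ^ 2) ^ k))"
      using assms by (intro mult_right_mono) auto
    also have "\<dots> = (1 + t) ^ (l + 2 * k + 2)" by (simp add: power_add power_mult mult_ac power2_eq_square power_mult_distrib)
    finally show ?thesis using False by (simp add: wscaled_def)
  qed (use assms in \<open>simp add: wscaled_def\<close>)
qed

lemma laplace_power:
  assumes p: "p > 0"
  shows "laplace (\<lambda>t. t ^ l) p = ennreal (fact l / p ^ Suc l)"
proof -
  have "laplace (\<lambda>t. t ^ l) p = (\<integral>\<^sup>+t. ennreal (t powr (real (Suc l) - 1) * exp (- p * t)) * indicator {0<..} t \<partial>lborel)"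
    unfolding laplace_def
    by (rule nn_integral_cong_AE, use AE_lborel_singleton[of 0] in eventually_elim)
       (auto simp: indicator_def powr_realpow)
  also have "\<dots> = ennreal (Gamma (real (Suc l)) * p powr (- real (Suc l)))"
    by (rule nn_integral_Gamma) (use p in auto)
  also have "Gamma (real (Suc l)) * p powr (- real (Suc l)) = fact l / p ^ Suc l"
    using p Gamma_fact[of l, where 'a=real] unfolding powr_minus powr_realpow[OF p]
    by (simp add: divide_inverse add.commute)
  finally show ?thesis .
qed

text \<open>The numerator collects l! from \<open>laplace_power\<close>, the constant of
  \<open>matern_profile\<close> and Gamma l from \<open>matern_fourier\<close>; the denominator sqrt
  pi from subordination and pi^(n/2) from the Gaussian transform.\<close>

definition matern_const :: "nat \<Rightarrow> nat \<Rightarrow> nat \<Rightarrow> real" where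
  "matern_const n l k = fact l * (fact k * 4 ^ Suc k / 2) * Gamma (real l) / (sqrt pi * pi powr (n / 2))"

text \<open>The convolution factor t^l gives p^(-l-1) and subordination returns one p. The resulting
  p^(-l) is what matches the l-th power of 1 / (p (p^2 + w^2)).\<close>

lemma laplace_wscaled:
  fixes x :: "'a::euclidean_space"
  assumes p: "p > 0" and l: "2 * l = DIM('a) + 3 + 2 * k"
  shows "laplace (wscaled l k (norm x)) p =
    ennreal (matern_const DIM('a) l k / p ^ l * (LINT z|lborel. cos (z \<bullet> x) / (p\<^sup>2 + (norm z)\<^sup>2) ^ l))"
proof -
  let ?r = "norm x"
  define I where "I = (LINT z|lborel. cos (z \<bullet> x) / (p\<^sup>2 + (norm z)\<^sup>2) ^ l)"
  define J where "J = matern_integral k p (norm x)"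
  define c1 where "c1 = fact k * 4 ^ Suc k / (2::real)"
  define c2 where "c2 = pi powr (DIM('a) / 2)"
  have c: "c1 > 0" "c2 > 0" by (auto simp: c1_def c2_def)
  have G: "Gamma (real l) > 0" using l by (intro Gamma_real_pos) auto
  have I0: "I \<ge> 0" unfolding I_def by (rule matern_fourier(1)[OF p l])
  have e1: "ennreal (Gamma (real l)) * ennreal I = ennreal c2 * J"
    unfolding I_def J_def c2_def by (rule matern_fourier(2)[OF p l])
  have J: "J = ennreal (Gamma (real l) * I / c2)"
  proof -
    have "J = ennreal (1 / c2) * (ennreal c2 * J)"
      using c by (simp add: mult.assoc[symmetric] ennreal_mult'[symmetric])
    also have "\<dots> = ennreal (Gamma (real l) * I / c2)"
      unfolding e1[symmetric] using c G I0 by (simp add: ennreal_mult'[symmetric])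
    finally show ?thesis .
  qed
  have e2: "ennreal (sqrt pi / p) * laplace (wprof k ?r) p = ennreal c1 * J"
    unfolding c1_def J_def by (rule matern_profile[OF p]) simp
  have W: "laplace (wprof k ?r) p = ennreal (p / sqrt pi * c1 * (Gamma (real l) * I / c2))"
  proof -
    have "laplace (wprof k ?r) p = ennreal (p / sqrt pi) * (ennreal (sqrt pi / p) * laplace (wprof k ?r) p)"
      using p by (simp add: mult.assoc[symmetric] ennreal_mult'[symmetric])
    also have "\<dots> = ennreal (p / sqrt pi) * ennreal (c1 * (Gamma (real l) * I / c2))"
      unfolding e2 J using c by (subst ennreal_mult'[symmetric]) auto
    also have "\<dots> = ennreal (p / sqrt pi * (c1 * (Gamma (real l) * I / c2)))"
      using p by (subst ennreal_mult') auto
    finally show ?thesis by (simp only: mult.assoc)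
  qed
  have "laplace (wscaled l k ?r) p = laplace (\<lambda>t. t ^ l) p * laplace (wprof k ?r) p"
    by (rule laplace_convolution) (auto intro: wprof_nonneg wscaled_convolution)
  also have "\<dots> = ennreal (fact l / p ^ Suc l * (p / sqrt pi * c1 * (Gamma (real l) * I / c2)))"
    unfolding laplace_power[OF p] W using p by (subst ennreal_mult') auto
  also have "fact l / p ^ Suc l * (p / sqrt pi * c1 * (Gamma (real l) * I / c2)) = matern_const DIM('a) l k / p ^ l * I"
    using p by (simp add: matern_const_def c1_def c2_def field_simps)
  finally show ?thesis by (simp add: I_def)
qed

lemma osc_conv_radial_borel [measurable]:
  "(\<lambda>z::'a::euclidean_space. osc_conv m (norm z) t) \<in> borel_measurable borel"
  by (intro borel_measurable_continuous_onI continuous_intros)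

lemma osc_conv_radial_bound:
  assumes "0 \<le> t" "t \<le> T"
  shows "\<bar>osc_conv m w t\<bar> \<le> T ^ m * (2 * (1 + T\<^sup>2)) ^ Suc m * (1 / (1\<^sup>2 + w\<^sup>2) ^ Suc m)"
proof -
  have "osc_conv m w t \<le> t ^ m * (2 * (1 + T\<^sup>2) / (1 + w\<^sup>2)) ^ Suc m"
    by (rule osc_conv_le[OF assms])
  also have "\<dots> \<le> T ^ m * (2 * (1 + T\<^sup>2) / (1 + w\<^sup>2)) ^ Suc m"
    using assms by (intro mult_right_mono power_mono zero_le_power) auto
  also have "\<dots> = T ^ m * (2 * (1 + T\<^sup>2)) ^ Suc m * (1 / (1\<^sup>2 + w\<^sup>2) ^ Suc m)"
    unfolding power_divide by (simp only: times_divide_eq_right mult_1_right power_one)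
  finally show ?thesis using osc_conv_nonneg[OF assms(1), of m w] by simp
qed

text \<open>As functions of T both sides are continuous, of polynomial growth and have equal Laplace
  transforms. The index l is \<open>Suc m\<close> because \<open>osc_conv m\<close> has m + 1
  factors.\<close>

theorem wscaled_fourier:
  fixes x :: "'a::euclidean_space"
  assumes l: "2 * Suc m = DIM('a) + 3 + 2 * k" and T: "T \<ge> 0"
  shows "wscaled (Suc m) k (norm x) T = matern_const DIM('a) (Suc m) k * (LINT z|lborel. osc_conv m (norm z) T * cos (z \<bullet> x))"
proof -
  define C where "C = matern_const DIM('a) (Suc m) k"
  let ?r = "norm x"
  let ?W = "wscaled (Suc m) k ?r"
  let ?K = "\<lambda>t z. osc_conv m (norm z) t * cos (z \<bullet> x)"
  let ?B = "\<lambda>t (z::'a). t ^ m * (2 * (1 + t\<^sup>2)) ^ Suc m * (1 / (1\<^sup>2 + (norm z)\<^sup>2) ^ Suc m)"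
  let ?I = "\<lambda>p. LINT z|lborel. cos (z \<bullet> x) / (p\<^sup>2 + (norm z)\<^sup>2) ^ Suc m"
  let ?WL = "\<lambda>p t. indicator {0..} t * (?W t * exp (- p * t))"
  define R where "R = (\<lambda>t. LINT z|lborel. ?K t z)"
  let ?R = "\<lambda>p t. indicator {0..} t * (R t * exp (- p * t))"
  have m: "2 * Suc m > DIM('a)" using l by simp
  define Q where "Q = (LINT z::'a|lborel. 1 / (1\<^sup>2 + (norm z)\<^sup>2) ^ Suc m)"
  have intQ: "integrable lborel (\<lambda>z::'a. 1 / (1\<^sup>2 + (norm z)\<^sup>2) ^ Suc m)"
    by (intro integrable_inverse_power m) simp
  have Q0: "Q \<ge> 0" unfolding Q_def by (intro Bochner_Integration.integral_nonneg) simp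
  have meas: "(\<lambda>z. ?K t z) \<in> borel_measurable lborel" for t
    by measurable
  have pt: "\<bar>?K t z\<bar> \<le> ?B U z"
    if "0 \<le> t" "t \<le> U" for t U z
  proof -
    have "\<bar>?K t z\<bar> \<le> \<bar>osc_conv m (norm z) t\<bar>"
      unfolding abs_mult by (rule mult_left_le) auto
    with osc_conv_radial_bound[OF that, of m "norm z"] show ?thesis by linarith
  qed
  have intU: "integrable lborel (\<lambda>z::'a. ?B U z)" for U
    by (intro integrable_mult_right intQ)
  have intR: "integrable lborel (\<lambda>z. ?K t z)" if "t \<ge> 0" for t
    by (rule Bochner_Integration.integrable_bound[OF intU[of t] meas])
       (use pt[OF that order_refl] in \<open>intro AE_I2, metis abs_ge_self order_trans real_norm_def\<close>)
  have Rbound: "\<bar>R t\<bar> \<le> t ^ m * (2 * (1 + t\<^sup>2)) ^ Suc m * Q" if t: "t \<ge> 0" for t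
  proof -
    have "\<bar>R t\<bar> \<le> (LINT z|lborel. \<bar>?K t z\<bar>)"
      unfolding R_def by (rule integral_abs_bound)
    also have "\<dots> \<le> (LINT z::'a|lborel. ?B t z)"
      by (intro integral_mono integrable_abs intR t intU pt order_refl)
    also have "\<dots> = t ^ m * (2 * (1 + t\<^sup>2)) ^ Suc m * Q"
      unfolding Q_def by (rule integral_mult_right_zero)
    finally show ?thesis .
  qed
  \<comment> \<open>A convergent sequence of radii is bounded by some U, and \<open>?B U\<close>
    dominates all the integrands at once.\<close>
  have contR: "continuous_on {0..} R"
    unfolding continuous_on_sequentially
  proof (intro ballI allI impI, elim conjE)
    fix t and u :: "nat \<Rightarrow> real"
    assume t: "t \<in> {0..}" and u: "\<forall>n. u n \<in> {0..}" "u \<longlonglongrightarrow> t"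
    obtain U where U: "\<And>n. \<bar>u n\<bar> \<le> U"
      using convergent_imp_Bseq[OF convergentI[OF u(2)]] unfolding Bseq_def by auto
    have "(\<lambda>n. LINT z|lborel. ?K (u n) z) \<longlonglongrightarrow> (LINT z|lborel. ?K t z)"
    proof (rule integral_dominated_convergence[OF meas meas intU[of U]])
      show "AE z in lborel. norm (?K (u n) z) \<le> ?B U z" for n
        unfolding real_norm_def using u(1) U[of n] by (intro AE_I2 pt) auto
      show "AE z in lborel. (\<lambda>n. ?K (u n) z) \<longlonglongrightarrow> ?K t z"
      proof (rule AE_I2)
        fix z :: 'a
        have "isCont (osc_conv m (norm z)) t"
          using continuous_on_osc_conv[OF continuous_on_const continuous_on_id, of UNIV m "norm z"]
          by (simp add: continuous_on_eq_continuous_at)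
        then show "(\<lambda>n. ?K (u n) z) \<longlonglongrightarrow> ?K t z"
          by (intro tendsto_mult tendsto_const isCont_tendsto_compose[OF _ u(2)])
      qed
    qed
    then show "(R \<circ> u) \<longlonglongrightarrow> R t" by (simp add: R_def o_def)
  qed
  have lapR: "(LINT t|lborel. ?R p t) = ?I p / p ^ Suc m"
    and intlapR: "integrable lborel (\<lambda>t. ?R p t)"
    if p: "p > 0" for p
  proof -
    define g where "g = (\<lambda>(z::'a) t. indicator {0..} t * (osc_conv m (norm z) t * exp (- p * t)))"
    have g0: "g z t \<ge> 0" for z t unfolding g_def by (auto simp: indicator_def osc_conv_nonneg)
    have gm: "(\<lambda>(z, t). g z t) \<in> borel_measurable (lborel \<Otimes>\<^sub>M lborel)"
      unfolding g_def by measurable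
    have gm1: "(\<lambda>t. g z t) \<in> borel_measurable lborel" for z
      unfolding g_def by measurable
    \<comment> \<open>The transform of \<open>osc_conv\<close> was computed for nonzero frequency;
      the origin is a null set.\<close>
    have AEz: "AE z::'a in lborel. norm z \<noteq> 0"
      using AE_lborel_singleton[of 0] by eventually_elim simp
    let ?H = "\<lambda>z::'a. (1 / p ^ Suc m) * (1 / (p\<^sup>2 + (norm z)\<^sup>2) ^ Suc m)"
    have gv: "(\<integral>\<^sup>+t. ennreal (g z t) \<partial>lborel) = ennreal (?H z)" if "norm z \<noteq> 0" for z
    proof -
      have "(\<integral>\<^sup>+t. ennreal (g z t) \<partial>lborel) = laplace (osc_conv m (norm z)) p"
        unfolding g_def laplace_def by (rule nn_integral_cong) (auto simp: indicator_def)
      also have "\<dots> = ennreal (?H z)"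
        unfolding laplace_osc_conv[OF that p] by (simp only: power_divide power_one power_mult_distrib times_divide_times_eq mult_1)
      finally show ?thesis .
    qed
    have H0: "?H z \<ge> 0" for z using p by (intro mult_nonneg_nonneg) auto
    have intH: "integrable lborel ?H"
      by (intro integrable_mult_right integrable_inverse_power p m)
    have "(\<integral>\<^sup>+q. ennreal (case q of (z, t) \<Rightarrow> g z t) \<partial>(lborel \<Otimes>\<^sub>M lborel)) = (\<integral>\<^sup>+z. \<integral>\<^sup>+t. ennreal (g z t) \<partial>lborel \<partial>lborel)"
      using gm by (subst lborel.nn_integral_fst[symmetric]) auto
    also have "\<dots> = (\<integral>\<^sup>+z. ennreal (?H z) \<partial>lborel)"
      by (rule nn_integral_cong_AE, use AEz in eventually_elim) (rule gv)
    also have "\<dots> = ennreal (LINT z|lborel. ?H z)"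
      using H0 by (intro nn_integral_eq_integral intH AE_I2)
    finally have fin: "(\<integral>\<^sup>+q. ennreal (case q of (z, t) \<Rightarrow> g z t) \<partial>(lborel \<Otimes>\<^sub>M lborel)) < \<infinity>" by simp
    have intg: "integrable (lborel \<Otimes>\<^sub>M lborel) (\<lambda>(z, t). g z t)"
      unfolding integrable_iff_bounded using fin g0 gm by (auto simp: case_prod_unfold)
    have intf: "integrable (lborel \<Otimes>\<^sub>M lborel) (\<lambda>(z, t). g z t * cos (z \<bullet> x))"
    proof (rule Bochner_Integration.integrable_bound[OF intg])
      show "(\<lambda>(z, t). g z t * cos (z \<bullet> x)) \<in> borel_measurable (lborel \<Otimes>\<^sub>M lborel)"
        using gm by measurable
    qed (auto simp: abs_mult mult_left_le case_prod_unfold)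
    have sw: "(LINT t|lborel. LINT z|lborel. g z t * cos (z \<bullet> x)) = (LINT z|lborel. LINT t|lborel. g z t * cos (z \<bullet> x))"
      by (rule lborel_pair.Fubini_integral[OF intf])
    have gz: "(LINT z|lborel. g z t * cos (z \<bullet> x)) = ?R p t" for t
    proof -
      have e: "g z t * cos (z \<bullet> x) = (indicator {0..} t * exp (- p * t)) * (?K t z)" for z
        by (simp add: g_def)
      show ?thesis unfolding e integral_mult_right_zero by (simp add: R_def)
    qed
    show "integrable lborel (\<lambda>t. ?R p t)"
      using lborel_pair.integrable_snd[OF intf] unfolding gz .
    have "(LINT z|lborel. LINT t|lborel. g z t * cos (z \<bullet> x)) = (LINT z|lborel. (1 / p ^ Suc m) * (cos (z \<bullet> x) / (p\<^sup>2 + (norm z)\<^sup>2) ^ Suc m))"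
    proof (rule integral_cong_AE)
      show "(\<lambda>z. LINT t|lborel. g z t * cos (z \<bullet> x)) \<in> borel_measurable lborel"
        using borel_measurable_integrable[OF lborel_pair.integrable_fst[OF intf]] .
      show "AE z in lborel. (LINT t|lborel. g z t * cos (z \<bullet> x)) = (1 / p ^ Suc m) * (cos (z \<bullet> x) / (p\<^sup>2 + (norm z)\<^sup>2) ^ Suc m)"
        using AEz
      proof eventually_elim
        case (elim z)
        have "(LINT t|lborel. g z t) = ?H z"
          using gv[OF elim] H0[of z] gm1 by (subst integral_eq_nn_integral) (auto simp: g0 simp del: power_Suc)
        then show ?case by simp
      qed
    qed measurable
    also have "\<dots> = (1 / p ^ Suc m) * ?I p"
      by (rule integral_mult_right_zero)
    finally show "(LINT t|lborel. ?R p t) = ?I p / p ^ Suc m"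
      unfolding gz[symmetric] sw by simp
  qed
  have C0: "C > 0" unfolding C_def matern_const_def by (intro divide_pos_pos mult_pos_pos Gamma_real_pos) auto
  have lapW: "(LINT t|lborel. ?WL p t) = C / p ^ Suc m * ?I p"
    and intlapW: "integrable lborel (\<lambda>t. ?WL p t)"
    if p: "p > 0" for p
  proof -
    let ?f = "?WL p"
    let ?L = "C / p ^ Suc m * ?I p"
    have f0: "?f t \<ge> 0" for t by (auto simp: indicator_def wscaled_bound(1))
    have fm: "?f \<in> borel_measurable lborel"
    proof -
      have "?W \<in> borel_measurable borel"
        by (intro borel_measurable_continuous_onI continuous_on_wscaled)
      then show ?thesis by measurable
    qed
    have "(\<integral>\<^sup>+t. ennreal (?f t) \<partial>lborel) = laplace (?W) p"
      unfolding laplace_def by (rule nn_integral_cong) (auto simp: indicator_def)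
    also have "\<dots> = ennreal ?L" unfolding C_def by (rule laplace_wscaled[OF p l])
    finally have nn: "(\<integral>\<^sup>+t. ennreal (?f t) \<partial>lborel) = ennreal ?L" .
    have L0: "?L \<ge> 0" using C0 p matern_fourier(1)[OF p l, of x] by (intro mult_nonneg_nonneg) auto
    show "integrable lborel ?f"
      unfolding integrable_iff_bounded using fm nn f0 by simp
    show "integral\<^sup>L lborel ?f = ?L"
    proof -
      have "integral\<^sup>L lborel ?f = enn2real (\<integral>\<^sup>+t. ennreal (?f t) \<partial>lborel)"
        by (rule integral_eq_nn_integral[OF fm AE_I2[OF f0]])
      then show ?thesis unfolding nn enn2real_ennreal[OF L0] .
    qed
  qed
  have "?W T - C * R T = 0"
  proof (rule laplace_eq_0_imp_eq_0[where f = "\<lambda>t. ?W t - C * R t"])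
    show "continuous_on {0..} (\<lambda>t. ?W t - C * R t)"
      by (intro continuous_intros continuous_on_wscaled contR)
    define N where "N = Suc m + 2 * k + 2 + (m + 2 * Suc m)"
    show "\<bar>?W t - C * R t\<bar> \<le> (1 + C * (2 ^ Suc m * Q)) * (1 + t) ^ N" if t: "t \<ge> 0" for t
    proof -
      have "\<bar>?W t\<bar> \<le> (1 + t) ^ (Suc m + 2 * k + 2)"
        using wscaled_bound[of ?r t "Suc m" k] t by simp
      also have "\<dots> \<le> (1 + t) ^ N" using t by (intro power_increasing) (auto simp: N_def)
      finally have 1: "\<bar>?W t\<bar> \<le> (1 + t) ^ N" .
      have "t ^ m * (2 * (1 + t\<^sup>2)) ^ Suc m \<le> (1 + t) ^ m * (2 * (1 + t)\<^sup>2) ^ Suc m"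
        using t by (intro mult_mono power_mono) (auto simp: power2_sum)
      also have "\<dots> = 2 ^ Suc m * (1 + t) ^ (m + 2 * Suc m)"
        unfolding power_mult_distrib power_mult[symmetric] power_add by (simp only: mult_ac)
      also have "\<dots> \<le> 2 ^ Suc m * (1 + t) ^ N"
        using t by (intro mult_left_mono power_increasing) (auto simp: N_def)
      finally have "\<bar>R t\<bar> \<le> 2 ^ Suc m * (1 + t) ^ N * Q"
        using Rbound[OF t] Q0 by (meson mult_right_mono order_trans)
      then have 2: "C * \<bar>R t\<bar> \<le> C * (2 ^ Suc m * (1 + t) ^ N * Q)"
        using C0 by (intro mult_left_mono) auto
      have "\<bar>?W t - C * R t\<bar> \<le> \<bar>?W t\<bar> + C * \<bar>R t\<bar>"
        using abs_triangle_ineq4[of "?W t" "C * R t"] C0 by (simp add: abs_mult)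
      also have "\<dots> \<le> (1 + t) ^ N + C * (2 ^ Suc m * (1 + t) ^ N * Q)" using 1 2 by linarith
      also have "\<dots> = (1 + C * (2 ^ Suc m * Q)) * (1 + t) ^ N" by (simp add: ring_distribs mult_ac)
      finally show ?thesis .
    qed
    show "(LINT t|lborel. indicator {0..} t * ((?W t - C * R t) * exp (- (real i + 2) * t))) = 0" for i
    proof -
      have p: "real i + 2 > 0" by simp
      have "(LINT t|lborel. indicator {0..} t * ((?W t - C * R t) * exp (- (real i + 2) * t))) =
        (LINT t|lborel. ?WL (real i + 2) t - C * (?R (real i + 2) t))"
        by (intro Bochner_Integration.integral_cong refl) (simp add: algebra_simps)
      also have "\<dots> = 0"
        by (subst Bochner_Integration.integral_diff[OF intlapW[OF p] integrable_mult_right[OF intlapR[OF p]]])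
           (simp only: integral_mult_right_zero lapW[OF p] lapR[OF p], simp)
      finally show ?thesis .
    qed
  qed (rule T)
  then show ?thesis by (simp add: C_def R_def)
qed

section \<open>Differentiating Fourier integrals\<close>

text \<open>The embedding of \<open>\<real>\<^sup>d\<close> into the odd-dimensional space in which the frequencies live.\<close>

locale isometric_embedding =
  fixes e :: "real ^ 'n::finite \<Rightarrow> 'b::euclidean_space"
  assumes linear: "linear e" and inner: "e x \<bullet> e y = x \<bullet> y"
begin

definition freq :: "'n \<Rightarrow> 'b \<Rightarrow> real" where
  "freq i z = z \<bullet> e (axis i 1)"

text \<open>The phase makes the family closed under differentiation: a derivative multiplies the
  density by a frequency and adds pi / 2 to c.\<close>

definition fcos :: "('b \<Rightarrow> real) \<Rightarrow> real \<Rightarrow> real ^ 'n \<Rightarrow> real" where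
  "fcos a c x = (LINT z|lborel. a z * cos (z \<bullet> e x + c))"

text \<open>A derivative consumes one order, while \<open>fcos_has_derivative\<close> asks for two
  in order to control the Taylor remainder; hence the orders used below exceed the number of
  derivatives.\<close>

definition moments :: "nat \<Rightarrow> ('b \<Rightarrow> real) \<Rightarrow> bool" where
  "moments m a \<longleftrightarrow> a \<in> borel_measurable borel \<and> integrable lborel (\<lambda>z. \<bar>a z\<bar> * (1 + norm z) ^ m)"

lemma freq_borel [measurable]: "freq i \<in> borel_measurable borel"
  unfolding freq_def[abs_def] by measurable

lemma abs_freq_le: "\<bar>freq i z\<bar> \<le> norm z"
proof -
  have "norm (e (axis i 1)) = 1"
    unfolding norm_eq_sqrt_inner inner by (simp add: inner_axis_axis)
  then show ?thesis
    unfolding freq_def using Cauchy_Schwarz_ineq2[of z "e (axis i 1)"] by simp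
qed

lemma momentsD: "moments m a \<Longrightarrow> a \<in> borel_measurable borel"
  by (simp add: moments_def)

lemma moments_bound:
  assumes "moments m a" "b \<in> borel_measurable borel" "\<And>z. \<bar>b z\<bar> * (1 + norm z) ^ m' \<le> K * (\<bar>a z\<bar> * (1 + norm z) ^ m)"
  shows "moments m' b"
  unfolding moments_def
proof
  show "integrable lborel (\<lambda>z. \<bar>b z\<bar> * (1 + norm z) ^ m')"
  proof (rule Bochner_Integration.integrable_bound)
    show "integrable lborel (\<lambda>z. K * (\<bar>a z\<bar> * (1 + norm z) ^ m))"
      using assms(1) by (intro integrable_mult_right) (simp add: moments_def)
    show "(\<lambda>z. \<bar>b z\<bar> * (1 + norm z) ^ m') \<in> borel_measurable lborel"
      using assms(2) by measurable
    show "AE z in lborel. norm (\<bar>b z\<bar> * (1 + norm z) ^ m') \<le> norm (K * (\<bar>a z\<bar> * (1 + norm z) ^ m))"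
    proof (rule AE_I2)
      fix z
      have "0 \<le> \<bar>b z\<bar> * (1 + norm z) ^ m'" by simp
      with assms(3)[of z] show "norm (\<bar>b z\<bar> * (1 + norm z) ^ m') \<le> norm (K * (\<bar>a z\<bar> * (1 + norm z) ^ m))"
        unfolding real_norm_def by linarith
    qed
  qed
qed (fact assms(2))

lemma moments_mono: "moments m a \<Longrightarrow> m' \<le> m \<Longrightarrow> moments m' a"
  by (rule moments_bound[of m a _ _ 1]) (auto simp: moments_def intro!: mult_left_mono power_increasing)

lemma moments_freq:
  assumes "moments (Suc m) a"
  shows "moments m (\<lambda>z. freq i z * a z)"
proof (rule moments_bound[OF assms, of _ _ 1])
  show "(\<lambda>z. freq i z * a z) \<in> borel_measurable borel"
    using momentsD[OF assms] by measurable
  fix z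
  have "\<bar>freq i z\<bar> * (\<bar>a z\<bar> * (1 + norm z) ^ m) \<le> (1 + norm z) * (\<bar>a z\<bar> * (1 + norm z) ^ m)"
    using abs_freq_le[of i z] by (intro mult_right_mono) auto
  then show "\<bar>freq i z * a z\<bar> * (1 + norm z) ^ m \<le> 1 * (\<bar>a z\<bar> * (1 + norm z) ^ Suc m)"
    by (simp add: abs_mult mult_ac)
qed

lemma moments_cmult: "moments m a \<Longrightarrow> moments m (\<lambda>z. K * a z)"
  by (rule moments_bound[of m a _ _ "\<bar>K\<bar>"]) (auto simp: moments_def abs_mult)

lemma moments_zero: "moments m (\<lambda>z. 0)"
  by (simp add: moments_def)

lemma moments_add:
  assumes "moments m a" "moments m b"
  shows "moments m (\<lambda>z. a z + b z)"
  unfolding moments_def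
proof
  show m: "(\<lambda>z. a z + b z) \<in> borel_measurable borel"
    using assms[THEN momentsD] by measurable
  show "integrable lborel (\<lambda>z. \<bar>a z + b z\<bar> * (1 + norm z) ^ m)"
  proof (rule Bochner_Integration.integrable_bound)
    show "integrable lborel (\<lambda>z. \<bar>a z\<bar> * (1 + norm z) ^ m + \<bar>b z\<bar> * (1 + norm z) ^ m)"
      using assms by (intro Bochner_Integration.integrable_add) (auto simp: moments_def)
    show "(\<lambda>z. \<bar>a z + b z\<bar> * (1 + norm z) ^ m) \<in> borel_measurable lborel"
      using m by measurable
    show "AE z in lborel. norm (\<bar>a z + b z\<bar> * (1 + norm z) ^ m) \<le> norm (\<bar>a z\<bar> * (1 + norm z) ^ m + \<bar>b z\<bar> * (1 + norm z) ^ m)"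
    proof (rule AE_I2)
      fix z
      have "\<bar>a z + b z\<bar> * (1 + norm z) ^ m \<le> (\<bar>a z\<bar> + \<bar>b z\<bar>) * (1 + norm z) ^ m"
        by (intro mult_right_mono abs_triangle_ineq) auto
      moreover have "0 \<le> \<bar>a z + b z\<bar> * (1 + norm z) ^ m" by simp
      ultimately show "norm (\<bar>a z + b z\<bar> * (1 + norm z) ^ m) \<le> norm (\<bar>a z\<bar> * (1 + norm z) ^ m + \<bar>b z\<bar> * (1 + norm z) ^ m)"
        unfolding real_norm_def ring_distribs by linarith
    qed
  qed
qed

lemma moments_sum: "(\<And>j. j \<in> J \<Longrightarrow> moments m (a j)) \<Longrightarrow> moments m (\<lambda>z. \<Sum>j\<in>J. a j z)"
  by (induction J rule: infinite_finite_induct) (auto intro: moments_add moments_zero)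

lemma moments_integrable:
  assumes "moments m a" "b \<in> borel_measurable borel" "\<And>z. \<bar>b z\<bar> \<le> 1"
  shows "integrable lborel (\<lambda>z. a z * b z)"
proof -
  have "moments 0 (\<lambda>z. a z * b z)"
  proof (rule moments_bound[OF moments_mono[OF assms(1) le0], of _ _ 1])
    show "(\<lambda>z. a z * b z) \<in> borel_measurable borel"
      using momentsD[OF assms(1)] assms(2) by measurable
  qed (use assms(3) in \<open>auto simp: abs_mult intro!: mult_left_le\<close>)
  then show ?thesis
    unfolding moments_def using integrable_abs_iff[of "\<lambda>z. a z * b z" lborel] by simp
qed

lemma cos_borel: "(\<lambda>z. cos (z \<bullet> e x + c)) \<in> borel_measurable borel"
  by measurable

lemma fcos_integrable: "moments m a \<Longrightarrow> integrable lborel (\<lambda>z. a z * cos (z \<bullet> e x + c))"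
  by (rule moments_integrable[OF _ cos_borel]) auto

lemma fcos_cmult: "fcos (\<lambda>z. K * a z) c x = K * fcos a c x"
  unfolding fcos_def mult.assoc by (rule integral_mult_right_zero)

lemma fcos_add: "moments m a \<Longrightarrow> moments m b \<Longrightarrow> fcos (\<lambda>z. a z + b z) c x = fcos a c x + fcos b c x"
  unfolding fcos_def ring_distribs by (intro Bochner_Integration.integral_add fcos_integrable)

lemma fcos_sum: "(\<And>j. j \<in> J \<Longrightarrow> moments m (a j)) \<Longrightarrow> fcos (\<lambda>z. \<Sum>j\<in>J. a j z) c x = (\<Sum>j\<in>J. fcos (a j) c x)"
  unfolding fcos_def sum_distrib_right by (intro Bochner_Integration.integral_sum fcos_integrable)

lemma fcos_plus_pi: "fcos a (c + pi) x = - fcos a c x"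
proof -
  have "a z * cos (z \<bullet> e x + (c + pi)) = (- 1) * (a z * cos (z \<bullet> e x + c))" for z
    using cos_periodic_pi[of "z \<bullet> e x + c"] by (simp add: add.assoc)
  then show ?thesis unfolding fcos_def by (simp only: integral_mult_right_zero)
qed

lemma fcos_minus_pi: "fcos a (c - pi) x = - fcos a c x"
  using fcos_plus_pi[of a "c - pi" x] by simp

lemma cos_taylor1: "\<bar>cos (\<theta> + u) - cos \<theta> - u * cos (\<theta> + pi / 2)\<bar> \<le> u\<^sup>2 / 2"
proof -
  have "cmod (iexp u - (\<Sum>k\<le>1. (\<i> * u) ^ k / fact k)) \<le> \<bar>u\<bar> ^ Suc 1 / fact (Suc 1)"
    by (rule iexp_approx1)
  then have 1: "cmod (cis u - 1 - \<i> * u) \<le> u\<^sup>2 / 2"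
    by (simp add: cis_conv_exp power2_eq_square diff_diff_eq)
  have "cos (\<theta> + u) - cos \<theta> - u * cos (\<theta> + pi / 2) = Re (cis \<theta> * (cis u - 1 - \<i> * u))"
    by (simp add: cos_add algebra_simps)
  then have "\<bar>cos (\<theta> + u) - cos \<theta> - u * cos (\<theta> + pi / 2)\<bar> \<le> cmod (cis \<theta> * (cis u - 1 - \<i> * u))"
    using abs_Re_le_cmod by metis
  then show ?thesis using 1 by (simp add: norm_mult)
qed

text \<open>The second moment bounds the first-order Taylor error under the integral by a multiple
  of h^2, so the derivative comes with an explicit rate.\<close>

lemma fcos_has_derivative:
  assumes a: "moments 2 a"
  shows "((\<lambda>t. fcos a c (x + t *\<^sub>R axis i 1)) has_real_derivative fcos (\<lambda>z. freq i z * a z) (c + pi / 2) x) (at 0)"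
proof -
  let ?D = "fcos (\<lambda>z. freq i z * a z) (c + pi / 2) x"
  let ?F = "\<lambda>t. fcos a c (x + t *\<^sub>R axis i 1)"
  have a1: "moments 1 (\<lambda>z. freq i z * a z)"
    by (rule moments_freq) (use a in \<open>simp add: numeral_2_eq_2\<close>)
  have "moments 0 (\<lambda>z. freq i z * (freq i z * a z))"
    by (rule moments_freq) (use a1 in simp)
  then have i2: "integrable lborel (\<lambda>z. (freq i z)\<^sup>2 * \<bar>a z\<bar>)"
    by (simp add: moments_def abs_mult power2_eq_square mult.assoc[symmetric])
  define K where "K = (LINT z|lborel. (freq i z)\<^sup>2 * \<bar>a z\<bar>) / 2"
  have est: "\<bar>?F h - ?F 0 - h * ?D\<bar> \<le> h\<^sup>2 * K" for h
  proof -
    have ex: "z \<bullet> e (x + h *\<^sub>R axis i 1) + c = (z \<bullet> e x + c) + h * freq i z" for z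
      unfolding linear_add[OF linear] linear_cmul[OF linear] freq_def by (simp add: inner_add_right)
    let ?E = "\<lambda>z. a z * cos ((z \<bullet> e x + c) + h * freq i z) - a z * cos (z \<bullet> e x + c) - h * ((freq i z * a z) * cos (z \<bullet> e x + (c + pi / 2)))"
    have iE: "integrable lborel (\<lambda>z. a z * cos ((z \<bullet> e x + c) + h * freq i z))"
      using fcos_integrable[OF a, of "x + h *\<^sub>R axis i 1" c] unfolding ex .
    have iE': "integrable lborel ?E"
      by (intro Bochner_Integration.integrable_diff integrable_mult_right iE fcos_integrable[OF a] fcos_integrable[OF a1])
    have "(LINT z|lborel. ?E z) = (LINT z|lborel. a z * cos ((z \<bullet> e x + c) + h * freq i z)) - (LINT z|lborel. a z * cos (z \<bullet> e x + c))
       - (LINT z|lborel. h * ((freq i z * a z) * cos (z \<bullet> e x + (c + pi / 2))))"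
      using iE fcos_integrable[OF a, of x c] integrable_mult_right[OF fcos_integrable[OF a1, of x "c + pi / 2"], of h]
      by (simp only: Bochner_Integration.integral_diff Bochner_Integration.integrable_diff)
    then have diff: "?F h - ?F 0 - h * ?D = (LINT z|lborel. ?E z)"
      unfolding fcos_def ex integral_mult_right_zero by simp
    have "\<bar>LINT z|lborel. ?E z\<bar> \<le> (LINT z|lborel. h\<^sup>2 / 2 * ((freq i z)\<^sup>2 * \<bar>a z\<bar>))"
    proof (rule order_trans[OF integral_abs_bound integral_mono[OF integrable_abs[OF iE'] integrable_mult_right[OF i2]]])
      fix z
      have "?E z = a z * (cos ((z \<bullet> e x + c) + h * freq i z) - cos (z \<bullet> e x + c) - (h * freq i z) * cos ((z \<bullet> e x + c) + pi / 2))"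
        by (simp add: algebra_simps)
      then have "\<bar>?E z\<bar> \<le> \<bar>a z\<bar> * ((h * freq i z)\<^sup>2 / 2)"
        unfolding abs_mult by (metis abs_ge_zero abs_mult cos_taylor1 mult_left_mono)
      then show "\<bar>?E z\<bar> \<le> h\<^sup>2 / 2 * ((freq i z)\<^sup>2 * \<bar>a z\<bar>)"
        by (simp add: power_mult_distrib mult_ac)
    qed
    also have "\<dots> = h\<^sup>2 / 2 * (LINT z|lborel. (freq i z)\<^sup>2 * \<bar>a z\<bar>)"
      by (rule integral_mult_right_zero)
    also have "\<dots> = h\<^sup>2 * K" by (simp only: K_def times_divide_eq_left times_divide_eq_right)
    finally show ?thesis unfolding diff .
  qed
  show ?thesis
    unfolding has_field_derivative_def has_derivative_at
  proof (intro conjI bounded_linear_mult_right)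
    show "((\<lambda>h. norm (?F (0 + h) - ?F 0 - ?D * h) / norm h) \<longlongrightarrow> 0) (at 0)"
    proof (rule Lim_null_comparison)
      show "\<forall>\<^sub>F h in at 0. norm (norm (?F (0 + h) - ?F 0 - ?D * h) / norm h) \<le> \<bar>h\<bar> * K"
        unfolding eventually_at_filter
      proof (intro always_eventually allI impI)
        fix h :: real assume h: "h \<noteq> 0"
        have "\<bar>?F h - ?F 0 - ?D * h\<bar> / \<bar>h\<bar> \<le> h\<^sup>2 * K / \<bar>h\<bar>"
          using est[of h] by (intro divide_right_mono) (auto simp: mult.commute)
        also have "\<dots> = \<bar>h\<bar> * K" using h by (simp add: power2_eq_square abs_if)
        finally show "norm (norm (?F (0 + h) - ?F 0 - ?D * h) / norm h) \<le> \<bar>h\<bar> * K" by simp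
      qed
      have "((\<lambda>h::real. \<bar>h\<bar> * K) \<longlongrightarrow> \<bar>0\<bar> * K) (at 0)" by (intro tendsto_intros)
      then show "((\<lambda>h. \<bar>h\<bar> * K) \<longlongrightarrow> 0) (at 0)" by simp
    qed
  qed
qed

lemma pderiv_fcos: "moments 2 a \<Longrightarrow> pderiv_at i (fcos a c) x = fcos (\<lambda>z. freq i z * a z) (c + pi / 2) x"
  unfolding pderiv_at_def by (intro DERIV_imp_deriv fcos_has_derivative)

lemma pderiv_fcos_shift:
  assumes "moments 2 a"
  shows "pderiv_at i (\<lambda>y. fcos a c (y - z)) x = fcos (\<lambda>z. freq i z * a z) (c + pi / 2) (x - z)"
  unfolding pderiv_at_def using fcos_has_derivative[OF assms, of c "x - z" i]
  by (intro DERIV_imp_deriv) (simp add: algebra_simps)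

text \<open>Differentiating in the subtracted argument reverses the sign, which amounts to the phase
  shift - pi / 2. Combined with + pi / 2 from the other argument, the pressure entries return to
  phase 0 with a positive sign.\<close>

lemma pderiv_fcos_reflect:
  assumes "moments 2 a"
  shows "pderiv_at i (\<lambda>z. fcos a c (y - z)) x = fcos (\<lambda>z. freq i z * a z) (c - pi / 2) (y - x)"
proof -
  let ?F = "\<lambda>t. fcos a c ((y - x) + t *\<^sub>R axis i 1)"
  let ?D = "fcos (\<lambda>z. freq i z * a z)"
  have eq: "y - (x + t *\<^sub>R axis i 1) = (y - x) + (- t) *\<^sub>R axis i 1" for t by simp
  have "((\<lambda>t. ?F (- t)) has_real_derivative ?D (c + pi / 2) (y - x) * - 1) (at 0)"
  proof (rule DERIV_chain2[where f = ?F and g = "\<lambda>t. - t"])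
    show "(?F has_real_derivative ?D (c + pi / 2) (y - x)) (at (- 0))"
      using fcos_has_derivative[OF assms, of c "y - x" i] by simp
  qed (auto intro!: derivative_eq_intros)
  then have "((\<lambda>t. fcos a c (y - (x + t *\<^sub>R axis i 1))) has_real_derivative ?D (c + pi / 2) (y - x) * - 1) (at 0)"
    unfolding eq .
  also have "?D (c + pi / 2) (y - x) * - 1 = ?D (c - pi / 2) (y - x)"
  proof -
    have "c + pi / 2 = c - pi / 2 + pi" by simp
    then show ?thesis by (simp only: fcos_plus_pi mult_minus1_right minus_minus)
  qed
  finally show ?thesis unfolding pderiv_at_def by (rule DERIV_imp_deriv)
qed

end

section \<open>Symbols of the Stokes functionals\<close>

context isometric_embedding begin

text \<open>The squared norm of the frequency projected to the image of \<open>e\<close>. If the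
  target has an extra dimension this may be smaller than (norm z)^2, on which the densities
  depend.\<close>

definition nsq :: "'b \<Rightarrow> real" where
  "nsq z = (\<Sum>j\<in>UNIV. (freq j z)\<^sup>2)"

lemma moments_nsq:
  assumes "moments (m + 2) a"
  shows "moments m (\<lambda>z. nsq z * a z)"
proof -
  have "moments m (\<lambda>z. \<Sum>j\<in>UNIV. freq j z * (freq j z * a z))"
    by (intro moments_sum moments_freq) (use assms in simp)
  then show ?thesis by (simp add: nsq_def sum_distrib_right power2_eq_square mult.assoc)
qed

lemma nsq_borel [measurable]: "nsq \<in> borel_measurable borel"
  unfolding nsq_def[abs_def] by measurable

lemma fcos_nsq:
  assumes "moments 2 a"
  shows "fcos (\<lambda>z. nsq z * a z) c x = (\<Sum>j\<in>UNIV. fcos (\<lambda>z. freq j z * (freq j z * a z)) c x)"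
proof -
  have "moments 0 (\<lambda>z. freq j z * (freq j z * a z))" for j
    by (intro moments_freq) (use assms in \<open>simp add: numeral_2_eq_2\<close>)
  then show ?thesis
    by (subst fcos_sum[symmetric]) (auto simp: nsq_def sum_distrib_right power2_eq_square mult.assoc)
qed

lemma moments_freq2: "moments 3 a \<Longrightarrow> moments 2 (\<lambda>z. freq i z * a z)"
  by (rule moments_freq) (simp add: eval_nat_numeral)

lemma laplacian_fcos:
  assumes a: "moments 3 a"
  shows "laplacian (fcos a c) x = - fcos (\<lambda>z. nsq z * a z) c x"
proof -
  have a2: "moments 2 a" by (rule moments_mono[OF a]) simp
  have "pderiv_at j (fcos a c) = fcos (\<lambda>z. freq j z * a z) (c + pi / 2)" for j
    by (rule ext) (rule pderiv_fcos[OF a2])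
  then show ?thesis unfolding laplacian_def
    by (simp add: pderiv_fcos[OF moments_freq2[OF a]] fcos_nsq[OF a2] add.assoc fcos_plus_pi sum_negf)
qed

lemma laplacian_fcos_shift:
  assumes a: "moments 3 a"
  shows "laplacian (\<lambda>y. fcos a c (y - z)) x = - fcos (\<lambda>z. nsq z * a z) c (x - z)"
proof -
  have a2: "moments 2 a" by (rule moments_mono[OF a]) simp
  have "pderiv_at j (\<lambda>y. fcos a c (y - z)) = (\<lambda>y. fcos (\<lambda>z. freq j z * a z) (c + pi / 2) (y - z))" for j
    by (rule ext) (rule pderiv_fcos_shift[OF a2])
  then show ?thesis unfolding laplacian_def
    by (simp add: pderiv_fcos_shift[OF moments_freq2[OF a]] fcos_nsq[OF a2] add.assoc fcos_plus_pi sum_negf)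
qed

lemma laplacian_fcos_reflect:
  assumes a: "moments 3 a"
  shows "laplacian (\<lambda>z. fcos a c (y - z)) x = - fcos (\<lambda>z. nsq z * a z) c (y - x)"
proof -
  have a2: "moments 2 a" by (rule moments_mono[OF a]) simp
  have e: "pderiv_at j (\<lambda>z. fcos a c (y - z)) = (\<lambda>z. fcos (\<lambda>z. freq j z * a z) (c - pi / 2) (y - z))" for j
    by (rule ext) (rule pderiv_fcos_reflect[OF a2])
  have "fcos b (c - pi / 2 - pi / 2) w = - fcos b c w" for b w
    using fcos_minus_pi[of b c w] by (simp add: diff_diff_eq)
  then show ?thesis unfolding laplacian_def e
    by (simp add: pderiv_fcos_reflect[OF moments_freq2[OF a]] fcos_nsq[OF a2] sum_negf)
qed

lemma pderiv_const: "pderiv_at i (\<lambda>x. k) y = 0"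
  by (simp add: pderiv_at_def)

lemma laplacian_const: "laplacian (\<lambda>x. k) y = 0"
  by (simp add: laplacian_def pderiv_at_def)

text \<open>Symbol of the operator \<open>- \<Delta> I + \<nabla> \<nabla>\<^sup>T\<close>.\<close>

definition dsym :: "'n \<Rightarrow> 'n \<Rightarrow> 'b \<Rightarrow> real" where
  "dsym i j z = (if i = j then nsq z else 0) - freq i z * freq j z"

lemma dsym_borel [measurable]: "dsym i j \<in> borel_measurable borel"
  unfolding dsym_def[abs_def] by measurable

lemma moments_freq_freq:
  assumes "moments (m + 2) a"
  shows "moments m (\<lambda>z. freq i z * freq j z * a z)"
  unfolding mult.assoc by (intro moments_freq) (use assms in simp)

lemma moments_dsym:
  assumes "moments (m + 2) a"
  shows "moments m (\<lambda>z. dsym i j z * a z)"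
proof -
  have "moments m (\<lambda>z. (if i = j then 1 else 0) * (nsq z * a z) + (- 1) * (freq i z * freq j z * a z))"
    by (intro moments_add moments_cmult moments_nsq moments_freq_freq assms)
  also have "(\<lambda>z. (if i = j then 1 else 0) * (nsq z * a z) + (- 1) * (freq i z * freq j z * a z)) = (\<lambda>z. dsym i j z * a z)"
    by (auto simp: dsym_def algebra_simps)
  finally show ?thesis .
qed

lemma fcos_dsym:
  assumes a: "moments 2 a"
  shows "fcos (\<lambda>z. dsym i j z * a z) 0 x =
    (if i = j then fcos (\<lambda>z. nsq z * a z) 0 x else 0) - fcos (\<lambda>z. freq i z * (freq j z * a z)) 0 x"
proof -
  have m0: "moments 0 (\<lambda>z. nsq z * a z)" by (rule moments_nsq) (use a in \<open>simp add: numeral_2_eq_2\<close>)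
  have m1: "moments 0 (\<lambda>z. freq i z * (freq j z * a z))" by (intro moments_freq) (use a in \<open>simp add: numeral_2_eq_2\<close>)
  have "fcos (\<lambda>z. dsym i j z * a z) 0 x = fcos (\<lambda>z. (if i = j then 1 else 0) * (nsq z * a z) + (- 1) * (freq i z * (freq j z * a z))) 0 x"
    by (intro arg_cong[of _ _ "\<lambda>f. fcos f 0 x"]) (auto simp: dsym_def algebra_simps)
  also have "\<dots> = (if i = j then 1 else 0) * fcos (\<lambda>z. nsq z * a z) 0 x + (- 1) * fcos (\<lambda>z. freq i z * (freq j z * a z)) 0 x"
    by (subst fcos_add[OF moments_cmult[OF m0] moments_cmult[OF m1]]) (simp only: fcos_cmult)
  finally show ?thesis by simp
qed

lemma div_free_kernel_fcos:
  assumes a: "moments 3 a"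
  shows "div_free_kernel (fcos a 0) x $ i $ j = fcos (\<lambda>z. dsym i j z * a z) 0 x"
proof -
  have a2: "moments 2 a" by (rule moments_mono[OF a]) simp
  have e: "pderiv_at j (fcos a 0) = fcos (\<lambda>z. freq j z * a z) (0 + pi / 2)" for j
    by (rule ext) (rule pderiv_fcos[OF a2])
  have "pderiv_at i (pderiv_at j (fcos a 0)) x = - fcos (\<lambda>z. freq i z * (freq j z * a z)) 0 x"
    unfolding e pderiv_fcos[OF moments_freq2[OF a]] using fcos_plus_pi[of _ 0 x] by simp
  then show ?thesis
    by (simp add: div_free_kernel_def laplacian_fcos[OF a] fcos_dsym[OF a2])
qed

text \<open>This encodes only how a functional acts on velocities. The kernel does not couple
  velocity and pressure, so the pressure gradients form a separate summand of each matrix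
  entry.\<close>

definition stokes_symbol :: "real \<Rightarrow> nat \<Rightarrow> nat \<Rightarrow> 'b \<Rightarrow> real" where
  "stokes_symbol \<nu> N j z = (if j \<le> N then \<nu> * nsq z else 1)"

lemma stokes_symbol_borel [measurable]: "stokes_symbol \<nu> N j \<in> borel_measurable borel"
  unfolding stokes_symbol_def[abs_def] by measurable

lemma moments_stokes_symbol:
  assumes "moments (m + 2) a"
  shows "moments m (\<lambda>z. stokes_symbol \<nu> N j z * a z)"
proof (cases "j \<le> N")
  case True
  then show ?thesis using moments_cmult[OF moments_nsq[OF assms], of \<nu>] by (simp add: stokes_symbol_def mult.assoc)
next
  case False
  then show ?thesis using moments_mono[OF assms, of m] by (simp add: stokes_symbol_def)
qed

lemma laplacian_stokes_symbol:
  assumes a: "moments 3 a" and j: "j \<le> N"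
  shows "- \<nu> * laplacian (\<lambda>y. fcos a c (y - z)) x = fcos (\<lambda>z. stokes_symbol \<nu> N j z * a z) c (x - z)"
    and "- \<nu> * laplacian (\<lambda>z. fcos a c (y - z)) x = fcos (\<lambda>z. stokes_symbol \<nu> N j z * a z) c (y - x)"
proof -
  have "fcos (\<lambda>z. stokes_symbol \<nu> N j z * a z) c w = \<nu> * fcos (\<lambda>z. nsq z * a z) c w" for w
    using j by (simp add: stokes_symbol_def mult.assoc fcos_cmult)
  then show "- \<nu> * laplacian (\<lambda>y. fcos a c (y - z)) x = fcos (\<lambda>z. stokes_symbol \<nu> N j z * a z) c (x - z)"
    and "- \<nu> * laplacian (\<lambda>z. fcos a c (y - z)) x = fcos (\<lambda>z. stokes_symbol \<nu> N j z * a z) c (y - x)"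
    by (simp_all add: laplacian_fcos_shift[OF a] laplacian_fcos_reflect[OF a])
qed

text \<open>The orders 8 and 4: the velocity density loses two to \<open>dsym\<close> and two to
  each functional, the pressure density one to each gradient, and in both cases order 2
  remains.\<close>

lemma colloc_entry_fcos:
  assumes p1: "moments 8 p1" and p2: "moments 4 p2"
    and k1: "scaled_wendland (k + 2) \<delta> = fcos p1 0" and k2: "scaled_wendland k \<delta> = fcos p2 0"
  shows "colloc_entry k \<delta> \<nu> N x i j i' j' =
     fcos (\<lambda>z. stokes_symbol \<nu> N j z * (stokes_symbol \<nu> N j' z * (dsym i i' z * p1 z))) 0 (x j - x j') +
     (if j \<le> N \<and> j' \<le> N then fcos (\<lambda>z. freq i z * (freq i' z * p2 z)) 0 (x j - x j') else 0)"
proof -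
  have p1': "moments 3 p1" by (rule moments_mono[OF p1]) simp
  have K: "stokes_kernel k \<delta> w $ Some m $ Some n = fcos (\<lambda>z. dsym m n z * p1 z) 0 w"
    "stokes_kernel k \<delta> w $ Some m $ None = 0" "stokes_kernel k \<delta> w $ None $ Some n = 0"
    "stokes_kernel k \<delta> w $ None $ None = fcos p2 0 w" for w m n
    by (simp_all add: stokes_kernel_def k1[unfolded add_2_eq_Suc'] k2 div_free_kernel_fcos[OF p1'])
  have md: "moments 6 (\<lambda>z. dsym m n z * p1 z)" for m n by (rule moments_dsym) (use p1 in simp)
  then have md3: "moments 3 (\<lambda>z. dsym m n z * p1 z)" for m n by (rule moments_mono) simp
  have ms: "moments 4 (\<lambda>z. stokes_symbol \<nu> N j' z * (dsym m n z * p1 z))" for m n by (rule moments_stokes_symbol) (use md in simp)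
  then have ms3: "moments 3 (\<lambda>z. stokes_symbol \<nu> N j' z * (dsym m n z * p1 z))" for m n by (rule moments_mono) simp
  have p22: "moments 2 p2" by (rule moments_mono[OF p2]) simp
  have p2f: "moments 2 (\<lambda>z. freq n z * p2 z)" for n by (rule moments_freq2) (rule moments_mono[OF p2], simp)
  have in_Some: "colloc_functional \<nu> N x i' j' (\<lambda>z. stokes_kernel k \<delta> (y - z) $ Some m) =
      fcos (\<lambda>z. stokes_symbol \<nu> N j' z * (dsym m i' z * p1 z)) 0 (y - x j')" for y m
    unfolding colloc_functional_def stokes_op_def K pderiv_const
    using laplacian_stokes_symbol(2)[where j = j' and N = N and \<nu> = \<nu> and c = 0, OF md3] by (simp add: stokes_symbol_def)
  have in_None: "colloc_functional \<nu> N x i' j' (\<lambda>z. stokes_kernel k \<delta> (y - z) $ None) =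
      (if j' \<le> N then fcos (\<lambda>z. freq i' z * p2 z) (0 - pi / 2) (y - x j') else 0)" for y
    unfolding colloc_functional_def stokes_op_def K laplacian_const pderiv_fcos_reflect[OF p22] by simp
  have e1: "- \<nu> * laplacian (\<lambda>y. fcos (\<lambda>z. stokes_symbol \<nu> N j' z * (dsym i i' z * p1 z)) 0 (y - x j')) (x j) =
     fcos (\<lambda>z. stokes_symbol \<nu> N j z * (stokes_symbol \<nu> N j' z * (dsym i i' z * p1 z))) 0 (x j - x j')" if "j \<le> N"
    by (rule laplacian_stokes_symbol(1)[OF ms3 that])
  have e2: "pderiv_at i (\<lambda>y. if j' \<le> N then fcos (\<lambda>z. freq i' z * p2 z) (0 - pi / 2) (y - x j') else 0) (x j)
     = (if j' \<le> N then fcos (\<lambda>z. freq i z * (freq i' z * p2 z)) 0 (x j - x j') else 0)"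
    using pderiv_fcos_shift[OF p2f, of i i' "0 - pi / 2" "x j'" "x j"] by (simp add: pderiv_const)
  show ?thesis
  proof (cases "j \<le> N")
    case True
    have "colloc_entry k \<delta> \<nu> N x i j i' j' =
      - \<nu> * laplacian (\<lambda>y. fcos (\<lambda>z. stokes_symbol \<nu> N j' z * (dsym i i' z * p1 z)) 0 (y - x j')) (x j) +
      pderiv_at i (\<lambda>y. if j' \<le> N then fcos (\<lambda>z. freq i' z * p2 z) (0 - pi / 2) (y - x j') else 0) (x j)"
      unfolding colloc_entry_def colloc_functional_def[of \<nu> N x i j] stokes_op_def[of \<nu> _ i "x j"] vec_lambda_beta in_Some in_None
      using True by simp
    then show ?thesis unfolding e1[OF True] e2 using True by simp
  next
    case False
    then show ?thesis
      unfolding colloc_entry_def colloc_functional_def[of \<nu> N x i j] vec_lambda_beta in_Some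
      by (simp add: stokes_symbol_def)
  qed
qed

end

section \<open>The quadratic form of the collocation matrix\<close>

lemma sum_rotate3:
  "(\<Sum>b\<in>B. \<Sum>c\<in>C. \<Sum>d\<in>D. G b c d) = (\<Sum>c\<in>C. \<Sum>d\<in>D. \<Sum>b\<in>B. G b c d)"
  by (subst sum.swap) (intro sum.cong refl sum.swap)

lemma sum_swap4:
  "(\<Sum>a\<in>A. \<Sum>b\<in>B. \<Sum>c\<in>C. \<Sum>d\<in>D. F a b c d) = (\<Sum>c\<in>C. \<Sum>d\<in>D. \<Sum>a\<in>A. \<Sum>b\<in>B. F a b c d)"
  by (simp only: sum_rotate3[where B = B and C = C and D = D] sum_rotate3[where B = A and C = C and D = D])

context isometric_embedding begin

lemma dsym_form: "(\<Sum>i\<in>UNIV. \<Sum>i'\<in>UNIV. dsym i i' z * (u i * u i')) = nsq z * (\<Sum>i\<in>UNIV. (u i)\<^sup>2) - (\<Sum>i\<in>UNIV. freq i z * u i)\<^sup>2"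
proof -
  have h: "(\<Sum>i'\<in>UNIV. dsym i i' z * (u i * u i')) = nsq z * (u i)\<^sup>2 - freq i z * u i * (\<Sum>i'\<in>UNIV. freq i' z * u i')" for i
  proof -
    have "dsym i i' z * (u i * u i') = (if i' = i then nsq z * (u i)\<^sup>2 else 0) - freq i z * u i * (freq i' z * u i')" for i'
      by (simp add: dsym_def power2_eq_square algebra_simps)
    then show ?thesis by (simp add: sum_subtractf sum_distrib_left)
  qed
  show ?thesis
    unfolding h sum_subtractf sum_distrib_left[symmetric] sum_distrib_right[symmetric]
    by (simp only: power2_eq_square)
qed

lemma dsym_form_nonneg: "(\<Sum>i\<in>UNIV. \<Sum>i'\<in>UNIV. dsym i i' z * (u i * u i')) \<ge> 0"
  unfolding dsym_form nsq_def using Cauchy_Schwarz_ineq_sum[of "\<lambda>i. freq i z" u UNIV] by simp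

text \<open>The addition theorem for cos (a - b) splits the sum over pairs of centres into the form
  of \<open>D\<close> at two real vectors, the cosine and sine sums; this is the real version of a
  squared modulus.\<close>

lemma form_cos_nonneg:
  assumes D: "\<And>u. (\<Sum>i\<in>UNIV. \<Sum>i'\<in>UNIV. D i i' * (u i * u i')) \<ge> (0::real)"
  shows "(\<Sum>j\<in>J. \<Sum>j'\<in>J. \<Sum>i\<in>UNIV. \<Sum>i'\<in>UNIV. \<beta> i j * \<beta> i' j' * D i i' * cos (z \<bullet> e (x j - x j'))) \<ge> 0"
proof -
  define u where "u = (\<lambda>i. \<Sum>j\<in>J. \<beta> i j * cos (z \<bullet> e (x j)))"
  define v where "v = (\<lambda>i. \<Sum>j\<in>J. \<beta> i j * sin (z \<bullet> e (x j)))"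
  have c: "cos (z \<bullet> e (x j - x j')) = cos (z \<bullet> e (x j)) * cos (z \<bullet> e (x j')) + sin (z \<bullet> e (x j)) * sin (z \<bullet> e (x j'))" for j j'
    unfolding linear_diff[OF linear] inner_diff_right cos_diff ..
  have "(\<Sum>j\<in>J. \<Sum>j'\<in>J. \<Sum>i\<in>UNIV. \<Sum>i'\<in>UNIV. \<beta> i j * \<beta> i' j' * D i i' * cos (z \<bullet> e (x j - x j'))) =
    (\<Sum>i\<in>UNIV. \<Sum>i'\<in>UNIV. \<Sum>j\<in>J. \<Sum>j'\<in>J. \<beta> i j * \<beta> i' j' * D i i' * cos (z \<bullet> e (x j - x j')))"
    by (rule sum_swap4)
  also have "\<dots> = (\<Sum>i\<in>UNIV. \<Sum>i'\<in>UNIV. D i i' * (u i * u i') + D i i' * (v i * v i'))"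
  proof (intro sum.cong refl)
    fix i i'
    have uu: "u i * u i' = (\<Sum>j\<in>J. \<Sum>j'\<in>J. (\<beta> i j * cos (z \<bullet> e (x j))) * (\<beta> i' j' * cos (z \<bullet> e (x j'))))"
      unfolding u_def by (rule sum_product)
    have vv: "v i * v i' = (\<Sum>j\<in>J. \<Sum>j'\<in>J. (\<beta> i j * sin (z \<bullet> e (x j))) * (\<beta> i' j' * sin (z \<bullet> e (x j'))))"
      unfolding v_def by (rule sum_product)
    show "(\<Sum>j\<in>J. \<Sum>j'\<in>J. \<beta> i j * \<beta> i' j' * D i i' * cos (z \<bullet> e (x j - x j'))) = D i i' * (u i * u i') + D i i' * (v i * v i')"
      unfolding uu vv sum_distrib_left sum.distrib[symmetric]
      by (intro sum.cong refl) (simp add: c algebra_simps)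
  qed
  also have "\<dots> = (\<Sum>i\<in>UNIV. \<Sum>i'\<in>UNIV. D i i' * (u i * u i')) + (\<Sum>i\<in>UNIV. \<Sum>i'\<in>UNIV. D i i' * (v i * v i'))"
    by (simp add: sum.distrib)
  finally show ?thesis using D[of u] D[of v] by simp
qed

text \<open>\<open>form1\<close> is the velocity part and \<open>form2\<close> the pressure part of
  the quadratic form. The density is an argument so that different scales can be compared for the
  same functionals and centres.\<close>

definition form1 :: "real \<Rightarrow> nat \<Rightarrow> (nat \<Rightarrow> real ^ 'n) \<Rightarrow> nat set \<Rightarrow> ('n \<Rightarrow> nat \<Rightarrow> real) \<Rightarrow> ('b \<Rightarrow> real) \<Rightarrow> real" where
  "form1 \<nu> N x J \<alpha> a = (\<Sum>j\<in>J. \<Sum>j'\<in>J. \<Sum>i\<in>UNIV. \<Sum>i'\<in>UNIV. \<alpha> i j * \<alpha> i' j' *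
     fcos (\<lambda>z. stokes_symbol \<nu> N j z * (stokes_symbol \<nu> N j' z * (dsym i i' z * a z))) 0 (x j - x j'))"

definition form2 :: "nat \<Rightarrow> (nat \<Rightarrow> real ^ 'n) \<Rightarrow> nat set \<Rightarrow> ('n \<Rightarrow> nat \<Rightarrow> real) \<Rightarrow> ('b \<Rightarrow> real) \<Rightarrow> real" where
  "form2 N x J \<alpha> a = (\<Sum>j\<in>J. \<Sum>j'\<in>J. \<Sum>i\<in>UNIV. \<Sum>i'\<in>UNIV. \<alpha> i j * \<alpha> i' j' *
     (if j \<le> N \<and> j' \<le> N then fcos (\<lambda>z. freq i z * (freq i' z * a z)) 0 (x j - x j') else 0))"

lemma moments_form1:
  assumes "moments 8 a"
  shows "moments 2 (\<lambda>z. stokes_symbol \<nu> N j z * (stokes_symbol \<nu> N j' z * (dsym i i' z * a z)))"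
  by (intro moments_stokes_symbol moments_dsym) (use assms in simp)

lemma moments_form2:
  assumes "moments 4 a"
  shows "moments 2 (\<lambda>z. freq i z * (freq i' z * a z))"
  by (intro moments_freq) (use assms in \<open>simp add: eval_nat_numeral\<close>)

text \<open>The scalar symbols \<open>w\<close> and the matrix symbol \<open>D\<close> are left
  general so that one argument serves both forms; for the pressure, \<open>w\<close> is the
  indicator of the interior centres and \<open>D\<close> has rank at most one.\<close>

lemma form_mono:
  fixes w :: "nat \<Rightarrow> 'b \<Rightarrow> real" and D :: "'n \<Rightarrow> 'n \<Rightarrow> 'b \<Rightarrow> real"
    and J :: "nat set" and x :: "nat \<Rightarrow> real ^ 'n" and \<alpha> :: "'n \<Rightarrow> nat \<Rightarrow> real"
  assumes D: "\<And>z u. (\<Sum>i\<in>UNIV. \<Sum>i'\<in>UNIV. D i i' z * (u i * u i')) \<ge> 0"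
    and a: "\<And>j j' i i'. moments 2 (\<lambda>z. w j z * (w j' z * (D i i' z * a z)))"
    and b: "\<And>j j' i i'. moments 2 (\<lambda>z. w j z * (w j' z * (D i i' z * b z)))"
    and ab: "\<And>z. c * b z \<le> a z"
  defines "Q \<equiv> \<lambda>a. \<Sum>j\<in>J. \<Sum>j'\<in>J. \<Sum>i\<in>UNIV. \<Sum>i'\<in>UNIV. \<alpha> i j * \<alpha> i' j' *
     fcos (\<lambda>z. w j z * (w j' z * (D i i' z * a z))) 0 (x j - x j')"
  shows "c * Q b \<le> Q a"
proof -
  let ?T = "\<lambda>z. \<Sum>j\<in>J. \<Sum>j'\<in>J. \<Sum>i\<in>UNIV. \<Sum>i'\<in>UNIV. (\<alpha> i j * w j z) * (\<alpha> i' j' * w j' z) * D i i' z * cos (z \<bullet> e (x j - x j'))"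
  have T0: "?T z \<ge> 0" for z by (rule form_cos_nonneg) (rule D)
  let ?g = "\<lambda>a z j j' i i'. \<alpha> i j * \<alpha> i' j' * ((w j z * (w j' z * (D i i' z * a z))) * cos (z \<bullet> e (x j - x j') + 0))"
  have eq: "(\<Sum>j\<in>J. \<Sum>j'\<in>J. \<Sum>i\<in>UNIV. \<Sum>i'\<in>UNIV. ?g a z j j' i i') = a z * ?T z" for a z
    unfolding sum_distrib_left by (intro sum.cong refl) (simp add: mult_ac)
  have rep: "Q a = (LINT z|lborel. a z * ?T z)" "integrable lborel (\<lambda>z. a z * ?T z)"
    if a: "\<And>j j' i i'. moments 2 (\<lambda>z. w j z * (w j' z * (D i i' z * a z)))" for a
  proof -
    have ig: "integrable lborel (\<lambda>z. ?g a z j j' i i')" for j j' i i'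
      by (intro integrable_mult_right fcos_integrable[OF a])
    have "Q a = (LINT z|lborel. (\<Sum>j\<in>J. \<Sum>j'\<in>J. \<Sum>i\<in>UNIV. \<Sum>i'\<in>UNIV. ?g a z j j' i i'))"
      unfolding Q_def fcos_def
      by (simp only: Bochner_Integration.integral_sum Bochner_Integration.integrable_sum ig integral_mult_right_zero)
    then show "Q a = (LINT z|lborel. a z * ?T z)" unfolding eq .
    have "integrable lborel (\<lambda>z. (\<Sum>j\<in>J. \<Sum>j'\<in>J. \<Sum>i\<in>UNIV. \<Sum>i'\<in>UNIV. ?g a z j j' i i'))"
      by (intro Bochner_Integration.integrable_sum ig)
    then show "integrable lborel (\<lambda>z. a z * ?T z)" unfolding eq .
  qed
  have "c * Q b = (LINT z|lborel. c * (b z * ?T z))"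
    unfolding rep(1)[OF b] by (rule integral_mult_right_zero[symmetric])
  also have "\<dots> \<le> (LINT z|lborel. a z * ?T z)"
  proof (intro integral_mono integrable_mult_right rep(2) a b)
    fix z show "c * (b z * ?T z) \<le> a z * ?T z"
      using mult_right_mono[OF ab T0, of z z] by (simp only: mult.assoc)
  qed
  finally show ?thesis unfolding rep(1)[OF a] .
qed

lemma form1_mono:
  assumes "moments 8 a" "moments 8 b" "\<And>z. c * b z \<le> a z"
  shows "c * form1 \<nu> N x J \<alpha> b \<le> form1 \<nu> N x J \<alpha> a"
  unfolding form1_def by (intro form_mono dsym_form_nonneg moments_form1 assms)

lemma form2_mono:
  assumes a: "moments 4 a" and b: "moments 4 b" and ab: "\<And>z. c * b z \<le> a z"
  shows "c * form2 N x J \<alpha> b \<le> form2 N x J \<alpha> a"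
proof -
  let ?w = "\<lambda>j z. if j \<le> N then 1 else 0 :: real"
  let ?D = "\<lambda>i i' z. freq i z * freq i' z"
  have eq: "form2 N x J \<alpha> a = (\<Sum>j\<in>J. \<Sum>j'\<in>J. \<Sum>i\<in>UNIV. \<Sum>i'\<in>UNIV. \<alpha> i j * \<alpha> i' j' *
     fcos (\<lambda>z. ?w j z * (?w j' z * (?D i i' z * a z))) 0 (x j - x j'))" for a
    unfolding form2_def by (intro sum.cong refl) (auto simp: fcos_def mult.assoc)
  have mo: "moments 2 (\<lambda>z. ?w j z * (?w j' z * (?D i i' z * a z)))" if "moments 4 a" for a j j' i i'
    unfolding mult.assoc using that by (intro moments_cmult moments_form2)
  have psd: "(\<Sum>i\<in>UNIV. \<Sum>i'\<in>UNIV. ?D i i' z * (u i * u i')) \<ge> 0" for u z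
  proof -
    have "(\<Sum>i\<in>UNIV. \<Sum>i'\<in>UNIV. ?D i i' z * (u i * u i')) = (\<Sum>i\<in>UNIV. freq i z * u i)\<^sup>2"
      unfolding power2_eq_square sum_product by (intro sum.cong refl) (simp add: mult_ac)
    then show ?thesis by simp
  qed
  show ?thesis unfolding eq by (intro form_mono psd mo a b ab)
qed

section \<open>Decoupling of the centres at small scales\<close>

definition vanishes_outside :: "real \<Rightarrow> real \<Rightarrow> ('b \<Rightarrow> real) \<Rightarrow> bool" where
  "vanishes_outside s c a \<longleftrightarrow> (\<forall>x. s < norm x \<longrightarrow> fcos a c x = 0)"

text \<open>The region \<open>s < norm x\<close> is open, so a function that vanishes there has
  vanishing derivatives there as well.\<close>

lemma vanishes_freq:
  assumes v: "vanishes_outside s c a" and a: "moments 2 a"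
  shows "vanishes_outside s (c + pi / 2) (\<lambda>z. freq i z * a z)"
  unfolding vanishes_outside_def
proof (intro allI impI)
  fix x :: "real ^ 'n" assume x: "s < norm x"
  have "((\<lambda>t::real. norm (x + t *\<^sub>R axis i 1)) \<longlongrightarrow> norm (x + 0 *\<^sub>R axis i 1)) (at 0)"
    by (intro tendsto_intros)
  then have "\<forall>\<^sub>F t in at 0. s < norm (x + t *\<^sub>R axis i (1::real))"
    using x by (intro order_tendstoD(1)) auto
  then have "\<forall>\<^sub>F t in nhds 0. s < norm (x + t *\<^sub>R axis i (1::real))"
    unfolding eventually_nhds_conv_at using x by simp
  then have "\<forall>\<^sub>F t in nhds 0. fcos a c (x + t *\<^sub>R axis i 1) = (\<lambda>t. 0) t"
    by eventually_elim (use v in \<open>simp add: vanishes_outside_def\<close>)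
  then have "((\<lambda>t. fcos a c (x + t *\<^sub>R axis i 1)) has_real_derivative 0) (at 0)"
    by (subst DERIV_cong_ev[OF refl _ refl]) auto
  with fcos_has_derivative[OF a] show "fcos (\<lambda>z. freq i z * a z) (c + pi / 2) x = 0"
    by (metis DERIV_unique)
qed

lemma vanishes_freq2:
  assumes v: "vanishes_outside s 0 a" and a: "moments 3 a"
  shows "vanishes_outside s 0 (\<lambda>z. freq i z * (freq j z * a z))"
proof -
  have "vanishes_outside s (0 + pi / 2 + pi / 2) (\<lambda>z. freq i z * (freq j z * a z))"
    by (intro vanishes_freq v moments_freq2 a moments_mono[OF a]) simp
  then show ?thesis unfolding vanishes_outside_def using fcos_plus_pi[of _ 0] by simp
qed

lemma vanishes_nsq:
  assumes v: "vanishes_outside s 0 a" and a: "moments 3 a"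
  shows "vanishes_outside s 0 (\<lambda>z. nsq z * a z)"
  using vanishes_freq2[OF v a] unfolding vanishes_outside_def
  by (auto simp: fcos_nsq[OF moments_mono[OF a]])

lemma vanishes_dsym:
  assumes v: "vanishes_outside s 0 a" and a: "moments 3 a"
  shows "vanishes_outside s 0 (\<lambda>z. dsym i j z * a z)"
proof -
  have a2: "moments 2 a" by (rule moments_mono[OF a]) simp
  show ?thesis
    using vanishes_nsq[OF v a] vanishes_freq2[OF v a, of i j] by (simp add: vanishes_outside_def fcos_dsym[OF a2])
qed

lemma vanishes_stokes_symbol:
  assumes v: "vanishes_outside s 0 a" and a: "moments 3 a"
  shows "vanishes_outside s 0 (\<lambda>z. stokes_symbol \<nu> N j z * a z)"
proof (cases "j \<le> N")
  case True
  then show ?thesis using vanishes_nsq[OF v a] by (simp add: vanishes_outside_def stokes_symbol_def mult.assoc fcos_cmult)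
next
  case False
  then show ?thesis using v by (simp add: stokes_symbol_def)
qed

lemma vanishes_form1:
  assumes v: "vanishes_outside s 0 a" and a: "moments 8 a"
  shows "vanishes_outside s 0 (\<lambda>z. stokes_symbol \<nu> N j z * (stokes_symbol \<nu> N j' z * (dsym i i' z * a z)))"
proof -
  have m6: "moments 6 (\<lambda>z. dsym i i' z * a z)" by (rule moments_dsym) (use a in simp)
  have m4: "moments 4 (\<lambda>z. stokes_symbol \<nu> N j' z * (dsym i i' z * a z))" by (rule moments_stokes_symbol) (use m6 in simp)
  show ?thesis
    by (intro vanishes_stokes_symbol vanishes_dsym v moments_mono[OF a] moments_mono[OF m6] moments_mono[OF m4]) auto
qed

text \<open>Reflecting the i-th coordinate preserves a radial function, so its j-th derivative is
  even along the i-th axis, and an even function has derivative 0 at 0.\<close>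

lemma fcos_freq_freq_eq_0:
  assumes a: "moments 3 a" and radial: "\<And>x y. norm x = norm y \<Longrightarrow> fcos a 0 x = fcos a 0 y" and ij: "i \<noteq> j"
  shows "fcos (\<lambda>z. freq i z * (freq j z * a z)) 0 0 = 0"
proof -
  have a2: "moments 2 a" by (rule moments_mono[OF a]) simp
  define G where "G = (\<lambda>t. fcos (\<lambda>z. freq j z * a z) (0 + pi / 2) (0 + t *\<^sub>R axis i 1))"
  have nrm: "norm (- t *\<^sub>R axis i 1 + u *\<^sub>R axis j 1 :: real ^ 'n) = norm (t *\<^sub>R axis i 1 + u *\<^sub>R axis j 1 :: real ^ 'n)" for t u
    using ij by (simp add: norm_eq_sqrt_inner inner_add_left inner_add_right inner_diff_left inner_diff_right inner_axis_axis)
  have even: "G (- t) = G t" for t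
  proof -
    have "(\<lambda>u. fcos a 0 (- t *\<^sub>R axis i 1 + u *\<^sub>R axis j 1)) = (\<lambda>u. fcos a 0 (t *\<^sub>R axis i 1 + u *\<^sub>R axis j 1))"
      by (rule ext) (rule radial[OF nrm])
    then have "pderiv_at j (fcos a 0) (- t *\<^sub>R axis i 1) = pderiv_at j (fcos a 0) (t *\<^sub>R axis i 1)"
      unfolding pderiv_at_def by simp
    then show ?thesis unfolding pderiv_fcos[OF a2] by (simp add: G_def)
  qed
  let ?D = "fcos (\<lambda>z. freq i z * (freq j z * a z)) (0 + pi / 2 + pi / 2) 0"
  have d: "(G has_real_derivative ?D) (at 0)"
    unfolding G_def by (rule fcos_has_derivative[OF moments_freq2[OF a]])
  have "((\<lambda>t. G (- t)) has_real_derivative ?D * - 1) (at 0)"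
  proof (rule DERIV_chain2[where f = G and g = "\<lambda>t. - t"])
    show "(G has_real_derivative ?D) (at (- 0))" using d by simp
  qed (auto intro!: derivative_eq_intros)
  then have "?D = ?D * - 1" unfolding even using d by (metis DERIV_unique)
  then show ?thesis using fcos_plus_pi[of "\<lambda>z. freq i z * (freq j z * a z)" 0 0] by simp
qed

lemma fcos_0_nonneg: "(\<And>z. a z \<ge> 0) \<Longrightarrow> fcos a 0 0 \<ge> 0"
  unfolding fcos_def by (intro Bochner_Integration.integral_nonneg) (simp add: linear_0[OF linear])

text \<open>Compact support removes the pairs of distinct centres, and radial symmetry makes each
  remaining block diagonal. Boundary functionals do not see the pressure, so the bound covers the
  interior centres only.\<close>

lemma form2_diag:
  assumes a: "moments 4 a" and v: "vanishes_outside s 0 a" and radial: "\<And>x y. norm x = norm y \<Longrightarrow> fcos a 0 x = fcos a 0 y"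
    and J: "finite J" and sep: "\<And>j j'. j \<in> J \<Longrightarrow> j' \<in> J \<Longrightarrow> j \<noteq> j' \<Longrightarrow> s < norm (x j - x j')"
    and g: "\<And>i. \<gamma> \<le> fcos (\<lambda>z. freq i z * (freq i z * a z)) 0 0"
  shows "form2 N x J \<alpha> a \<ge> \<gamma> * (\<Sum>j\<in>{j\<in>J. j \<le> N}. \<Sum>i\<in>UNIV. (\<alpha> i j)\<^sup>2)"
proof -
  have a3: "moments 3 a" by (rule moments_mono[OF a]) simp
  let ?g = "\<lambda>i i'. fcos (\<lambda>z. freq i z * (freq i' z * a z)) 0"
  have diag: "(\<Sum>i'\<in>UNIV. \<alpha> i j * \<alpha> i' j' * (if j \<le> N \<and> j' \<le> N then ?g i i' (x j - x j') else 0)) =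
     (if j' = j then (if j \<le> N then (\<alpha> i j)\<^sup>2 * ?g i i 0 else 0) else 0)" if "j \<in> J" "j' \<in> J" for j j' i
  proof (cases "j = j'")
    case True
    have "(\<Sum>i'\<in>UNIV. \<alpha> i j * \<alpha> i' j' * (if j \<le> N \<and> j' \<le> N then ?g i i' (x j - x j') else 0)) =
       (\<Sum>i'\<in>UNIV. if i' = i then (if j \<le> N then (\<alpha> i j)\<^sup>2 * ?g i i 0 else 0) else 0)"
      using fcos_freq_freq_eq_0[OF a3 radial, of i] True
      by (intro sum.cong refl) (auto simp: power2_eq_square)
    then show ?thesis using True by simp
  next
    case False
    then have "?g i i' (x j - x j') = 0" for i'
      using vanishes_freq2[OF v a3, of i i'] sep[OF that] by (simp add: vanishes_outside_def)
    then show ?thesis using False by simp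
  qed
  have "form2 N x J \<alpha> a = (\<Sum>j\<in>J. \<Sum>i\<in>UNIV. \<Sum>j'\<in>J. \<Sum>i'\<in>UNIV. \<alpha> i j * \<alpha> i' j' * (if j \<le> N \<and> j' \<le> N then ?g i i' (x j - x j') else 0))"
    unfolding form2_def by (subst (2) sum.swap) simp
  also have "\<dots> = (\<Sum>j\<in>J. \<Sum>i\<in>UNIV. \<Sum>j'\<in>J. (if j' = j then (if j \<le> N then (\<alpha> i j)\<^sup>2 * ?g i i 0 else 0) else 0))"
    by (intro sum.cong refl diag)
  also have "\<dots> = (\<Sum>j\<in>J. if j \<le> N then (\<Sum>i\<in>UNIV. (\<alpha> i j)\<^sup>2 * ?g i i 0) else 0)"
    using J by (intro sum.cong refl) auto
  also have "\<dots> = (\<Sum>j\<in>{j\<in>J. j \<le> N}. \<Sum>i\<in>UNIV. (\<alpha> i j)\<^sup>2 * ?g i i 0)"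
    using J by (rule sum.inter_filter[symmetric])
  also have "\<dots> \<ge> (\<Sum>j\<in>{j\<in>J. j \<le> N}. \<Sum>i\<in>UNIV. (\<alpha> i j)\<^sup>2 * \<gamma>)"
    by (intro sum_mono mult_left_mono g) auto
  finally show ?thesis by (simp add: sum_distrib_left mult.commute)
qed

text \<open>The counterpart of \<open>form2_diag\<close> for boundary centres: interior blocks are
  only shown to be nonnegative. A boundary block is diagonal, and its i-th entry is the sum of the
  second moments in all directions other than i.\<close>

lemma form1_diag:
  assumes a: "moments 8 a" and v: "vanishes_outside s 0 a" and radial: "\<And>x y. norm x = norm y \<Longrightarrow> fcos a 0 x = fcos a 0 y"
    and J: "finite J" and sep: "\<And>j j'. j \<in> J \<Longrightarrow> j' \<in> J \<Longrightarrow> j \<noteq> j' \<Longrightarrow> s < norm (x j - x j')"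
    and g: "\<And>i. \<gamma> \<le> fcos (\<lambda>z. freq i z * (freq i z * a z)) 0 0"
    and a0: "\<And>z. a z \<ge> 0" and dim: "CARD('n) \<ge> 2"
  shows "form1 \<nu> N x J \<alpha> a \<ge> \<gamma> * (\<Sum>j\<in>{j\<in>J. \<not> j \<le> N}. \<Sum>i\<in>UNIV. (\<alpha> i j)\<^sup>2)"
proof -
  have a3: "moments 3 a" by (rule moments_mono[OF a]) simp
  have a2: "moments 2 a" by (rule moments_mono[OF a]) simp
  let ?f = "\<lambda>j j' i i'. fcos (\<lambda>z. stokes_symbol \<nu> N j z * (stokes_symbol \<nu> N j' z * (dsym i i' z * a z))) 0"
  have off: "?f j j' i i' (x j - x j') = 0" if "j \<in> J" "j' \<in> J" "j \<noteq> j'" for j j' i i'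
    using vanishes_form1[OF v a, of \<nu> N j j' i i'] sep[OF that] by (simp add: vanishes_outside_def)
  have "form1 \<nu> N x J \<alpha> a = (\<Sum>j\<in>J. \<Sum>j'\<in>J. if j' = j then (\<Sum>i\<in>UNIV. \<Sum>i'\<in>UNIV. \<alpha> i j * \<alpha> i' j * ?f j j i i' 0) else 0)"
    unfolding form1_def by (intro sum.cong refl) (auto simp: off)
  also have "\<dots> = (\<Sum>j\<in>J. \<Sum>i\<in>UNIV. \<Sum>i'\<in>UNIV. \<alpha> i j * \<alpha> i' j * ?f j j i i' 0)"
    using J by (intro sum.cong refl) auto
  finally have eq: "form1 \<nu> N x J \<alpha> a = (\<Sum>j\<in>J. \<Sum>i\<in>UNIV. \<Sum>i'\<in>UNIV. \<alpha> i j * \<alpha> i' j * ?f j j i i' 0)" .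
  have blk: "(\<Sum>i\<in>UNIV. \<Sum>i'\<in>UNIV. \<alpha> i j * \<alpha> i' j * ?f j j i i' 0) \<ge> 0" for j
  proof -
    have "(\<Sum>i\<in>UNIV. \<Sum>i'\<in>UNIV. \<alpha> i j * \<alpha> i' j * ?f j j i i' 0) =
      fcos (\<lambda>z. \<Sum>i\<in>UNIV. \<Sum>i'\<in>UNIV. (\<alpha> i j * \<alpha> i' j) * (stokes_symbol \<nu> N j z * (stokes_symbol \<nu> N j z * (dsym i i' z * a z)))) 0 0"
    proof -
      have "fcos (\<lambda>z. \<Sum>i\<in>UNIV. \<Sum>i'\<in>UNIV. (\<alpha> i j * \<alpha> i' j) * (stokes_symbol \<nu> N j z * (stokes_symbol \<nu> N j z * (dsym i i' z * a z)))) 0 0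
        = (\<Sum>i\<in>UNIV. fcos (\<lambda>z. \<Sum>i'\<in>UNIV. (\<alpha> i j * \<alpha> i' j) * (stokes_symbol \<nu> N j z * (stokes_symbol \<nu> N j z * (dsym i i' z * a z)))) 0 0)"
        by (rule fcos_sum[where m = 2]) (intro moments_sum moments_cmult moments_form1[OF a])
      also have "\<dots> = (\<Sum>i\<in>UNIV. \<Sum>i'\<in>UNIV. fcos (\<lambda>z. (\<alpha> i j * \<alpha> i' j) * (stokes_symbol \<nu> N j z * (stokes_symbol \<nu> N j z * (dsym i i' z * a z)))) 0 0)"
        by (intro sum.cong refl fcos_sum[where m = 2] moments_cmult moments_form1[OF a])
      finally show ?thesis by (simp only: fcos_cmult)
    qed
    also have "\<dots> \<ge> 0"
    proof (rule fcos_0_nonneg)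
      fix z
      have "(\<Sum>i\<in>UNIV. \<Sum>i'\<in>UNIV. (\<alpha> i j * \<alpha> i' j) * (stokes_symbol \<nu> N j z * (stokes_symbol \<nu> N j z * (dsym i i' z * a z)))) =
        (stokes_symbol \<nu> N j z)\<^sup>2 * a z * (\<Sum>i\<in>UNIV. \<Sum>i'\<in>UNIV. dsym i i' z * (\<alpha> i j * \<alpha> i' j))"
        unfolding sum_distrib_left by (intro sum.cong refl) (simp add: power2_eq_square mult_ac)
      also have "\<dots> \<ge> 0" by (intro mult_nonneg_nonneg dsym_form_nonneg a0) simp
      finally show "(\<Sum>i\<in>UNIV. \<Sum>i'\<in>UNIV. (\<alpha> i j * \<alpha> i' j) * (stokes_symbol \<nu> N j z * (stokes_symbol \<nu> N j z * (dsym i i' z * a z)))) \<ge> 0" .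
    qed
    finally show ?thesis .
  qed
  let ?g = "\<lambda>i i'. fcos (\<lambda>z. freq i z * (freq i' z * a z)) 0 0"
  have g0: "?g i i \<ge> 0" for i
    by (rule fcos_0_nonneg) (simp add: mult.assoc[symmetric] a0)
  have bnd: "(\<Sum>i\<in>UNIV. \<Sum>i'\<in>UNIV. \<alpha> i j * \<alpha> i' j * ?f j j i i' 0) \<ge> \<gamma> * (\<Sum>i\<in>UNIV. (\<alpha> i j)\<^sup>2)" if j: "\<not> j \<le> N" for j
  proof -
    have fd: "?f j j i i' 0 = (if i' = i then (\<Sum>m\<in>UNIV. ?g m m) - ?g i i else 0)" for i i'
      using j fcos_freq_freq_eq_0[OF a3 radial, of i i'] fcos_nsq[OF a2, of 0 0] fcos_dsym[OF a2, of i i' 0]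
      by (auto simp: stokes_symbol_def)
    have "(\<Sum>i\<in>UNIV. \<Sum>i'\<in>UNIV. \<alpha> i j * \<alpha> i' j * ?f j j i i' 0) = (\<Sum>i\<in>UNIV. (\<alpha> i j)\<^sup>2 * ((\<Sum>m\<in>UNIV. ?g m m) - ?g i i))"
      unfolding fd by (simp add: if_distrib[of "\<lambda>x. _ * x"] power2_eq_square cong: if_cong)
    also have "\<dots> \<ge> (\<Sum>i\<in>UNIV. (\<alpha> i j)\<^sup>2 * \<gamma>)"
    proof (intro sum_mono mult_left_mono)
      fix i :: 'n
      \<comment> \<open>In dimension at least 2 there is a second direction, and its moment alone
        already supplies \<gamma>.\<close>
      obtain i' where i': "i' \<noteq> i"
        using dim by (metis (full_types) One_nat_def Suc_1 UNIV_I card_1_singleton_iff insert_iff le_less_Suc_eq less_Suc_eq_le not_less_eq_eq order_refl subsetI subset_antisym singletonD top_greatest)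
      have "?g i i + ?g i' i' \<le> (\<Sum>m\<in>UNIV. ?g m m)"
        using sum_mono2[of UNIV "{i, i'}" "\<lambda>m. ?g m m"] i' g0 by simp
      then show "\<gamma> \<le> (\<Sum>m\<in>UNIV. ?g m m) - ?g i i" using g[of i'] by linarith
    qed auto
    finally show ?thesis by (simp add: sum_distrib_left mult.commute)
  qed
  have "\<gamma> * (\<Sum>j\<in>{j\<in>J. \<not> j \<le> N}. \<Sum>i\<in>UNIV. (\<alpha> i j)\<^sup>2) = (\<Sum>j\<in>J. if \<not> j \<le> N then \<gamma> * (\<Sum>i\<in>UNIV. (\<alpha> i j)\<^sup>2) else 0)"
    unfolding sum_distrib_left using J by (rule sum.inter_filter)
  also have "\<dots> \<le> form1 \<nu> N x J \<alpha> a"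
    unfolding eq by (intro sum_mono) (use bnd blk in auto)
  finally show ?thesis .
qed

end

section \<open>Comparison of scales\<close>

lemma one_plus_power_le: "(1 + w) ^ (2 * \<mu>) \<le> 2 ^ \<mu> * (1 + w\<^sup>2) ^ \<mu>" if "w \<ge> 0" for w :: real
proof -
  have "(1 + w)\<^sup>2 \<le> 2 * (1 + w\<^sup>2)"
    using zero_le_power2[of "1 - w"] by (simp add: power2_sum power2_diff)
  then have "((1 + w)\<^sup>2) ^ \<mu> \<le> (2 * (1 + w\<^sup>2)) ^ \<mu>" by (intro power_mono) auto
  then show ?thesis by (simp only: power_mult power_mult_distrib)
qed

text \<open>In the upper bound at s the bracket 1 + s^2 is replaced by 1 + T^2, leaving
  \<open>s ^ Suc l\<close> as the sole dependence on s; this makes the constant uniform in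
  s.\<close>

lemma osc_conv_compare:
  assumes T: "T > 0"
  shows "\<exists>c>0. \<forall>s w. 0 < s \<longrightarrow> s \<le> T \<longrightarrow> c / s ^ Suc l * osc_conv (Suc l) w s \<le> osc_conv (Suc l) w T"
proof -
  obtain c where c: "c > 0" "\<And>w. osc_conv (Suc l) w 1 \<ge> c / (1 + w\<^sup>2) ^ (l + 2)"
    using osc_conv_lower[of l] by blast
  define B where "B = (2 * (1 + T\<^sup>2)) ^ Suc (Suc l)"
  \<comment> \<open>The power of T transports the lower bound from 1 to T, and the maximum accounts
    for replacing 1 + (w T)^2 by a multiple of 1 + w^2.\<close>
  define A where "A = T ^ (3 * Suc l + 2) * (c / (max 1 (T\<^sup>2)) ^ (l + 2))"
  have B: "B > 0" unfolding B_def by (intro zero_less_power mult_pos_pos add_pos_nonneg) auto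
  have A: "A > 0" unfolding A_def using c T by (intro mult_pos_pos divide_pos_pos zero_less_power) auto
  have lowT: "osc_conv (Suc l) w T \<ge> A / (1 + w\<^sup>2) ^ (l + 2)" for w
  proof -
    have "(1 + (w * T)\<^sup>2) \<le> max 1 (T\<^sup>2) * (1 + w\<^sup>2)"
    proof -
      have "w\<^sup>2 * T\<^sup>2 \<le> w\<^sup>2 * max 1 (T\<^sup>2)" by (intro mult_left_mono) auto
      moreover have "1 \<le> max 1 (T\<^sup>2)" by simp
      ultimately show ?thesis by (simp only: power_mult_distrib ring_distribs mult.commute[of "w\<^sup>2"] mult_1_right)
    qed
    then have "(1 + (w * T)\<^sup>2) ^ (l + 2) \<le> (max 1 (T\<^sup>2)) ^ (l + 2) * (1 + w\<^sup>2) ^ (l + 2)"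
      unfolding power_mult_distrib[symmetric] by (intro power_mono) auto
    then have "c / ((max 1 (T\<^sup>2)) ^ (l + 2) * (1 + w\<^sup>2) ^ (l + 2)) \<le> c / (1 + (w * T)\<^sup>2) ^ (l + 2)"
      using c by (intro divide_left_mono mult_pos_pos zero_less_power add_pos_nonneg) auto
    also have "\<dots> \<le> osc_conv (Suc l) (w * T) 1" by (rule c)
    finally have "T ^ (3 * Suc l + 2) * (c / ((max 1 (T\<^sup>2)) ^ (l + 2) * (1 + w\<^sup>2) ^ (l + 2))) \<le> T ^ (3 * Suc l + 2) * osc_conv (Suc l) (w * T) 1"
      using T by (intro mult_left_mono) auto
    also have "\<dots> = osc_conv (Suc l) w T" using osc_conv_scale[of "Suc l" w T 1] by simp
    finally show ?thesis unfolding A_def by (simp only: divide_divide_eq_left times_divide_eq_right)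
  qed
  have "A / B / s ^ Suc l * osc_conv (Suc l) w s \<le> osc_conv (Suc l) w T" if s: "0 < s" "s \<le> T" for s w
  proof -
    have "osc_conv (Suc l) w s \<le> s ^ Suc l * (2 * (1 + T\<^sup>2) / (1 + w\<^sup>2)) ^ Suc (Suc l)"
      by (rule osc_conv_le) (use s in auto)
    also have "\<dots> = s ^ Suc l * (B / (1 + w\<^sup>2) ^ (l + 2))"
      unfolding B_def power_divide by simp
    finally have "A / B / s ^ Suc l * osc_conv (Suc l) w s \<le> A / B / s ^ Suc l * (s ^ Suc l * (B / (1 + w\<^sup>2) ^ (l + 2)))"
      using A B s by (intro mult_left_mono divide_nonneg_nonneg) auto
    also have "\<dots> = A / (1 + w\<^sup>2) ^ (l + 2)"
    proof -
      have "a / b / t * (t * (b / d)) = a / d" if "b \<noteq> 0" "t \<noteq> 0" for a b t d :: real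
        using that by simp
      then show ?thesis using B s by simp
    qed
    also have "\<dots> \<le> osc_conv (Suc l) w T" by (rule lowT)
    finally show ?thesis .
  qed
  then show ?thesis using A B by (intro exI[of _ "A / B"]) auto
qed

text \<open>The substitution s = \<delta> u. At r = \<delta> the two definitions take different
  branches, but both give 0.\<close>

lemma wendland_wscaled:
  assumes r: "r \<ge> 0" and \<delta>: "\<delta> > 0"
  shows "wendland l (Suc k) (r / \<delta>) = 1 / (Gamma (real (Suc k)) * 2 ^ k * \<delta> ^ (l + 2 * k + 2)) * wscaled l k r \<delta>"
proof (cases "r < \<delta>")
  case True
  let ?g = "\<lambda>s. (\<delta> - s) ^ l * (s * (s\<^sup>2 - r\<^sup>2) ^ k)"
  have "(?g has_integral integral {r..\<delta>} ?g) {r..\<delta>}"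
    by (intro integrable_integral integrable_continuous_interval continuous_intros)
  from has_integral_affinity[OF this[folded cbox_interval], of \<delta> 0] \<delta>
  have "((\<lambda>u. ?g (\<delta> * u)) has_integral integral {r..\<delta>} ?g / \<delta>) ((\<lambda>x. x / \<delta>) ` {r..\<delta>})"
    by (simp add: divide_inverse mult.commute)
  also have "(\<lambda>x. x / \<delta>) ` {r..\<delta>} = {r / \<delta>..1}"
    using \<delta> True by (simp add: image_divide_atLeastAtMost)
  finally have i: "integral {r / \<delta>..1} (\<lambda>u. ?g (\<delta> * u)) = integral {r..\<delta>} ?g / \<delta>" by (rule integral_unique)
  have g: "?g (\<delta> * u) = \<delta> ^ (l + 2 * k + 1) * (u * (1 - u) ^ l * (u\<^sup>2 - (r / \<delta>)\<^sup>2) ^ k)" for u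
  proof -
    define X where "X = u\<^sup>2 - (r / \<delta>)\<^sup>2"
    have 1: "(\<delta> * u)\<^sup>2 - r\<^sup>2 = \<delta>\<^sup>2 * X"
      using \<delta> by (simp add: X_def field_simps)
    have 2: "\<delta> - \<delta> * u = \<delta> * (1 - u)" by (simp add: algebra_simps)
    show ?thesis unfolding 1 2 X_def[symmetric] unfolding power_mult_distrib power_add power_mult by (simp add: mult_ac)
  qed
  have "\<delta> ^ (l + 2 * k + 1) * integral {r / \<delta>..1} (\<lambda>u. u * (1 - u) ^ l * (u\<^sup>2 - (r / \<delta>)\<^sup>2) ^ k) = integral {r..\<delta>} ?g / \<delta>"
    unfolding i[symmetric] g by simp
  then have "integral {r / \<delta>..1} (\<lambda>u. u * (1 - u) ^ l * (u\<^sup>2 - (r / \<delta>)\<^sup>2) ^ k) = integral {r..\<delta>} ?g / \<delta> ^ (l + 2 * k + 2)"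
    using \<delta> by (simp add: field_simps)
  then show ?thesis using True \<delta> by (simp add: wendland_def wscaled_def)
next
  case False
  then show ?thesis using \<delta> by (auto simp: wendland_def wscaled_def)
qed

section \<open>The density of a scaled Wendland function\<close>

context isometric_embedding begin

definition dens :: "nat \<Rightarrow> real \<Rightarrow> 'b \<Rightarrow> real" where
  "dens m T z = osc_conv m (norm z) T"

lemma norm_e: "norm (e x) = norm x"
  unfolding norm_eq_sqrt_inner inner ..

lemma dens_nonneg: "T \<ge> 0 \<Longrightarrow> dens m T z \<ge> 0"
  by (simp add: dens_def osc_conv_nonneg)

text \<open>Of the m + 1 powers of 1 / (1 + (norm z)^2) in the decay, k + 1 are spent on the weight.
  The remaining q = m - k satisfies 2 q = DIM + 1, just enough for integrability.\<close>

lemma moments_dens: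
  assumes m: "2 * Suc m = DIM('b) + 3 + 2 * k" and T: "T \<ge> 0"
  shows "moments (2 * Suc k) (dens m T)"
  unfolding moments_def
proof
  show bm: "dens m T \<in> borel_measurable borel" unfolding dens_def[abs_def] by measurable
  define C where "C = T ^ m * (2 * (1 + T\<^sup>2)) ^ Suc m"
  have C: "C \<ge> 0" unfolding C_def using T by (intro mult_nonneg_nonneg zero_le_power) auto
  define q where "q = Suc m - Suc k"
  have q: "Suc m = q + Suc k" "2 * q > DIM('b)" using m by (auto simp: q_def)
  show "integrable lborel (\<lambda>z. \<bar>dens m T z\<bar> * (1 + norm z) ^ (2 * Suc k))"
  proof (rule Bochner_Integration.integrable_bound)
    show "integrable lborel (\<lambda>z::'b. (C * 2 ^ Suc k) * (1 / (1\<^sup>2 + (norm z)\<^sup>2) ^ q))"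
      by (intro integrable_mult_right integrable_inverse_power q) simp
    show "(\<lambda>z. \<bar>dens m T z\<bar> * (1 + norm z) ^ (2 * Suc k)) \<in> borel_measurable lborel"
      using bm by measurable
    show "AE z in lborel. norm (\<bar>dens m T z\<bar> * (1 + norm z) ^ (2 * Suc k)) \<le> norm ((C * 2 ^ Suc k) * (1 / (1\<^sup>2 + (norm z)\<^sup>2) ^ q))"
    proof (rule AE_I2)
      fix z :: 'b
      let ?P = "1\<^sup>2 + (norm z)\<^sup>2"
      have P: "?P > 0" by (simp add: add_pos_nonneg)
      have "\<bar>dens m T z\<bar> * (1 + norm z) ^ (2 * Suc k) \<le> (C * (1 / ?P ^ Suc m)) * (2 ^ Suc k * ?P ^ Suc k)"
        unfolding dens_def C_def using osc_conv_radial_bound[OF T order_refl, of m "norm z"] one_plus_power_le[of "norm z" "Suc k"] C[unfolded C_def]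
        by (intro mult_mono) auto
      also have "\<dots> = (C * 2 ^ Suc k) * (1 / ?P ^ q)"
      proof -
        have "c * (1 / (a * b)) * (d * b) = c * d * (1 / a)" if "b \<noteq> 0" for a b c d :: real
          using that by simp
        then show ?thesis unfolding q(1) power_add using P by simp
      qed
      finally show "norm (\<bar>dens m T z\<bar> * (1 + norm z) ^ (2 * Suc k)) \<le> norm ((C * 2 ^ Suc k) * (1 / ?P ^ q))"
        using C P by simp
    qed
  qed
qed

lemma fcos_dens:
  assumes m: "2 * Suc m = DIM('b) + 3 + 2 * k" and T: "T \<ge> 0"
  shows "wscaled (Suc m) k (norm x) T = matern_const DIM('b) (Suc m) k * fcos (dens m T) 0 x"
  using wscaled_fourier[OF m T, of "e x"] by (simp add: norm_e fcos_def dens_def)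

lemma matern_const_pos: "l > 0 \<Longrightarrow> matern_const n l k > 0"
  unfolding matern_const_def by (intro divide_pos_pos mult_pos_pos Gamma_real_pos) auto

lemma fcos_dens_radial:
  assumes m: "2 * Suc m = DIM('b) + 3 + 2 * k" and T: "T \<ge> 0"
  shows "norm x = norm y \<Longrightarrow> fcos (dens m T) 0 x = fcos (dens m T) 0 y"
  using fcos_dens[OF m T, of x] fcos_dens[OF m T, of y] matern_const_pos[of "Suc m" "DIM('b)" k] by simp

lemma fcos_dens_vanishes:
  assumes m: "2 * Suc m = DIM('b) + 3 + 2 * k" and T: "T \<ge> 0" and x: "T < norm x"
  shows "fcos (dens m T) 0 x = 0"
  using fcos_dens[OF m T, of x] matern_const_pos[of "Suc m" "DIM('b)" k] x by (simp add: wscaled_def)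

lemma scaled_wendland_fcos:
  assumes m: "2 * Suc m = DIM('b) + 3 + 2 * k" and D: "DIM('b) = 2 * (CARD('n) div 2) + 1" and \<delta>: "\<delta> > 0"
  shows "\<exists>\<kappa>>0. scaled_wendland (Suc k) \<delta> = fcos (\<lambda>z. \<kappa> * dens m \<delta> z) 0"
proof -
  have l: "CARD('n) div 2 + Suc k + 1 = Suc m" using m D by simp
  define \<kappa> where "\<kappa> = 1 / (Gamma (real (Suc k)) * 2 ^ k * \<delta> ^ (Suc m + 2 * k + 2)) * matern_const DIM('b) (Suc m) k / \<delta> ^ CARD('n)"
  have "\<kappa> > 0" unfolding \<kappa>_def using \<delta> matern_const_pos[of "Suc m" "DIM('b)" k]
    by (intro divide_pos_pos mult_pos_pos Gamma_real_pos zero_less_power) auto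
  moreover have "scaled_wendland (Suc k) \<delta> = fcos (\<lambda>z. \<kappa> * dens m \<delta> z) 0"
  proof
    fix x :: "real ^ 'n"
    have "scaled_wendland (Suc k) \<delta> x = wendland (Suc m) (Suc k) (norm x / \<delta>) / \<delta> ^ CARD('n)"
      unfolding scaled_wendland_def l ..
    also have "\<dots> = \<kappa> * fcos (dens m \<delta>) 0 x"
      unfolding wendland_wscaled[OF norm_ge_zero \<delta>] fcos_dens[OF m less_imp_le[OF \<delta>]] \<kappa>_def by simp
    finally show "scaled_wendland (Suc k) \<delta> x = fcos (\<lambda>z. \<kappa> * dens m \<delta> z) 0 x"
      by (simp only: fcos_cmult)
  qed
  ultimately show ?thesis by blast
qed

text \<open>The density scales with exponent 3 m + 2, the two frequencies take away 2 and the change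
  of variables takes away the dimension, which leaves m + 1 + 2 k. Combined with the factor s^(-m)
  of the comparison, the rate is 2 k + 1.\<close>

lemma fcos_freq_dens_scale:
  assumes m: "2 * Suc m = DIM('b) + 3 + 2 * k" and s: "s > 0"
  shows "fcos (\<lambda>z. freq i z * (freq i z * dens m s z)) 0 0 = s ^ (m + 1 + 2 * k) * fcos (\<lambda>z. freq i z * (freq i z * dens m 1 z)) 0 0"
proof -
  let ?f = "\<lambda>z. freq i z * (freq i z * dens m 1 z)"
  have f: "freq i z * (freq i z * dens m s z) = s ^ (3 * m) * ?f (s *\<^sub>R z)" for z
    using osc_conv_scale[of m "norm z" s 1] s
    by (simp add: freq_def dens_def power_add power2_eq_square mult.commute)
  have fm: "?f \<in> borel_measurable borel" unfolding dens_def by measurable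
  have "(LINT z|lborel. ?f z) = s ^ DIM('b) * (LINT z|lborel. ?f (s *\<^sub>R z))"
  proof -
    have "(LINT z|lborel. ?f z) = (LINT z|density (distr lborel borel (\<lambda>x. 0 + s *\<^sub>R x)) (\<lambda>_. \<bar>s\<bar> ^ DIM('b)). ?f z)"
      using lborel_affine[of s "0::'b"] s by simp
    also have "\<dots> = (LINT z|distr lborel borel (\<lambda>x. 0 + s *\<^sub>R x). \<bar>s\<bar> ^ DIM('b) *\<^sub>R ?f z)"
      by (rule integral_density) (use fm in auto)
    also have "\<dots> = (LINT z|lborel. \<bar>s\<bar> ^ DIM('b) *\<^sub>R ?f (0 + s *\<^sub>R z))"
      by (rule integral_distr) (use fm in measurable)
    also have "\<dots> = s ^ DIM('b) * (LINT z|lborel. ?f (s *\<^sub>R z))" using s by simp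
    finally show ?thesis .
  qed
  moreover have "(LINT z|lborel. freq i z * (freq i z * dens m s z)) = s ^ (3 * m) * (LINT z|lborel. ?f (s *\<^sub>R z))"
    unfolding f by (rule integral_mult_right_zero)
  moreover have "s ^ (3 * m) = s ^ (m + 1 + 2 * k) * s ^ DIM('b)"
  proof -
    have "3 * m = (m + 1 + 2 * k) + DIM('b)" using m by simp
    then show ?thesis by (simp only: power_add)
  qed
  ultimately have "(LINT z|lborel. freq i z * (freq i z * dens m s z)) = s ^ (m + 1 + 2 * k) * (LINT z|lborel. ?f z)"
    by (simp only: mult.assoc)
  then show ?thesis unfolding fcos_def by (simp add: linear_0[OF linear])
qed

text \<open>The density is positive everywhere, which is where the index \<open>Suc m\<close> (at
  least two factors) enters, and the frequency vanishes only on a hyperplane.\<close>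

lemma fcos_freq_dens_pos:
  assumes m: "2 * Suc (Suc m) = DIM('b) + 3 + 2 * k"
  shows "fcos (\<lambda>z. freq i z * (freq i z * dens (Suc m) 1 z)) 0 0 > 0"
proof -
  let ?f = "\<lambda>z. freq i z * (freq i z * dens (Suc m) 1 z)"
  have f0: "?f z \<ge> 0" for z using dens_nonneg[of 1 "Suc m" z] by (simp add: mult.assoc[symmetric])
  have "moments (2 * Suc k) (dens (Suc m) 1)" by (rule moments_dens[OF m]) simp
  then have "moments 2 (dens (Suc m) 1)" by (rule moments_mono) simp
  then have "moments 0 ?f" by (intro moments_freq) (simp add: numeral_2_eq_2)
  then have int: "integrable lborel ?f" using fcos_integrable[of 0 ?f 0 0] by (simp add: linear_0[OF linear])
  have eq: "fcos ?f 0 0 = (LINT z|lborel. ?f z)" by (simp add: fcos_def linear_0[OF linear])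
  have "(LINT z|lborel. ?f z) \<noteq> 0"
  proof
    assume "(LINT z|lborel. ?f z) = 0"
    then have "AE z in lborel. ?f z = 0"
      using integral_nonneg_eq_0_iff_AE[OF int] f0 by simp
    moreover have "AE z in lborel. freq i z \<noteq> 0"
    proof -
      have "e (axis i 1) \<noteq> 0" using inner[of "axis i 1" "axis i 1"] by (auto simp: inner_axis_axis)
      then have "negligible {z. e (axis i 1) \<bullet> z = 0}" by (intro negligible_hyperplane) simp
      then have "{z. e (axis i 1) \<bullet> z = 0} \<in> null_sets lebesgue" by (simp add: negligible_iff_null_sets)
      moreover have "{z. e (axis i 1) \<bullet> z = 0} \<in> sets lborel" by simp
      ultimately have "{z. e (axis i 1) \<bullet> z = 0} \<in> null_sets lborel"
        by (metis null_sets_completion_iff)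
      then show ?thesis by (rule AE_I') (auto simp: freq_def inner_commute)
    qed
    ultimately have "AE z::'b in lborel. False"
    proof eventually_elim
      case (elim z)
      obtain c where c: "c > 0" "\<And>w. osc_conv (Suc m) w 1 \<ge> c / (1 + w\<^sup>2) ^ (m + 2)"
        using osc_conv_lower[of m] by blast
      have "0 < c / (1 + (norm z)\<^sup>2) ^ (m + 2)" using c by (intro divide_pos_pos zero_less_power add_pos_nonneg) auto
      with c(2)[of "norm z"] have "dens (Suc m) 1 z > 0" unfolding dens_def by linarith
      with elim show False by simp
    qed
    from AE_E2[OF this] show False by simp
  qed
  moreover have "(LINT z|lborel. ?f z) \<ge> 0" using f0 by (intro Bochner_Integration.integral_nonneg)
  ultimately show ?thesis unfolding eq by linarith
qed

end

section \<open>Eigenvalues of the collocation matrix\<close>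

lemma eigenvector_iff_sum:
  assumes A: "A \<in> carrier_mat n n" and v: "v \<in> carrier_vec n"
  shows "eigenvector A v k \<longleftrightarrow> v \<noteq> 0\<^sub>v n \<and> (\<forall>r<n. (\<Sum>c<n. A $$ (r, c) * vec_index v c) = k * vec_index v r)"
proof -
  have "vec_index (A *\<^sub>v v) r = (\<Sum>c<n. A $$ (r, c) * vec_index v c)" if "r < n" for r
    using A v that by (simp add: scalar_prod_def atLeast0LessThan)
  then have "A *\<^sub>v v = k \<cdot>\<^sub>v v \<longleftrightarrow> (\<forall>r<n. (\<Sum>c<n. A $$ (r, c) * vec_index v c) = k * vec_index v r)"
    using A v by (auto simp: vec_eq_iff)
  then show ?thesis using A v by (auto simp: eigenvector_def)
qed

text \<open>\<open>lambda_min\<close> is a \<open>Min\<close>, so a real eigenvalue has to be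
  exhibited. For a complex eigenvector with real part x and imaginary part y, symmetry gives Im k
  times the sum of x^2 + y^2 equal to 0. Hence k is real, and x or y is a real eigenvector.\<close>

lemma spectrum_real_symmetric_nonempty:
  fixes A :: "real Matrix.mat"
  assumes A: "A \<in> carrier_mat n n" and n: "n > 0" and symm: "\<And>r c. r < n \<Longrightarrow> c < n \<Longrightarrow> A $$ (r, c) = A $$ (c, r)"
  shows "spectrum A \<noteq> {}"
proof -
  let ?B = "map_mat complex_of_real A"
  have B: "?B \<in> carrier_mat n n" using A by simp
  obtain k where "k \<in> spectrum ?B" using spectrum_non_empty[OF B n] by blast
  then obtain v where ev: "eigenvector ?B v k" by (auto simp: spectrum_def eigenvalue_def)
  then have v: "v \<in> carrier_vec n" using A by (auto simp: eigenvector_def)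
  have v0: "v \<noteq> 0\<^sub>v n" and vk: "(\<Sum>c<n. complex_of_real (A $$ (r, c)) * vec_index v c) = k * vec_index v r" if "r < n" for r
    using ev that A n unfolding eigenvector_iff_sum[OF B v] by (auto simp: index_map_mat)
  define x where "x = (\<lambda>r. Re (vec_index v r))"
  define y where "y = (\<lambda>r. Im (vec_index v r))"
  have ex: "(\<Sum>c<n. A $$ (r, c) * x c) = Re k * x r - Im k * y r" if "r < n" for r
    using arg_cong[OF vk[OF that], of Re] by (simp add: x_def y_def)
  have ey: "(\<Sum>c<n. A $$ (r, c) * y c) = Re k * y r + Im k * x r" if "r < n" for r
    using arg_cong[OF vk[OF that], of Im] by (simp add: x_def y_def)
  have "(\<Sum>r<n. y r * (Re k * x r - Im k * y r)) = (\<Sum>r<n. y r * (\<Sum>c<n. A $$ (r, c) * x c))"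
    by (intro sum.cong refl) (simp add: ex)
  also have "\<dots> = (\<Sum>r<n. \<Sum>c<n. A $$ (r, c) * (y r * x c))"
    by (simp add: sum_distrib_left mult_ac)
  also have "\<dots> = (\<Sum>c<n. \<Sum>r<n. A $$ (r, c) * (y r * x c))" by (rule sum.swap)
  also have "\<dots> = (\<Sum>c<n. \<Sum>r<n. A $$ (c, r) * (y r * x c))"
    by (intro sum.cong refl) (simp add: symm)
  also have "\<dots> = (\<Sum>c<n. x c * (\<Sum>r<n. A $$ (c, r) * y r))"
    by (simp add: sum_distrib_left mult_ac)
  also have "\<dots> = (\<Sum>r<n. x r * (Re k * y r + Im k * x r))"
    by (intro sum.cong refl) (simp add: ey)
  finally have "(\<Sum>r<n. x r * (Re k * y r + Im k * x r)) - (\<Sum>r<n. y r * (Re k * x r - Im k * y r)) = 0" by simp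
  moreover have "(\<Sum>r<n. x r * (Re k * y r + Im k * x r)) - (\<Sum>r<n. y r * (Re k * x r - Im k * y r)) = Im k * (\<Sum>r<n. (x r)\<^sup>2 + (y r)\<^sup>2)"
    unfolding sum_subtractf[symmetric] sum_distrib_left by (intro sum.cong refl) (simp add: power2_eq_square algebra_simps)
  ultimately have prod: "Im k * (\<Sum>r<n. (x r)\<^sup>2 + (y r)\<^sup>2) = 0" by simp
  obtain r where r: "r < n" "vec_index v r \<noteq> 0" using v0[OF n] v by (auto simp: vec_eq_iff)
  then have xy: "x r \<noteq> 0 \<or> y r \<noteq> 0" by (simp add: x_def y_def complex_eq_iff)
  then have "0 < (x r)\<^sup>2 + (y r)\<^sup>2" by (simp add: sum_power2_gt_zero_iff)
  also have "\<dots> \<le> (\<Sum>r<n. (x r)\<^sup>2 + (y r)\<^sup>2)" using r by (intro member_le_sum) auto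
  finally have Im: "Im k = 0" using prod by simp
  obtain w where w: "w r \<noteq> 0" "\<And>r. r < n \<Longrightarrow> (\<Sum>c<n. A $$ (r, c) * w c) = Re k * w r"
    using xy ex ey Im by (metis add.right_neutral diff_zero mult_zero_left)
  let ?w = "vec n w"
  have "eigenvector A ?w (Re k)"
    using w r by (subst eigenvector_iff_sum[OF A]) (auto simp: vec_eq_iff)
  then show ?thesis by (auto simp: spectrum_def eigenvalue_def)
qed

lemma lambda_min_ge:
  fixes A :: "real Matrix.mat"
  assumes A: "A \<in> carrier_mat n n" and n: "n > 0" and symm: "\<And>r c. r < n \<Longrightarrow> c < n \<Longrightarrow> A $$ (r, c) = A $$ (c, r)"
    and form: "\<And>w. b * (\<Sum>r<n. (w r)\<^sup>2) \<le> (\<Sum>r<n. \<Sum>c<n. w r * w c * A $$ (r, c))"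
  shows "b \<le> lambda_min A"
proof -
  have "b \<le> k" if k: "k \<in> spectrum A" for k
  proof -
    obtain v where ev: "eigenvector A v k" using k by (auto simp: spectrum_def eigenvalue_def)
    then have v: "v \<in> carrier_vec n" using A by (auto simp: eigenvector_def)
    have v0: "v \<noteq> 0\<^sub>v n" and vk: "\<And>r. r < n \<Longrightarrow> (\<Sum>c<n. A $$ (r, c) * vec_index v c) = k * vec_index v r"
      using ev unfolding eigenvector_iff_sum[OF A v] by auto
    obtain r where r: "r < n" "vec_index v r \<noteq> 0" using v0 v by (auto simp: vec_eq_iff)
    have "0 < (vec_index v r)\<^sup>2" using r by simp
    also have "\<dots> \<le> (\<Sum>r<n. (vec_index v r)\<^sup>2)" using r by (intro member_le_sum) auto
    finally have pos: "0 < (\<Sum>r<n. (vec_index v r)\<^sup>2)" .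
    have "b * (\<Sum>r<n. (vec_index v r)\<^sup>2) \<le> (\<Sum>r<n. \<Sum>c<n. vec_index v r * vec_index v c * A $$ (r, c))"
      by (rule form)
    also have "\<dots> = (\<Sum>r<n. vec_index v r * (\<Sum>c<n. A $$ (r, c) * vec_index v c))"
      by (simp add: sum_distrib_left mult_ac)
    also have "\<dots> = (\<Sum>r<n. vec_index v r * (k * vec_index v r))"
      by (intro sum.cong refl) (simp add: vk)
    also have "\<dots> = k * (\<Sum>r<n. (vec_index v r)\<^sup>2)"
      by (simp add: sum_distrib_left power2_eq_square mult_ac)
    finally show "b \<le> k" using pos by simp
  qed
  moreover have "finite (spectrum A)" "spectrum A \<noteq> {}"
    using card_finite_spectrum(1)[OF A] spectrum_real_symmetric_nonempty[OF A n symm] by auto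
  ultimately show ?thesis unfolding lambda_min_def by simp
qed

lemma bij_betw_colloc_index:
  "bij_betw (\<lambda>r. (from_nat_into (UNIV :: 'n::finite set) (r mod CARD('n)), r div CARD('n) + 1)) {..<CARD('n) * M} (UNIV \<times> {1..M})"
proof -
  let ?d = "CARD('n)"
  let ?f = "from_nat_into (UNIV :: 'n set)"
  have d: "?d > 0" by simp
  have f: "bij_betw ?f {..<?d} UNIV" using bij_betw_from_nat_into_finite[of "UNIV :: 'n set"] by simp
  show ?thesis
  proof (rule bij_betw_imageI)
    show "inj_on (\<lambda>r. (?f (r mod ?d), r div ?d + 1)) {..<?d * M}"
    proof (rule inj_onI)
      fix r s assume "(?f (r mod ?d), r div ?d + 1) = (?f (s mod ?d), s div ?d + 1)"
      then have "?f (r mod ?d) = ?f (s mod ?d)" and dv: "r div ?d = s div ?d" by auto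
      then have "r mod ?d = s mod ?d"
        using bij_betw_imp_inj_on[OF f] d by (auto dest: inj_onD)
      with dv show "r = s" by (metis div_mult_mod_eq)
    qed
    show "(\<lambda>r. (?f (r mod ?d), r div ?d + 1)) ` {..<?d * M} = UNIV \<times> {1..M}"
    proof (intro equalityI subsetI)
      fix p assume "p \<in> (\<lambda>r. (?f (r mod ?d), r div ?d + 1)) ` {..<?d * M}"
      then show "p \<in> UNIV \<times> {1..M}"
        using less_mult_imp_div_less by (force simp: mult.commute Suc_le_eq)
    next
      fix p :: "'n \<times> nat" assume p: "p \<in> UNIV \<times> {1..M}"
      obtain i j where ij: "p = (i, j)" by (cases p)
      obtain a where a: "a < ?d" "?f a = i" using bij_betw_imp_surj_on[OF f] by (metis (no_types, lifting) UNIV_I imageE lessThan_iff)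
      have j: "1 \<le> j" "j \<le> M" using p ij by auto
      \<comment> \<open>The shift j - 1 undoes the numbering of centres from 1 in the proposed
        preimage d (j - 1) + a.\<close>
      have "?d * (j - 1) + a < ?d * (j - 1) + ?d" using a by simp
      also have "\<dots> = ?d * j" using j by (metis Suc_diff_1 mult_Suc_right add.commute less_eq_Suc_le One_nat_def)
      also have "\<dots> \<le> ?d * M" using j by simp
      finally have "?d * (j - 1) + a < ?d * M" .
      moreover have "(?f ((?d * (j - 1) + a) mod ?d), (?d * (j - 1) + a) div ?d + 1) = p"
        using a j d ij by simp
      ultimately show "p \<in> (\<lambda>r. (?f (r mod ?d), r div ?d + 1)) ` {..<?d * M}"
        by (metis (no_types, lifting) image_eqI lessThan_iff)
    qed
  qed
qed

lemma lambda_min_colloc_matrix_ge: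
  fixes x :: "nat \<Rightarrow> real ^ 'n::finite"
  assumes M: "M > 0" and symm: "\<And>i j i' j'. colloc_entry k \<delta> \<nu> N x i j i' j' = colloc_entry k \<delta> \<nu> N x i' j' i j"
    and form: "\<And>\<alpha>. b * (\<Sum>j\<in>{1..M}. \<Sum>i\<in>UNIV. (\<alpha> i j)\<^sup>2) \<le> (\<Sum>j\<in>{1..M}. \<Sum>j'\<in>{1..M}. \<Sum>i\<in>UNIV. \<Sum>i'\<in>UNIV. \<alpha> i j * \<alpha> i' j' * colloc_entry k \<delta> \<nu> N x i j i' j')"
  shows "b \<le> lambda_min (colloc_matrix k \<delta> \<nu> N M x)"
proof (rule lambda_min_ge)
  let ?n = "CARD('n) * M"
  let ?P = "(UNIV :: 'n set) \<times> {1..M}"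
  define \<phi> where "\<phi> = (\<lambda>r. (from_nat_into (UNIV :: 'n set) (r mod CARD('n)), r div CARD('n) + 1))"
  have bij: "bij_betw \<phi> {..<?n} ?P" unfolding \<phi>_def by (rule bij_betw_colloc_index)
  let ?E = "\<lambda>p q. colloc_entry k \<delta> \<nu> N x (fst p) (snd p) (fst q) (snd q)"
  show "colloc_matrix k \<delta> \<nu> N M x \<in> carrier_mat ?n ?n" by (simp add: colloc_matrix_def)
  show "?n > 0" using M by simp
  have entry: "colloc_matrix k \<delta> \<nu> N M x $$ (r, c) = ?E (\<phi> r) (\<phi> c)" if "r < ?n" "c < ?n" for r c
    using that by (simp add: colloc_matrix_def \<phi>_def)
  show "colloc_matrix k \<delta> \<nu> N M x $$ (r, c) = colloc_matrix k \<delta> \<nu> N M x $$ (c, r)" if "r < ?n" "c < ?n" for r c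
    using that symm by (simp add: entry)
  fix w :: "nat \<Rightarrow> real"
  define \<beta> where "\<beta> = (\<lambda>p. w (the_inv_into {..<?n} \<phi> p))"
  have \<beta>: "\<beta> (\<phi> r) = w r" if "r < ?n" for r
    using that bij unfolding \<beta>_def by (simp add: the_inv_into_f_f bij_betw_imp_inj_on)
  have "(\<Sum>r<?n. (w r)\<^sup>2) = (\<Sum>r<?n. (\<beta> (\<phi> r))\<^sup>2)" by (simp add: \<beta>)
  also have "\<dots> = (\<Sum>p\<in>?P. (\<beta> p)\<^sup>2)" by (rule sum.reindex_bij_betw[OF bij])
  also have "\<dots> = (\<Sum>i\<in>UNIV. \<Sum>j\<in>{1..M}. (\<beta> (i, j))\<^sup>2)" by (simp add: sum.cartesian_product case_prod_unfold)
  also have "\<dots> = (\<Sum>j\<in>{1..M}. \<Sum>i\<in>UNIV. (\<beta> (i, j))\<^sup>2)" by (rule sum.swap)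
  finally have 1: "(\<Sum>r<?n. (w r)\<^sup>2) = (\<Sum>j\<in>{1..M}. \<Sum>i\<in>UNIV. (\<beta> (i, j))\<^sup>2)" .
  have "(\<Sum>r<?n. \<Sum>c<?n. w r * w c * colloc_matrix k \<delta> \<nu> N M x $$ (r, c)) = (\<Sum>r<?n. \<Sum>c<?n. \<beta> (\<phi> r) * \<beta> (\<phi> c) * ?E (\<phi> r) (\<phi> c))"
    by (intro sum.cong refl) (simp add: \<beta> entry)
  also have "\<dots> = (\<Sum>r<?n. \<Sum>q\<in>?P. \<beta> (\<phi> r) * \<beta> q * ?E (\<phi> r) q)"
    by (intro sum.cong refl sum.reindex_bij_betw[OF bij])
  also have "\<dots> = (\<Sum>p\<in>?P. \<Sum>q\<in>?P. \<beta> p * \<beta> q * ?E p q)"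
    by (rule sum.reindex_bij_betw[OF bij])
  also have "\<dots> = (\<Sum>i\<in>UNIV. \<Sum>j\<in>{1..M}. \<Sum>i'\<in>UNIV. \<Sum>j'\<in>{1..M}. \<beta> (i, j) * \<beta> (i', j') * colloc_entry k \<delta> \<nu> N x i j i' j')"
    unfolding sum.cartesian_product' by simp
  also have "\<dots> = (\<Sum>j\<in>{1..M}. \<Sum>i\<in>UNIV. \<Sum>j'\<in>{1..M}. \<Sum>i'\<in>UNIV. \<beta> (i, j) * \<beta> (i', j') * colloc_entry k \<delta> \<nu> N x i j i' j')"
    by (subst sum.swap) (intro sum.cong refl sum.swap)
  also have "\<dots> = (\<Sum>j\<in>{1..M}. \<Sum>j'\<in>{1..M}. \<Sum>i\<in>UNIV. \<Sum>i'\<in>UNIV. \<beta> (i, j) * \<beta> (i', j') * colloc_entry k \<delta> \<nu> N x i j i' j')"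
    by (intro sum.cong refl sum.swap)
  finally have 2: "(\<Sum>r<?n. \<Sum>c<?n. w r * w c * colloc_matrix k \<delta> \<nu> N M x $$ (r, c)) =
    (\<Sum>j\<in>{1..M}. \<Sum>j'\<in>{1..M}. \<Sum>i\<in>UNIV. \<Sum>i'\<in>UNIV. \<beta> (i, j) * \<beta> (i', j') * colloc_entry k \<delta> \<nu> N x i j i' j')" .
  show "b * (\<Sum>r<?n. (w r)\<^sup>2) \<le> (\<Sum>r<?n. \<Sum>c<?n. w r * w c * colloc_matrix k \<delta> \<nu> N M x $$ (r, c))"
    unfolding 1 2 by (rule form)
qed

section \<open>The lower bound for separated centres\<close>

context isometric_embedding begin

lemma fcos_minus: "fcos a 0 (- x) = fcos a 0 x"
  by (simp add: fcos_def linear_neg[OF linear])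

lemma dsym_commute: "dsym i j = dsym j i"
  by (auto simp: dsym_def fun_eq_iff)

text \<open>Here q may be any lower bound for half the mutual distances, capped by R. The cap lets
  the comparison scale be a fixed multiple of q and still stay below \<delta>.\<close>

lemma colloc_form_lower:
  assumes dim: "CARD('n) \<ge> 2" and D: "DIM('b) = 2 * (CARD('n) div 2) + 1"
    and \<delta>: "\<delta> > 0" and k: "k \<ge> 2" and R: "R > 0"
  shows "\<exists>C>0. \<forall>N M (x :: nat \<Rightarrow> real ^ 'n) q.
     M > 0 \<longrightarrow> 0 < q \<longrightarrow> q \<le> R \<longrightarrow> (\<forall>j\<in>{1..M}. \<forall>j'\<in>{1..M}. j \<noteq> j' \<longrightarrow> 2 * q \<le> norm (x j - x j')) \<longrightarrow>
     C * q ^ (2 * k + 3) \<le> lambda_min (colloc_matrix k \<delta> \<nu> N M x)"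
proof -
  define d where "d = CARD('n) div 2"
  \<comment> \<open>\<open>Suc m1\<close> and \<open>Suc m2\<close> are the indices l of the
    velocity and pressure Wendland functions. Each of m1 and m2 is written as a successor so that
    the lower bound for two or more factors applies.\<close>
  define m1 where "m1 = Suc (d + k + 1)"
  define m2 where "m2 = Suc (d + k - 1)"
  have m1: "2 * Suc m1 = DIM('b) + 3 + 2 * (k + 1)" unfolding D m1_def d_def by simp
  have m2: "2 * Suc m2 = DIM('b) + 3 + 2 * (k - 1)" unfolding D m2_def d_def using k by simp
  obtain \<kappa>1 where \<kappa>1: "\<kappa>1 > 0" "scaled_wendland (Suc (k + 1)) \<delta> = fcos (\<lambda>z. \<kappa>1 * dens m1 \<delta> z) 0"
    using scaled_wendland_fcos[OF m1 D \<delta>] by blast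
  obtain \<kappa>2 where \<kappa>2: "\<kappa>2 > 0" "scaled_wendland (Suc (k - 1)) \<delta> = fcos (\<lambda>z. \<kappa>2 * dens m2 \<delta> z) 0"
    using scaled_wendland_fcos[OF m2 D \<delta>] by blast
  define p1 where "p1 = (\<lambda>z. \<kappa>1 * dens m1 \<delta> z)"
  define p2 where "p2 = (\<lambda>z. \<kappa>2 * dens m2 \<delta> z)"
  have k1: "scaled_wendland (k + 2) \<delta> = fcos p1 0" using \<kappa>1(2) by (simp add: p1_def)
  have k2: "scaled_wendland k \<delta> = fcos p2 0" using \<kappa>2(2) k by (simp add: p2_def)
  \<comment> \<open>The available orders are 2 (k + 2) and 2 k; the condition k \<ge> 2 makes them
    reach 8 and 4.\<close>
  have mo1: "moments 8 (dens m1 T)" if "T \<ge> 0" for T by (rule moments_mono[OF moments_dens[OF m1 that]]) (use k in simp)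
  have mo2: "moments 4 (dens m2 T)" if "T \<ge> 0" for T by (rule moments_mono[OF moments_dens[OF m2 that]]) (use k in simp)
  have mp1: "moments 8 p1" and mp2: "moments 4 p2"
    unfolding p1_def p2_def using \<delta> by (auto intro!: moments_cmult mo1 mo2)
  obtain c1 where c1: "c1 > 0" "\<And>s w. 0 < s \<Longrightarrow> s \<le> \<delta> \<Longrightarrow> c1 / s ^ m1 * osc_conv m1 w s \<le> osc_conv m1 w \<delta>"
    using osc_conv_compare[OF \<delta>, of "d + k + 1"] unfolding m1_def by blast
  obtain c2 where c2: "c2 > 0" "\<And>s w. 0 < s \<Longrightarrow> s \<le> \<delta> \<Longrightarrow> c2 / s ^ m2 * osc_conv m2 w s \<le> osc_conv m2 w \<delta>"
    using osc_conv_compare[OF \<delta>, of "d + k - 1"] unfolding m2_def by blast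
  let ?g = "\<lambda>m s i. fcos (\<lambda>z. freq i z * (freq i z * dens m s z)) 0 0"
  define G1 where "G1 = Min (range (?g m1 1))"
  define G2 where "G2 = Min (range (?g m2 1))"
  have G1: "G1 > 0" "\<And>i. G1 \<le> ?g m1 1 i"
    using fcos_freq_dens_pos[OF m1[unfolded m1_def]] unfolding G1_def m1_def by (auto simp: Min_gr_iff)
  have G2: "G2 > 0" "\<And>i. G2 \<le> ?g m2 1 i"
    using fcos_freq_dens_pos[OF m2[unfolded m2_def]] unfolding G2_def m2_def by (auto simp: Min_gr_iff)
  \<comment> \<open>The fixed ratio of the comparison scale to q: at most 1, and small enough that
    \<theta> R \<le> \<delta>.\<close>
  define \<theta> where "\<theta> = min 1 (\<delta> / R)"
  have \<theta>: "\<theta> > 0" "\<theta> \<le> 1" "\<theta> \<le> \<delta> / R" using \<delta> R by (auto simp: \<theta>_def)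
  \<comment> \<open>Dividing by \<delta>^4 lowers the pressure rate s^(2k-1) to the velocity rate
    s^(2k+3), using s \<le> \<delta>.\<close>
  define c where "c = min (\<kappa>1 * c1 * G1) (\<kappa>2 * c2 * G2 / \<delta> ^ 4)"
  have c: "c > 0" unfolding c_def using \<kappa>1(1) \<kappa>2(1) c1(1) c2(1) G1(1) G2(1) \<delta> by simp
  have "c * \<theta> ^ (2 * k + 3) * q ^ (2 * k + 3) \<le> lambda_min (colloc_matrix k \<delta> \<nu> N M x)"
    if M: "M > 0" and q: "0 < q" "q \<le> R" and sep: "\<forall>j\<in>{1..M}. \<forall>j'\<in>{1..M}. j \<noteq> j' \<longrightarrow> 2 * q \<le> norm (x j - x j')"
    for N M and x :: "nat \<Rightarrow> real ^ 'n" and q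
  proof (rule lambda_min_colloc_matrix_ge[OF M])
    note entry = colloc_entry_fcos[OF mp1 mp2 k1 k2, of \<nu> N x]
    show "colloc_entry k \<delta> \<nu> N x i j i' j' = colloc_entry k \<delta> \<nu> N x i' j' i j" for i j i' j'
      unfolding entry using fcos_minus[of _ "x j - x j'"] by (simp add: dsym_commute[of i' i] mult.left_commute)
    \<comment> \<open>The comparison scale: below \<open>2 q\<close> the centres decouple, and \<open>s \<le> \<delta>\<close> is needed for monotonicity.\<close>
    define s where "s = \<theta> * q"
    have s0: "s > 0" using \<theta> q by (simp add: s_def)
    have "s \<le> 1 * q" unfolding s_def using \<theta> q by (intro mult_right_mono) auto
    then have s2: "s < 2 * q" using q by simp
    have "s \<le> \<delta> / R * R" unfolding s_def using \<theta> q \<delta> R by (intro mult_mono) auto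
    then have s\<delta>: "s \<le> \<delta>" using R by simp
    have sep': "s < norm (x j - x j')" if "j \<in> {1..M}" "j' \<in> {1..M}" "j \<noteq> j'" for j j'
      using sep that s2 by fastforce
    have van1: "vanishes_outside s 0 (dens m1 s)" and van2: "vanishes_outside s 0 (dens m2 s)"
      unfolding vanishes_outside_def using fcos_dens_vanishes[OF m1] fcos_dens_vanishes[OF m2] s0 by auto
    fix \<alpha> :: "'n \<Rightarrow> nat \<Rightarrow> real"
    let ?J = "{1..M}"
    let ?S1 = "\<Sum>j\<in>{j\<in>?J. \<not> j \<le> N}. \<Sum>i\<in>UNIV. (\<alpha> i j)\<^sup>2"
    let ?S2 = "\<Sum>j\<in>{j\<in>?J. j \<le> N}. \<Sum>i\<in>UNIV. (\<alpha> i j)\<^sup>2"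
    have S0: "?S1 \<ge> 0" "?S2 \<ge> 0" by (auto intro!: sum_nonneg)
    have f1: "form1 \<nu> N x ?J \<alpha> p1 \<ge> c * s ^ (2 * k + 3) * ?S1"
    proof -
      have "c * s ^ (2 * k + 3) * ?S1 \<le> \<kappa>1 * c1 * G1 * s ^ (2 * k + 3) * ?S1"
        using s0 S0 by (intro mult_right_mono) (auto simp: c_def)
      also have "\<dots> = (\<kappa>1 * (c1 / s ^ m1)) * (s ^ (m1 + 1 + 2 * (k + 1)) * G1 * ?S1)"
      proof -
        have "m1 + 1 + 2 * (k + 1) = m1 + (2 * k + 3)" by simp
        then show ?thesis using s0 by (simp only: power_add) simp
      qed
      also have "\<dots> \<le> (\<kappa>1 * (c1 / s ^ m1)) * form1 \<nu> N x ?J \<alpha> (dens m1 s)"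
      proof (rule mult_left_mono)
        show "s ^ (m1 + 1 + 2 * (k + 1)) * G1 * ?S1 \<le> form1 \<nu> N x ?J \<alpha> (dens m1 s)"
        proof (rule form1_diag[OF mo1[OF less_imp_le[OF s0]] van1 fcos_dens_radial[OF m1 less_imp_le[OF s0]] finite_atLeastAtMost sep' _ dens_nonneg[OF less_imp_le[OF s0]] dim])
          show "s ^ (m1 + 1 + 2 * (k + 1)) * G1 \<le> ?g m1 s i" for i
            unfolding fcos_freq_dens_scale[OF m1 s0] using s0 by (intro mult_left_mono G1) auto
        qed
        show "0 \<le> \<kappa>1 * (c1 / s ^ m1)" using \<kappa>1(1) c1(1) s0 by simp
      qed
      also have "\<dots> \<le> form1 \<nu> N x ?J \<alpha> p1"
      proof (rule form1_mono[OF mp1 mo1])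
        show "\<kappa>1 * (c1 / s ^ m1) * dens m1 s z \<le> p1 z" for z
          unfolding p1_def dens_def mult.assoc using c1(2)[OF s0 s\<delta>, of "norm z"] \<kappa>1(1) by (intro mult_left_mono) auto
      qed (use s0 in simp)
      finally show ?thesis .
    qed
    have f2: "form2 N x ?J \<alpha> p2 \<ge> c * s ^ (2 * k + 3) * ?S2"
    proof -
      have sk: "s ^ (2 * k + 3) \<le> \<delta> ^ 4 * s ^ (2 * k - 1)"
      proof -
        have "2 * k + 3 = 4 + (2 * k - 1)" using k by simp
        then have "s ^ (2 * k + 3) = s ^ 4 * s ^ (2 * k - 1)" by (simp only: power_add)
        also have "\<dots> \<le> \<delta> ^ 4 * s ^ (2 * k - 1)" using s0 s\<delta> by (intro mult_right_mono power_mono) auto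
        finally show ?thesis .
      qed
      have "c * s ^ (2 * k + 3) * ?S2 \<le> (\<kappa>2 * c2 * G2 / \<delta> ^ 4) * (\<delta> ^ 4 * s ^ (2 * k - 1)) * ?S2"
        using s0 S0 c sk \<kappa>2(1) c2(1) G2(1) \<delta> by (intro mult_right_mono mult_mono) (auto simp: c_def)
      also have "\<dots> = (\<kappa>2 * (c2 / s ^ m2)) * (s ^ (m2 + 1 + 2 * (k - 1)) * G2 * ?S2)"
      proof -
        have "m2 + 1 + 2 * (k - 1) = m2 + (2 * k - 1)" using k by simp
        then show ?thesis using s0 \<delta> by (simp only: power_add) simp
      qed
      also have "\<dots> \<le> (\<kappa>2 * (c2 / s ^ m2)) * form2 N x ?J \<alpha> (dens m2 s)"
      proof (rule mult_left_mono)
        show "s ^ (m2 + 1 + 2 * (k - 1)) * G2 * ?S2 \<le> form2 N x ?J \<alpha> (dens m2 s)"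
        proof (rule form2_diag[OF mo2[OF less_imp_le[OF s0]] van2 fcos_dens_radial[OF m2 less_imp_le[OF s0]] finite_atLeastAtMost sep'])
          show "s ^ (m2 + 1 + 2 * (k - 1)) * G2 \<le> ?g m2 s i" for i
            unfolding fcos_freq_dens_scale[OF m2 s0] using s0 by (intro mult_left_mono G2) auto
        qed
        show "0 \<le> \<kappa>2 * (c2 / s ^ m2)" using \<kappa>2(1) c2(1) s0 by simp
      qed
      also have "\<dots> \<le> form2 N x ?J \<alpha> p2"
      proof (rule form2_mono[OF mp2 mo2])
        show "\<kappa>2 * (c2 / s ^ m2) * dens m2 s z \<le> p2 z" for z
          unfolding p2_def dens_def mult.assoc using c2(2)[OF s0 s\<delta>, of "norm z"] \<kappa>2(1) by (intro mult_left_mono) auto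
      qed (use s0 in simp)
      finally show ?thesis .
    qed
    have split: "(\<Sum>j\<in>?J. \<Sum>i\<in>UNIV. (\<alpha> i j)\<^sup>2) = ?S1 + ?S2"
    proof -
      have "(\<Sum>j\<in>?J. \<Sum>i\<in>UNIV. (\<alpha> i j)\<^sup>2) = (\<Sum>j\<in>{j\<in>?J. \<not> j \<le> N} \<union> {j\<in>?J. j \<le> N}. \<Sum>i\<in>UNIV. (\<alpha> i j)\<^sup>2)"
        by (rule sum.cong) auto
      also have "\<dots> = ?S1 + ?S2" by (rule sum.union_disjoint) auto
      finally show ?thesis .
    qed
    have "c * \<theta> ^ (2 * k + 3) * q ^ (2 * k + 3) * (\<Sum>j\<in>?J. \<Sum>i\<in>UNIV. (\<alpha> i j)\<^sup>2) = c * s ^ (2 * k + 3) * ?S1 + c * s ^ (2 * k + 3) * ?S2"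
      unfolding split s_def power_mult_distrib by (simp add: algebra_simps)
    also have "\<dots> \<le> form1 \<nu> N x ?J \<alpha> p1 + form2 N x ?J \<alpha> p2" using f1 f2 by (rule add_mono)
    also have "\<dots> = (\<Sum>j\<in>?J. \<Sum>j'\<in>?J. \<Sum>i\<in>UNIV. \<Sum>i'\<in>UNIV. \<alpha> i j * \<alpha> i' j' * colloc_entry k \<delta> \<nu> N x i j i' j')"
      unfolding form1_def form2_def sum.distrib[symmetric] entry by (simp only: distrib_left)
    finally show "c * \<theta> ^ (2 * k + 3) * q ^ (2 * k + 3) * (\<Sum>j\<in>?J. \<Sum>i\<in>UNIV. (\<alpha> i j)\<^sup>2) \<le>
      (\<Sum>j\<in>?J. \<Sum>j'\<in>?J. \<Sum>i\<in>UNIV. \<Sum>i'\<in>UNIV. \<alpha> i j * \<alpha> i' j' * colloc_entry k \<delta> \<nu> N x i j i' j')" .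
  qed
  moreover have "c * \<theta> ^ (2 * k + 3) > 0" using c \<theta> by simp
  ultimately show ?thesis by blast
qed

end

lemma colloc_lower:
  assumes dim: "CARD('n::finite) \<ge> 2" and \<delta>: "\<delta> > 0" and k: "k \<ge> 2" and R: "R > 0"
  shows "\<exists>C>0. \<forall>N M (x :: nat \<Rightarrow> real ^ 'n) q.
     M > 0 \<longrightarrow> 0 < q \<longrightarrow> q \<le> R \<longrightarrow> (\<forall>j\<in>{1..M}. \<forall>j'\<in>{1..M}. j \<noteq> j' \<longrightarrow> 2 * q \<le> norm (x j - x j')) \<longrightarrow>
     C * q ^ (2 * k + 3) \<le> lambda_min (colloc_matrix k \<delta> \<nu> N M x)"
proof (cases "even CARD('n)")
  case True
  interpret isometric_embedding "\<lambda>x :: real ^ 'n. (x, 0 :: real)"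
    by standard (auto intro!: linearI simp: inner_prod_def)
  have "DIM((real ^ 'n) \<times> real) = 2 * (CARD('n) div 2) + 1" using True by simp
  from colloc_form_lower[OF dim this \<delta> k R] show ?thesis .
next
  case False
  interpret isometric_embedding "\<lambda>x :: real ^ 'n. x"
    by standard (auto intro!: linearI)
  have "DIM(real ^ 'n) = 2 * (CARD('n) div 2) + 1" using False by simp
  from colloc_form_lower[OF dim this \<delta> k R] show ?thesis .
qed

section \<open>Separation distance and conclusion\<close>

lemma separation_distance_bounds:
  fixes x :: "nat \<Rightarrow> real ^ 'n::finite"
  assumes M: "2 \<le> M" and inj: "inj_on x {1..M}"
  shows "separation_distance M x > 0"
    and "\<And>j k. j \<in> {1..M} \<Longrightarrow> k \<in> {1..M} \<Longrightarrow> j \<noteq> k \<Longrightarrow> 2 * separation_distance M x \<le> norm (x j - x k)"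
proof -
  let ?S = "{norm (x j - x k) | j k. j \<in> {1..M} \<and> k \<in> {1..M} \<and> j \<noteq> k}"
  have "?S \<subseteq> (\<lambda>(j, k). norm (x j - x k)) ` ({1..M} \<times> {1..M})" by auto
  then have fin: "finite ?S" by (rule finite_subset) auto
  have "norm (x 1 - x 2) \<in> ?S" using M by (intro CollectI exI[of _ "1::nat"] exI[of _ "2::nat"]) auto
  then have ne: "?S \<noteq> {}" by blast
  have "0 < r" if r: "r \<in> ?S" for r
  proof -
    obtain j k where jk: "r = norm (x j - x k)" "j \<in> {1..M}" "k \<in> {1..M}" "j \<noteq> k" using r by blast
    then have "x j \<noteq> x k" using inj_onD[OF inj] by blast
    then show ?thesis using jk(1) by simp
  qed
  then show "separation_distance M x > 0"
    unfolding separation_distance_def using Min_in[OF fin ne] by auto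
  fix j k assume "j \<in> {1..M}" "k \<in> {1..M}" "j \<noteq> k"
  then have "norm (x j - x k) \<in> ?S" by blast
  then show "2 * separation_distance M x \<le> norm (x j - x k)"
    unfolding separation_distance_def using Min_le[OF fin] by simp
qed

theorem theorem5p5:
  fixes \<Omega> :: "(real ^ 'n) set" and \<nu> \<delta> \<tau> :: real and k :: nat
  assumes dim: "CARD('n) \<ge> 2"
    and domain: "open \<Omega>" "connected \<Omega>" "\<Omega> \<noteq> {}" "bounded \<Omega>"
    and viscosity: "\<nu> > 0"
    and scaling: "\<delta> > 0"
    and smoothness: "k \<ge> 2" "\<tau> = (real CARD('n) + 3) / 2 + real k"
  shows "\<exists>C>0. \<forall>(N::nat) (M::nat) (x :: nat \<Rightarrow> real ^ 'n).
           N \<le> M \<longrightarrow> 2 \<le> M \<longrightarrow> inj_on x {1..M} \<longrightarrow>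
           (\<forall>j\<in>{1..N}. x j \<in> \<Omega>) \<longrightarrow> (\<forall>j\<in>{N+1..M}. x j \<in> frontier \<Omega>) \<longrightarrow>
           lambda_min (colloc_matrix k \<delta> \<nu> N M x)
             \<ge> C * (separation_distance M x / \<delta>) powr (2 * \<tau> + 2)
                 * separation_distance M x powr (- real CARD('n) - 2)"
proof -
  \<comment> \<open>All centres lie in the closure of the domain, so R bounds the separation
    distance of every admissible point set; this keeps the constant independent of the
    points.\<close>
  obtain R where R: "R > 0" "\<And>y. y \<in> closure \<Omega> \<Longrightarrow> norm y \<le> R"
    using bounded_closure[OF domain(4)] unfolding bounded_pos by blast
  obtain C where C: "C > 0" "\<And>N M (x :: nat \<Rightarrow> real ^ 'n) q. M > 0 \<Longrightarrow> 0 < q \<Longrightarrow> q \<le> R \<Longrightarrow>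
     (\<forall>j\<in>{1..M}. \<forall>j'\<in>{1..M}. j \<noteq> j' \<longrightarrow> 2 * q \<le> norm (x j - x j')) \<Longrightarrow>
     C * q ^ (2 * k + 3) \<le> lambda_min (colloc_matrix k \<delta> \<nu> N M x)"
    using colloc_lower[where 'n = 'n, OF dim scaling smoothness(1) R(1), of \<nu>] by blast
  define a where "a = 2 * \<tau> + 2"
  have "C * \<delta> powr a * (separation_distance M x / \<delta>) powr a * separation_distance M x powr (- real CARD('n) - 2)
      \<le> lambda_min (colloc_matrix k \<delta> \<nu> N M x)"
    if M: "2 \<le> M" and NM: "N \<le> M" and inj: "inj_on x {1..M}"
      and int: "\<forall>j\<in>{1..N}. x j \<in> \<Omega>" and bd: "\<forall>j\<in>{N+1..M}. x j \<in> frontier \<Omega>" for N M and x :: "nat \<Rightarrow> real ^ 'n"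
  proof -
    define q where "q = separation_distance M x"
    note sep = separation_distance_bounds[OF M inj, folded q_def]
    have cl: "x j \<in> closure \<Omega>" if "j \<in> {1..M}" for j
      using that int bd closure_subset[of \<Omega>] by (cases "j \<le> N") (auto simp: frontier_def)
    have "2 * q \<le> norm (x 1 - x 2)" using M by (intro sep(2)) auto
    also have "\<dots> \<le> norm (x 1) + norm (x 2)" by (rule norm_triangle_ineq4)
    also have "\<dots> \<le> R + R" using M by (intro add_mono R(2) cl) auto
    finally have qR: "q \<le> R" by simp
    have "\<delta> powr a * (q / \<delta>) powr a * q powr (- real CARD('n) - 2) = q powr a * q powr (- real CARD('n) - 2)"
      using scaling sep(1) by (simp add: powr_divide)
    also have "\<dots> = q powr real (2 * k + 3)"
    proof -
      \<comment> \<open>Here 2 \<tau> = d + 3 + 2 k, so the dimension cancels and the rate of the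
        velocity block remains.\<close>
      have "a + (- real CARD('n) - 2) = real (2 * k + 3)"
        unfolding a_def smoothness(2) by (simp add: field_simps)
      then show ?thesis by (simp only: powr_add[symmetric])
    qed
    also have "\<dots> = q ^ (2 * k + 3)" using sep(1) by (rule powr_realpow)
    finally have "C * \<delta> powr a * (q / \<delta>) powr a * q powr (- real CARD('n) - 2) = C * q ^ (2 * k + 3)"
      by (simp only: mult.assoc)
    also have "\<dots> \<le> lambda_min (colloc_matrix k \<delta> \<nu> N M x)"
      using M sep qR by (intro C(2)) auto
    finally show ?thesis unfolding q_def .
  qed
  \<comment> \<open>The final constant carries the factor \<delta>^a, which cancels the division by
    \<delta> in the bound; it may depend on \<delta>, but not on the point set.\<close>
  moreover have "C * \<delta> powr a > 0" using C(1) scaling by simp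
  ultimately show ?thesis unfolding a_def by blast
qed

end
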